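(* For the binary erasure multiple access channel with noiseless feedback, $Y=X_1+X_2$ with $X_1,X_2\in\{0,1\}$ and ordinary integer addition, the capacity region equals $$\bigcup_{u_1,u_2\in[0,\frac14]}\Bigl\{(R_1,R_2):\ R_1\le h(\phi(2u_1)),\ R_2\le h(\phi(2u_2)),\ R_1+R_2\le h(f(2u_1,2u_2))+1-f(2u_1,2u_2)\Bigr\}.$$ Moreover, the entire capacity region is obtained with a binary and uniform auxiliary random variable $T$: it equals the union, over $u_1,u_2\in[0,\frac14]$, of the sets of rate pairs satisfying $R_1\le H(X_1|T)$, $R_2\le H(X_2|T)$, $R_1+R_2\le H(Y)$, where $T$ is uniform on $\{0,1\}$, $X_1$ and $X_2$ are conditionally independent given $T$, $\Pr(X_1=0|T=0)=1-\Pr(X_1=0|T=1)=\phi(2u_1)$ and $\Pr(X_2=0|T=0)=1-\Pr(X_2=0|T=1)=\phi(2u_2)$.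
   Context: All logarithms and entropies are to base 2. $h(s)=-s\log s-(1-s)\log(1-s)$ is the binary entropy function on $[0,1]$ (with $0\log0=0$). The function $\phi:[0,1]\to[0,\frac12]$ is $\phi(s)=\frac{1-\sqrt{1-2s}}{2}$ for $0\le s\le\frac12$ and $\phi(s)=\frac{1-\sqrt{2s-1}}{2}$ for $\frac12<s\le1$. For $x,y\in[0,\frac12]$, $f(x,y)=\phi(x)+\phi(y)-2\phi(x)\phi(y)=\frac{1-\sqrt{(1-2x)(1-2y)}}{2}$. A discrete memoryless two-user multiple access channel with noiseless feedback (MAC-FB) consists of finite input alphabets $\mathcal X_1,\mathcal X_2$, a finite output alphabet $\mathcal Y$ and a transition law $p(y|x_1,x_2)$, used memorylessly. For the channel here $\mathcal X_1=\mathcal X_2=\{0,1\}$, $\mathcal Y=\{0,1,2\}$. An $(n,M_1,M_2,P_e)$ code consists of message sets $\mathcal M_k=\{1,\dots,M_k\}$ ($k=1,2$), encoding functions $e_{ki}:\mathcal M_k\times\mathcal Y^{i-1}\to\mathcal X_k$ for $k=1,2$ and $i=1,\dots,n$ (the $i$-th input of user $k$ is $e_{ki}(W_k,Y_1,\dots,Y_{i-1})$), and a decoder $g:\mathcal Y^n\to\mathcal M_1\times\mathcal M_2$. The messages $W_1,W_2$ are independent and uniform on $\mathcal M_1,\mathcal M_2$, and $P_e=\Pr(g(Y^n)\ne(W_1,W_2))$. A pair $(R_1,R_2)$ of nonnegative reals is achievable if for every $\epsilon>0$ and all sufficiently large $n$ there is a code with $R_1\le \log(M_1)/n$, $R_2\le\log(M_2)/n$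 and $P_e\le\epsilon$. The capacity region is the closure of the set of achievable pairs. All rate pairs are pairs of nonnegative reals. *)

theory Defs
  imports "HOL-Probability.Probability"
begin

(* At s = 0 and s = 1 the convention 0 log 0 = 0 holds automatically. *)
definition binary_entropy :: "real \<Rightarrow> real" where
  "binary_entropy s = - s * log 2 s - (1 - s) * log 2 (1 - s)"

(* Only arguments in [0, 1] matter. *)
definition phi :: "real \<Rightarrow> real" where
  "phi s = (if s \<le> 1 / 2 then (1 - sqrt (1 - 2 * s)) / 2 else (1 - sqrt (2 * s - 1)) / 2)"

definition phi_cross :: "real \<Rightarrow> real \<Rightarrow> real" where
  "phi_cross x y = phi x + phi y - 2 * phi x * phi y"

locale mac_fb =
  fixes X1 :: "'a set" and X2 :: "'b set" and Y :: "'c set"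
    and p :: "'a \<Rightarrow> 'b \<Rightarrow> 'c pmf"
  assumes finite_alphabets: "finite X1" "finite X2" "finite Y"
    and nonempty_alphabets: "X1 \<noteq> {}" "X2 \<noteq> {}"
    and law_support: "\<And>x1 x2. x1 \<in> X1 \<Longrightarrow> x2 \<in> X2 \<Longrightarrow> set_pmf (p x1 x2) \<subseteq> Y"
begin

definition words :: "nat \<Rightarrow> 'c list set" where
  "words n = {ys. length ys = n \<and> set ys \<subseteq> Y}"

definition feedback_encoder ::
  "'x set \<Rightarrow> nat \<Rightarrow> nat \<Rightarrow> (nat \<Rightarrow> nat \<Rightarrow> 'c list \<Rightarrow> 'x) \<Rightarrow> bool" where
  "feedback_encoder X n M e \<longleftrightarrow>
     (\<forall>i\<in>{1..n}. \<forall>w\<in>{1..M}. \<forall>ys\<in>words (i - 1). e i w ys \<in> X)"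

definition is_code ::
  "nat \<Rightarrow> nat \<Rightarrow> nat \<Rightarrow> (nat \<Rightarrow> nat \<Rightarrow> 'c list \<Rightarrow> 'a) \<Rightarrow> (nat \<Rightarrow> nat \<Rightarrow> 'c list \<Rightarrow> 'b) \<Rightarrow>
   ('c list \<Rightarrow> nat \<times> nat) \<Rightarrow> bool" where
  "is_code n M1 M2 e1 e2 g \<longleftrightarrow> M1 \<ge> 1 \<and> M2 \<ge> 1 \<and>
     feedback_encoder X1 n M1 e1 \<and> feedback_encoder X2 n M2 e2 \<and>
     (\<forall>ys\<in>words n. g ys \<in> {1..M1} \<times> {1..M2})"

(* Law of the first i outputs, oldest first, for fixed messages w1, w2. *)
primrec output_law ::
  "(nat \<Rightarrow> nat \<Rightarrow> 'c list \<Rightarrow> 'a) \<Rightarrow> (nat \<Rightarrow> nat \<Rightarrow> 'c list \<Rightarrow> 'b) \<Rightarrow> nat \<Rightarrow> nat \<Rightarrow> nat \<Rightarrow> 'c list pmf" where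
  "output_law e1 e2 w1 w2 0 = return_pmf []"
| "output_law e1 e2 w1 w2 (Suc i) =
     do { ys \<leftarrow> output_law e1 e2 w1 w2 i;
          y \<leftarrow> p (e1 (Suc i) w1 ys) (e2 (Suc i) w2 ys);
          return_pmf (ys @ [y]) }"

definition message_output_law ::
  "nat \<Rightarrow> nat \<Rightarrow> nat \<Rightarrow> (nat \<Rightarrow> nat \<Rightarrow> 'c list \<Rightarrow> 'a) \<Rightarrow> (nat \<Rightarrow> nat \<Rightarrow> 'c list \<Rightarrow> 'b) \<Rightarrow>
   ((nat \<times> nat) \<times> 'c list) pmf" where
  "message_output_law n M1 M2 e1 e2 =
     do { w1 \<leftarrow> pmf_of_set {1..M1};
          w2 \<leftarrow> pmf_of_set {1..M2};
          ys \<leftarrow> output_law e1 e2 w1 w2 n;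
          return_pmf ((w1, w2), ys) }"

definition error_prob ::
  "nat \<Rightarrow> nat \<Rightarrow> nat \<Rightarrow> (nat \<Rightarrow> nat \<Rightarrow> 'c list \<Rightarrow> 'a) \<Rightarrow> (nat \<Rightarrow> nat \<Rightarrow> 'c list \<Rightarrow> 'b) \<Rightarrow>
   ('c list \<Rightarrow> nat \<times> nat) \<Rightarrow> real" where
  "error_prob n M1 M2 e1 e2 g =
     \<P>((w, ys) in measure_pmf (message_output_law n M1 M2 e1 e2). g ys \<noteq> w)"

definition achievable :: "real \<Rightarrow> real \<Rightarrow> bool" where
  "achievable R1 R2 \<longleftrightarrow> R1 \<ge> 0 \<and> R2 \<ge> 0 \<and>
     (\<forall>\<epsilon>>0. \<forall>\<^sub>F n in sequentially. \<exists>M1 M2 e1 e2 g.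
        is_code n M1 M2 e1 e2 g \<and>
        R1 \<le> log 2 (real M1) / real n \<and> R2 \<le> log 2 (real M2) / real n \<and>
        error_prob n M1 M2 e1 e2 g \<le> \<epsilon>)"

definition capacity_region :: "(real \<times> real) set" where
  "capacity_region = closure {(R1, R2). achievable R1 R2}"

end

interpretation binary_erasure:
  mac_fb "{0, 1 :: nat}" "{0, 1 :: nat}" "{0, 1, 2 :: nat}" "\<lambda>x1 x2. return_pmf (x1 + x2)"
  by unfold_locales auto

(* The reference measure count_space UNIV makes the library's entropies the
   discrete ones for random variables with countably many values. *)
abbreviation pmf_entropy :: "'w pmf \<Rightarrow> ('w \<Rightarrow> nat) \<Rightarrow> real" where
  "pmf_entropy P X \<equiv> prob_space.entropy (measure_pmf P) 2 (count_space UNIV) X"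

abbreviation pmf_cond_entropy :: "'w pmf \<Rightarrow> ('w \<Rightarrow> nat) \<Rightarrow> ('w \<Rightarrow> nat) \<Rightarrow> real" where
  "pmf_cond_entropy P X T \<equiv>
     prob_space.conditional_entropy (measure_pmf P) 2 (count_space UNIV) (count_space UNIV) X T"

(* P is the joint law of (T, X1, X2). *)
definition uniform_aux_law :: "real \<Rightarrow> real \<Rightarrow> (nat \<times> nat \<times> nat) pmf \<Rightarrow> bool" where
  "uniform_aux_law a1 a2 P \<longleftrightarrow>
     set_pmf P \<subseteq> {0, 1} \<times> {0, 1} \<times> {0, 1} \<and>
     map_pmf fst P = pmf_of_set {0, 1} \<and>
     (\<forall>t\<in>{0, 1}. \<forall>a\<in>{0, 1}. \<forall>b\<in>{0, 1}.
        \<P>((T, X1, X2) in measure_pmf P. X1 = a \<and> X2 = b \<bar> T = t) =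
        \<P>((T, X1, X2) in measure_pmf P. X1 = a \<bar> T = t) *
        \<P>((T, X1, X2) in measure_pmf P. X2 = b \<bar> T = t)) \<and>
     \<P>((T, X1, X2) in measure_pmf P. X1 = 0 \<bar> T = 0) = a1 \<and>
     1 - \<P>((T, X1, X2) in measure_pmf P. X1 = 0 \<bar> T = 1) = a1 \<and>
     \<P>((T, X1, X2) in measure_pmf P. X2 = 0 \<bar> T = 0) = a2 \<and>
     1 - \<P>((T, X1, X2) in measure_pmf P. X2 = 0 \<bar> T = 1) = a2"

end

theory Submission
  imports Defs
begin

text \<open>
  Converse. Since \<open>Y = X\<^sub>1 + X\<^sub>2\<close>, either input is determined by the other one and the output, so the
  message pairs with a given history of both inputs form a rectangle: given the past inputs the two
  current inputs are independent. Hence the rates are bounded by averages of the entropies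
  of independent bits with parameters \<open>p\<close> and \<open>q\<close>, and the sum rate by the entropy of the output. Because
  \<open>h ((1 - sqrt t) / 2)\<close> is concave in \<open>t\<close>, averaging \<open>(1 - 2p)\<^sup>2\<close> only increases the individual bounds,
  and by the Cauchy-Schwarz inequality it only decreases the probability of an erasure; if this
  probability drops below the maximiser \<open>1/3\<close> of the output entropy, larger parameters raise it again.

  Achievability. Trading one parameter for the other, one may assume \<open>R\<^sub>1 = h a\<close>, so that user 1 can use
  all words of weight \<open>a N\<close> and user 2 any set of words of weight \<open>b N\<close>. The message pair of a block is known
  to both users after the block; it selects the permutation and the translation that
  scramble the words of the next block. The outputs of a block and its messages determine the pair that
  selected the scrambling, as long as there are fewer pairs than outputs with the typical number of erasures,
  and the receiver decodes the blocks backwards.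
\<close>

section \<open>Entropy functions and the single-letter optimisation\<close>

text \<open>All laws are uniform on finite sets and the channel is deterministic, so the proof
  counts: an entropy is a sum of logarithms of \<open>card A / card fiber\<close>, and conditional
  independence says that a fiber is a rectangle. The fibers are those of the input histories. Those
  of the output words would not do, because an erased position couples the two inputs. Fano's
  inequality still applies, because with one message fixed the outputs reveal the other user's
  inputs.

  For achievability, feedback acts only between blocks: subtracting its own inputs, each user learns
  the other message, whatever the sum rate. The sum bound enters only when the receiver must
  recognise the scrambling among about 2 to the power \<open>N * erasure_entropy s\<close> outputs
  with typical erasure frequency \<open>s\<close>. So the erasure number of the unscrambled words
  must be controlled. It concentrates for every fixed word of user 2 if user 1 draws from a complete
  weight class, whereas two arbitrary sets of words could be badly correlated. This is why the first
  rate is made to exhaust its parameter.\<close>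

lemma continuous_on_mult_log: "continuous_on {0..1} (\<lambda>x::real. x * log 2 x)"
proof (unfold continuous_on_eq_continuous_within, rule ballI)
  fix x :: real assume x: "x \<in> {0..1}"
  show "continuous (at x within {0..1}) (\<lambda>x. x * log 2 x)"
  proof (cases "x = 0")
    case True
    have "((\<lambda>x::real. x * log 2 x) \<longlongrightarrow> 0) (at_right 0)"
      by real_asymp
    then have "((\<lambda>x::real. x * log 2 x) \<longlongrightarrow> 0) (at 0 within {0..})"
      by (simp add: at_within_Ici_at_right)
    then have "((\<lambda>x::real. x * log 2 x) \<longlongrightarrow> 0) (at 0 within {0..1})"
      by (rule tendsto_within_subset) auto
    then show ?thesis
      using True by (simp add: continuous_within)
  next
    case False
    then show ?thesis
      using x by (auto intro!: continuous_intros)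
  qed
qed

lemma continuous_on_binary_entropy: "continuous_on {0..1} binary_entropy"
proof -
  have "continuous_on {0..1} (\<lambda>x::real. (1 - x) * log 2 (1 - x))"
    by (rule continuous_on_compose2[OF continuous_on_mult_log, where f = "\<lambda>x. 1 - x"])
       (auto intro!: continuous_intros)
  then have "continuous_on {0..1} (\<lambda>s::real. - (s * log 2 s) - (1 - s) * log 2 (1 - s))"
    by (intro continuous_on_diff continuous_on_minus continuous_on_mult_log)
  then show ?thesis
    by (simp add: binary_entropy_def[abs_def])
qed

lemma binary_entropy_0 [simp]: "binary_entropy 0 = 0"
  by (simp add: binary_entropy_def)

lemma binary_entropy_half [simp]: "binary_entropy (1/2) = 1"
  by (simp add: binary_entropy_def log_divide)

lemma binary_entropy_sym: "binary_entropy (1 - s) = binary_entropy s"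
  by (simp add: binary_entropy_def algebra_simps)

lemma binary_entropy_has_derivative:
  assumes "0 < s" "s < 1"
  shows "(binary_entropy has_real_derivative log 2 ((1 - s) / s)) (at s)"
proof -
  have "((\<lambda>s. (- s * ln s - (1 - s) * ln (1 - s)) / ln 2) has_real_derivative
      (ln (1 - s) - ln s) / ln 2) (at s)"
    using assms by (auto intro!: derivative_eq_intros)
  moreover have "(\<lambda>s. (- s * ln s - (1 - s) * ln (1 - s)) / ln 2) = binary_entropy"
    by (auto simp: binary_entropy_def log_def diff_divide_distrib)
  ultimately show ?thesis using assms by (simp add: log_def ln_div)
qed

lemma binary_entropy_mono:
  assumes "0 \<le> x" "x \<le> y" "y \<le> 1/2"
  shows "binary_entropy x \<le> binary_entropy y"
proof (rule DERIV_nonneg_imp_increasing_open[OF assms(2)])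
  fix s assume s: "x < s" "s < y"
  have "log 2 ((1 - s) / s) \<ge> 0"
    using s assms by (subst zero_le_log_cancel_iff) (auto simp: field_simps)
  then show "\<exists>z. (binary_entropy has_real_derivative z) (at s) \<and> 0 \<le> z"
    using binary_entropy_has_derivative[of s] s assms by auto
next
  show "continuous_on {x..y} binary_entropy"
    by (rule continuous_on_subset[OF continuous_on_binary_entropy]) (use assms in auto)
qed

lemma binary_entropy_nonneg: "0 \<le> s \<Longrightarrow> s \<le> 1 \<Longrightarrow> 0 \<le> binary_entropy s"
  using binary_entropy_mono[of 0 s] binary_entropy_mono[of 0 "1 - s"] binary_entropy_sym[of s]
  by (cases "s \<le> 1/2") auto

text \<open>The entropy of a symmetric ternary variable whose erasure symbol has probability \<open>s\<close>.\<close>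
definition erasure_entropy :: "real \<Rightarrow> real" where
  "erasure_entropy s = binary_entropy s + 1 - s"

lemma continuous_on_erasure_entropy: "continuous_on {0..1} erasure_entropy"
  unfolding erasure_entropy_def[abs_def] by (intro continuous_intros continuous_on_binary_entropy)

lemma erasure_entropy_has_derivative:
  assumes "0 < s" "s < 1"
  shows "(erasure_entropy has_real_derivative log 2 ((1 - s) / s) - 1) (at s)"
  unfolding erasure_entropy_def[abs_def]
  by (auto intro!: derivative_eq_intros binary_entropy_has_derivative assms)

text \<open>The derivative \<open>log 2 ((1 - s) / s) - 1\<close> changes sign where
  \<open>(1 - s) / s = 2\<close>, which is the origin of \<open>1/3\<close>.\<close>

lemma erasure_entropy_mono:
  assumes "0 \<le> x" "x \<le> y" "y \<le> 1/3"
  shows "erasure_entropy x \<le> erasure_entropy y"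
proof (rule DERIV_nonneg_imp_increasing_open[OF assms(2)])
  fix s assume s: "x < s" "s < y"
  have "log 2 ((1 - s) / s) \<ge> 1"
    using s assms by (subst one_le_log_cancel_iff) (auto simp: field_simps)
  then show "\<exists>z. (erasure_entropy has_real_derivative z) (at s) \<and> 0 \<le> z"
    using erasure_entropy_has_derivative[of s] s assms by auto
next
  show "continuous_on {x..y} erasure_entropy"
    by (rule continuous_on_subset[OF continuous_on_erasure_entropy]) (use assms in auto)
qed

lemma erasure_entropy_antimono:
  assumes "1/3 \<le> x" "x \<le> y" "y \<le> 1"
  shows "erasure_entropy y \<le> erasure_entropy x"
proof (rule DERIV_nonpos_imp_decreasing_open[OF assms(2)])
  fix s assume s: "x < s" "s < y"
  have "log 2 ((1 - s) / s) \<le> 1"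
    using s assms by (subst log_le_one_cancel_iff) (auto simp: field_simps)
  then show "\<exists>z. (erasure_entropy has_real_derivative z) (at s) \<and> z \<le> 0"
    using erasure_entropy_has_derivative[of s] s assms by auto
next
  show "continuous_on {x..y} erasure_entropy"
    by (rule continuous_on_subset[OF continuous_on_erasure_entropy]) (use assms in auto)
qed

lemma erasure_entropy_ge_1: "0 \<le> s \<Longrightarrow> s \<le> 1/2 \<Longrightarrow> 1 \<le> erasure_entropy s"
  using erasure_entropy_mono[of 0 s] erasure_entropy_antimono[of s "1/2"]
  by (cases "s \<le> 1/3") (auto simp: erasure_entropy_def)

lemma erasure_entropy_le_third: "0 \<le> s \<Longrightarrow> s \<le> 1 \<Longrightarrow> erasure_entropy s \<le> erasure_entropy (1/3)"
  using erasure_entropy_mono[of s "1/3"] erasure_entropy_antimono[of "1/3" s]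
  by (cases "s \<le> 1/3") auto

section \<open>Concavity of the entropy in the squared bias\<close>

text \<open>This function is \<open>2 * artanh s\<close>, with the increasing derivative
  \<open>2 / (1 - s^2)\<close>. It appears when \<open>binary_entropy ((1 - sqrt t) / 2)\<close> is
  differentiated.\<close>

lemma convex_on_log_ratio: "convex_on {0..<1} (\<lambda>s::real. ln (1 + s) - ln (1 - s))"
proof (rule convex_on_realI)
  show "((\<lambda>s. ln (1 + s) - ln (1 - s)) has_real_derivative 1/(1+s) + 1/(1-s)) (at s)"
    if "s \<in> {0..<1}" for s :: real
    using that by (auto intro!: derivative_eq_intros)
  show "1/(1+x) + 1/(1-x) \<le> 1/(1+y) + 1/(1-y)"
    if "x \<in> {0..<1}" "y \<in> {0..<1}" "x \<le> y" for x y :: real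
  proof -
    have "x\<^sup>2 \<le> y\<^sup>2" "y\<^sup>2 < 1"
      using that by (auto intro: power_mono simp: abs_square_less_1)
    then have "2/(1 - x\<^sup>2) \<le> 2/(1 - y\<^sup>2)"
      by (intro divide_left_mono mult_pos_pos) auto
    moreover have "1/(1+z) + 1/(1-z) = 2/(1 - z\<^sup>2)" if "z \<in> {0..<1}" for z :: real
    proof -
      have "1 - z\<^sup>2 = (1+z)*(1-z)" by (simp add: power2_eq_square algebra_simps)
      then show ?thesis using that by (simp add: add_frac_eq)
    qed
    ultimately show ?thesis using that by simp
  qed
qed auto

text \<open>A convex function that vanishes at 0 has increasing slopes of chords from the
  origin.\<close>

lemma log_ratio_div_mono:
  fixes x y :: real
  assumes "0 < x" "x \<le> y" "y < 1"
  shows "(ln (1 + x) - ln (1 - x)) / x \<le> (ln (1 + y) - ln (1 - y)) / y"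
proof -
  have "ln (1 + x) - ln (1 - x) \<le> (x / y) * (ln (1 + y) - ln (1 - y))"
    using convex_onD[OF convex_on_log_ratio, of "x/y" 0 y] assms by auto
  then show ?thesis using assms by (simp add: field_simps)
qed

text \<open>By the chain rule the derivative of the negated function is, up to the factor
  \<open>1 / (4 * ln 2)\<close>, the chord slope of the log ratio at \<open>sqrt t\<close>, hence
  increasing. The end points are excluded: \<open>sqrt\<close> has no derivative at 0, and at 1 the
  entropy is evaluated at 0, where its slope is infinite.\<close>

lemma concave_on_entropy_sqrt_open: "concave_on {0<..<1} (\<lambda>t. binary_entropy ((1 - sqrt t) / 2))"
  unfolding concave_on_def
proof (rule convex_on_realI)
  let ?f' = "\<lambda>t. (ln (1 + sqrt t) - ln (1 - sqrt t)) / sqrt t / (4 * ln 2)"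
  show "((\<lambda>t. - binary_entropy ((1 - sqrt t) / 2)) has_real_derivative ?f' t) (at t)"
    if t: "t \<in> {0<..<1}" for t
  proof -
    have s: "0 < sqrt t" "sqrt t < 1" using t by (auto simp: real_sqrt_lt_1_iff)
    have d: "((\<lambda>t. (1 - sqrt t)/2) has_real_derivative - (1 / (4 * sqrt t))) (at t)"
      using t by (auto intro!: derivative_eq_intros simp: field_simps)
    have "(binary_entropy has_real_derivative log 2 ((1 - (1 - sqrt t)/2) / ((1 - sqrt t)/2))) (at ((1 - sqrt t)/2))"
      by (rule binary_entropy_has_derivative) (use s less_trans[of "-1" 0 "sqrt t"] in auto)
    from DERIV_minus[OF DERIV_chain2[OF this d]]
    have "((\<lambda>t. - binary_entropy ((1 - sqrt t) / 2)) has_real_derivative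
       - (log 2 ((1 - (1 - sqrt t)/2) / ((1 - sqrt t)/2)) * - (1 / (4 * sqrt t)))) (at t)" .
    also have "(1 - (1 - sqrt t)/2) / ((1 - sqrt t)/2) = (1 + sqrt t) / (1 - sqrt t)"
      using s by (simp add: divide_simps) (simp add: algebra_simps)?
    also have "- (log 2 ((1 + sqrt t) / (1 - sqrt t)) * - (1 / (4 * sqrt t))) = ?f' t"
    proof -
      have "ln ((1 + sqrt t) / (1 - sqrt t)) = ln (1 + sqrt t) - ln (1 - sqrt t)"
        by (intro ln_divide_pos) (use s in linarith)+
      then show ?thesis by (simp add: log_def)
    qed
    finally show ?thesis .
  qed
  show "?f' x \<le> ?f' y" if "x \<in> {0<..<1}" "y \<in> {0<..<1}" "x \<le> y" for x y
    by (intro divide_right_mono log_ratio_div_mono) (use that in \<open>auto simp: real_sqrt_lt_1_iff\<close>)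
qed auto

text \<open>The end points are added by continuity. The contraction \<open>P\<close> towards
  \<open>1/2\<close> maps the closed interval into the open one for \<open>e > 0\<close> and
  commutes with convex combinations, so the inequality holds for the contracted points and survives
  \<open>e\<close> tending to 0.\<close>

lemma concave_on_entropy_sqrt: "concave_on {0..1} (\<lambda>t. binary_entropy ((1 - sqrt t) / 2))"
proof -
  define k where "k = (\<lambda>t. binary_entropy ((1 - sqrt t) / 2))"
  have cont: "continuous_on {0..1} k"
    unfolding k_def
  proof (rule continuous_on_compose2[OF continuous_on_binary_entropy])
    have "(1 - sqrt t) / 2 \<in> {0..1}" if "t \<in> {0..1}" for t
    proof -
      have *: "0 \<le> s \<Longrightarrow> s \<le> 1 \<Longrightarrow> (1 - s) / 2 \<in> {0..1}" for s :: real by auto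
      show ?thesis by (rule *) (use that in auto)
    qed
    then show "(\<lambda>t. (1 - sqrt t) / 2) ` {0..1} \<subseteq> {0..1}" by blast
  qed (auto intro!: continuous_intros)
  have "u * k x + v * k y \<le> k (u * x + v * y)"
    if xy: "x \<in> {0..1}" "y \<in> {0..1}" and uv: "u \<ge> 0" "v \<ge> 0" "u + v = 1" for x y u v :: real
  proof -
    define P where "P = (\<lambda>x e. (1 - e) * x + e / 2 :: real)"
    have P01: "P x e \<in> {0..1}" if "x \<in> {0..1}" "e \<in> {0..1}" for x e
    proof -
      have "(1 - e) * x \<le> (1 - e)" "(1 - e) * x \<ge> 0" using that by (auto intro: mult_left_le)
      then show ?thesis using that unfolding P_def atLeastAtMost_iff by auto
    qed
    have P01': "P x e \<in> {0<..<1}" if "x \<in> {0..1}" "e \<in> {0<..1}" for x e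
    proof -
      have "(1 - e) * x \<le> (1 - e)" "(1 - e) * x \<ge> 0" using that by (auto intro: mult_left_le)
      then show ?thesis using that unfolding P_def greaterThanLessThan_iff by auto
    qed
    have lin: "P (u * x + v * y) e = u * P x e + v * P y e" for e
    proof -
      have "u * P x e + v * P y e = (1 - e) * (u * x + v * y) + (u + v) * (e / 2)"
        by (simp add: P_def algebra_simps)
      then show ?thesis by (simp add: uv P_def)
    qed
    have z: "u * x + v * y \<in> {0..1}"
      using xy uv convexD[OF convex_real_interval(5), of x 0 1 y u v] by simp
    have contP: "continuous_on {0..1} (\<lambda>e. k (P x e))" if "x \<in> {0..1}" for x
      by (rule continuous_on_compose2[OF cont])
         (use P01 that in \<open>auto intro!: continuous_intros simp: P_def\<close>)
    define \<psi> where "\<psi> = (\<lambda>e. k (P (u * x + v * y) e) - u * k (P x e) - v * k (P y e))"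
    have c: "continuous_on {0..1} \<psi>"
      unfolding \<psi>_def by (intro continuous_intros contP xy z)
    have nn: "\<psi> e \<ge> 0" if "e \<in> {0<..1}" for e
    proof -
      have "k (u *\<^sub>R P x e + v *\<^sub>R P y e) \<ge> u * k (P x e) + v * k (P y e)"
        using concave_on_entropy_sqrt_open P01'[OF xy(1) that] P01'[OF xy(2) that] uv
        unfolding concave_on_iff k_def by blast
      then show ?thesis by (simp only: \<psi>_def lin real_scaleR_def)
    qed
    have "(\<psi> \<longlongrightarrow> \<psi> 0) (at 0 within {0..1})"
      using c by (auto simp: continuous_on)
    then have "(\<psi> \<longlongrightarrow> \<psi> 0) (at_right 0)"
      by (simp add: at_within_Icc_at_right)
    then have "\<psi> 0 \<ge> 0"
    proof (rule tendsto_lowerbound)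
      show "\<forall>\<^sub>F e in at_right 0. 0 \<le> \<psi> e"
        by (rule eventually_at_rightI[of 0 1]) (auto intro: nn)
    qed simp
    then show ?thesis by (simp add: \<psi>_def P_def)
  qed
  then show ?thesis
    unfolding concave_on_iff k_def by (auto simp: convex_real_interval)
qed

text \<open>The probability that two independent bits with parameters \<open>a\<close> and \<open>b\<close> differ.\<close>
definition bconv :: "real \<Rightarrow> real \<Rightarrow> real" where
  "bconv a b = a + b - 2 * a * b"

text \<open>In terms of the biases \<open>1 - 2 * a\<close> the operation is multiplication, the
  form in which monotonicity and the Cauchy-Schwarz inequality apply.\<close>

lemma bconv_altdef: "bconv a b = (1 - (1 - 2 * a) * (1 - 2 * b)) / 2"
  by (simp add: bconv_def field_simps)

lemma bconv_half [simp]: "bconv a (1/2) = 1/2" "bconv (1/2) b = 1/2"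
  by (simp_all add: bconv_def)

lemma bconv_nonneg: "a \<in> {0..1} \<Longrightarrow> b \<in> {0..1} \<Longrightarrow> 0 \<le> bconv a b"
proof -
  assume "a \<in> {0..1}" "b \<in> {0..1}"
  then have "0 \<le> a * (1 - b) + b * (1 - a)" by simp
  then show ?thesis by (simp add: bconv_def algebra_simps)
qed

lemma bconv_le_1: "a \<in> {0..1} \<Longrightarrow> b \<in> {0..1} \<Longrightarrow> bconv a b \<le> 1"
proof -
  assume "a \<in> {0..1}" "b \<in> {0..1}"
  then have "0 \<le> a * b + (1 - b) * (1 - a)" by simp
  then show ?thesis by (simp add: bconv_def algebra_simps)
qed

lemma bconv_le_half: "a \<in> {0..1/2} \<Longrightarrow> b \<in> {0..1/2} \<Longrightarrow> bconv a b \<le> 1/2"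
  unfolding bconv_altdef by simp

lemma bconv_mono_left: "a \<le> a' \<Longrightarrow> b \<le> 1/2 \<Longrightarrow> bconv a b \<le> bconv a' b"
  unfolding bconv_altdef by (auto intro: mult_right_mono)

text \<open>
  Increasing both parameters keeps the individual rates admissible and moves the erasure
  probability from below towards the maximiser \<open>1/3\<close> of the output entropy.
\<close>
lemma bconv_raise:
  assumes a: "a \<in> {0..1/2}" and b: "b \<in> {0..1/2}" and s: "bconv a b \<le> s" "s \<le> 1"
  shows "\<exists>a'\<in>{a..1/2}. \<exists>b'\<in>{b..1/2}. erasure_entropy s \<le> erasure_entropy (bconv a' b')"
proof (cases "bconv a b \<ge> 1/3")
  case True
  then show ?thesis using erasure_entropy_antimono[of "bconv a b" s] s a b
    by (intro bexI[of _ a] bexI[of _ b]) auto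
next
  case False
  \<comment> \<open>The segment from \<open>(a, b)\<close> to \<open>(1/2, 1/2)\<close>: along it
    the erasure probability moves from below \<open>1/3\<close> to \<open>1/2\<close>, so it meets
    \<open>s\<close> if \<open>s\<close> is below the maximiser and the maximiser otherwise.\<close>
  let ?f = "\<lambda>t. bconv (a + t * (1/2 - a)) (b + t * (1/2 - b))"
  have nn: "0 \<le> bconv a b" using a b by (intro bconv_nonneg) auto
  have "\<exists>t. 0 \<le> t \<and> t \<le> 1 \<and> ?f t = min s (1/3)"
    by (rule IVT') (use s False in \<open>auto simp: bconv_def intro!: continuous_intros\<close>)
  then obtain t where t: "0 \<le> t" "t \<le> 1" "?f t = min s (1/3)" by blast
  have "a \<le> a + t * (1/2 - a)" "b \<le> b + t * (1/2 - b)" using t a b by auto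
  moreover have "a + t * (1/2 - a) \<le> 1/2" "b + t * (1/2 - b) \<le> 1/2"
    using t a b mult_left_le_one_le[of "1/2 - a" t] mult_left_le_one_le[of "1/2 - b" t] by auto
  moreover have "erasure_entropy s \<le> erasure_entropy (min s (1/3))"
    using erasure_entropy_le_third[of s] s nn by (auto simp: min_def)
  ultimately show ?thesis using t(3) by (metis atLeastAtMost_iff)
qed

text \<open>The symmetry of the entropy makes it a function of the squared bias
  \<open>(1 - 2 * p i)^2\<close>, to which Jensen's inequality is applied.\<close>

lemma avg_binary_entropy_le:
  assumes "finite I" "I \<noteq> {}" "\<And>i. i \<in> I \<Longrightarrow> p i \<in> {0..1}"
  shows "(\<Sum>i\<in>I. binary_entropy (p i)) / card I
     \<le> binary_entropy ((1 - sqrt ((\<Sum>i\<in>I. (1 - 2 * p i)\<^sup>2) / card I)) / 2)"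
proof -
  have h: "binary_entropy (p i) = binary_entropy ((1 - sqrt ((1 - 2 * p i)\<^sup>2)) / 2)" for i
    using binary_entropy_sym[of "p i"] by (simp add: abs_if diff_divide_distrib add_divide_distrib)
  have "(1 - 2 * p i)\<^sup>2 \<in> {0..1}" if "i \<in> I" for i
    using assms(3)[OF that] by (auto simp: abs_square_le_1)
  then have "(\<Sum>i\<in>I. (1 / card I) * binary_entropy ((1 - sqrt ((1 - 2 * p i)\<^sup>2)) / 2))
      \<le> binary_entropy ((1 - sqrt (\<Sum>i\<in>I. (1 / card I) *\<^sub>R (1 - 2 * p i)\<^sup>2)) / 2)"
    by (intro concave_on_sum[OF assms(1,2) concave_on_entropy_sqrt]) (use assms in auto)
  then have "(\<Sum>i\<in>I. (1 / card I) * binary_entropy (p i))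
      \<le> binary_entropy ((1 - sqrt (\<Sum>i\<in>I. (1 / card I) *\<^sub>R (1 - 2 * p i)\<^sup>2)) / 2)"
    unfolding h[symmetric] .
  then show ?thesis by (simp add: sum_divide_distrib)
qed

lemma single_letter:
  assumes I: "finite I" "I \<noteq> {}" and p: "\<And>i. i \<in> I \<Longrightarrow> p i \<in> {0..1}" and q: "\<And>i. i \<in> I \<Longrightarrow> q i \<in> {0..1}"
  shows "\<exists>a\<in>{0..1/2}. \<exists>b\<in>{0..1/2}.
     (\<Sum>i\<in>I. binary_entropy (p i)) / card I \<le> binary_entropy a \<and>
     (\<Sum>i\<in>I. binary_entropy (q i)) / card I \<le> binary_entropy b \<and>
     erasure_entropy ((\<Sum>i\<in>I. bconv (p i) (q i)) / card I) \<le> erasure_entropy (bconv a b)"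
proof -
  define m where "m = real (card I)"
  have m: "m > 0" using I by (auto simp: m_def card_gt_0_iff)
  define A where "A = (\<Sum>i\<in>I. (1 - 2 * p i)\<^sup>2) / m"
  define B where "B = (\<Sum>i\<in>I. (1 - 2 * q i)\<^sup>2) / m"
  define s where "s = (\<Sum>i\<in>I. bconv (p i) (q i)) / m"
  have sq: "(\<Sum>i\<in>I. (1 - 2 * r i)\<^sup>2) \<le> m" if "\<And>i. i \<in> I \<Longrightarrow> r i \<in> {0..1}" for r :: "'a \<Rightarrow> real"
  proof -
    have "(1 - 2 * r i)\<^sup>2 \<le> 1" if "i \<in> I" for i
      using \<open>\<And>i. i \<in> I \<Longrightarrow> r i \<in> {0..1}\<close>[OF that] by (auto simp: abs_square_le_1)
    from sum_bounded_above[of I _ 1, OF this] show ?thesis by (simp add: m_def)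
  qed
  have A: "0 \<le> A" "A \<le> 1" using sq[of p, OF p] m by (auto simp: A_def intro!: divide_nonneg_nonneg sum_nonneg)
  have B: "0 \<le> B" "B \<le> 1" using sq[of q, OF q] m by (auto simp: B_def intro!: divide_nonneg_nonneg sum_nonneg)
  \<comment> \<open>The parameters in \<open>{0..1/2}\<close> whose squared biases are the averages
    \<open>A\<close> and \<open>B\<close>. They are the least candidates for \<open>a\<close> and
    \<open>b\<close>; \<open>bconv_raise\<close> enlarges them where necessary.\<close>
  define a0 where "a0 = (1 - sqrt A) / 2"
  define b0 where "b0 = (1 - sqrt B) / 2"
  have ab: "a0 \<in> {0..1/2}" "b0 \<in> {0..1/2}" using A B by (auto simp: a0_def b0_def)
  have "(\<Sum>i\<in>I. (1 - 2 * p i) * (1 - 2 * q i))\<^sup>2 \<le> (m * A) * (m * B)"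
    using Cauchy_Schwarz_ineq_sum[of "\<lambda>i. 1 - 2 * p i" "\<lambda>i. 1 - 2 * q i" I] m by (simp add: A_def B_def)
  also have "\<dots> = (m * sqrt A * sqrt B)\<^sup>2" using A B by (simp add: power_mult_distrib) (simp add: power2_eq_square)
  finally have cs: "(\<Sum>i\<in>I. (1 - 2 * p i) * (1 - 2 * q i)) \<le> m * sqrt A * sqrt B"
    by (rule power2_le_imp_le) (use m A B in auto)
  have "s = (1 - (\<Sum>i\<in>I. (1 - 2 * p i) * (1 - 2 * q i)) / m) / 2"
    using m unfolding s_def bconv_altdef
    by (simp add: sum_subtractf sum_divide_distrib[symmetric] diff_divide_distrib m_def)
  moreover have "(\<Sum>i\<in>I. (1 - 2 * p i) * (1 - 2 * q i)) / m \<le> sqrt A * sqrt B"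
    using cs m by (simp add: divide_le_eq mult_ac)
  ultimately have "bconv a0 b0 \<le> s"
    by (simp add: bconv_altdef a0_def b0_def diff_divide_distrib)
  moreover have "s \<le> 1"
    using sum_bounded_above[of I "\<lambda>i. bconv (p i) (q i)" 1] p q m bconv_le_1 unfolding s_def m_def by auto
  ultimately obtain a b where *: "a \<in> {a0..1/2}" "b \<in> {b0..1/2}" "erasure_entropy s \<le> erasure_entropy (bconv a b)"
    using bconv_raise[OF ab] by blast
  have "(\<Sum>i\<in>I. binary_entropy (p i)) / card I \<le> binary_entropy a0"
    using avg_binary_entropy_le[OF I, of p] p by (simp add: a0_def A_def m_def)
  also have "\<dots> \<le> binary_entropy a" using * ab by (intro binary_entropy_mono) auto
  finally have 1: "(\<Sum>i\<in>I. binary_entropy (p i)) / card I \<le> binary_entropy a" .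
  have "(\<Sum>i\<in>I. binary_entropy (q i)) / card I \<le> binary_entropy b0"
    using avg_binary_entropy_le[OF I, of q] q by (simp add: b0_def B_def m_def)
  also have "\<dots> \<le> binary_entropy b" using * ab by (intro binary_entropy_mono) auto
  finally have 2: "(\<Sum>i\<in>I. binary_entropy (q i)) / card I \<le> binary_entropy b" .
  show ?thesis using 1 2 * ab by (intro bexI[of _ a] bexI[of _ b]) (auto simp: s_def m_def)
qed

section \<open>The region as a union of pentagons\<close>

definition pentagon :: "real \<Rightarrow> real \<Rightarrow> (real \<times> real) set" where
  "pentagon a b = {(R1, R2). 0 \<le> R1 \<and> 0 \<le> R2 \<and> R1 \<le> binary_entropy a \<and> R2 \<le> binary_entropy b \<and>
     R1 + R2 \<le> erasure_entropy (bconv a b)}"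

definition rate_region :: "(real \<times> real) set" where
  "rate_region = (\<Union>a\<in>{0..1/2}. \<Union>b\<in>{0..1/2}. pentagon a b)"

text \<open>The region is the projection of a closed subset \<open>K\<close> of a compact box of
  parameters and rates; rates fit into the box because binary entropies are at most 1. Closedness is
  what lets the converse pass to the limit of vanishing error.\<close>

lemma closed_rate_region: "closed rate_region"
proof -
  define C :: "((real \<times> real) \<times> real \<times> real) set" where "C = ({0..1/2} \<times> {0..1/2}) \<times> ({0..1} \<times> {0..1})"
  define K where "K = {x \<in> C. fst (snd x) \<le> binary_entropy (fst (fst x))} \<inter>
      {x \<in> C. snd (snd x) \<le> binary_entropy (snd (fst x))} \<inter>
      {x \<in> C. fst (snd x) + snd (snd x) \<le> erasure_entropy (bconv (fst (fst x)) (snd (fst x)))}"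
  have C: "compact C" unfolding C_def by (intro compact_Times compact_Icc)
  have "continuous_on C (\<lambda>x. binary_entropy (fst (fst x)))" "continuous_on C (\<lambda>x. binary_entropy (snd (fst x)))"
    by (rule continuous_on_compose2[OF continuous_on_binary_entropy]; auto simp: C_def intro!: continuous_intros)+
  moreover have "continuous_on C (\<lambda>x. erasure_entropy (bconv (fst (fst x)) (snd (fst x))))"
  proof (rule continuous_on_compose2[OF continuous_on_erasure_entropy])
    show "continuous_on C (\<lambda>x. bconv (fst (fst x)) (snd (fst x)))"
      unfolding bconv_def by (intro continuous_intros)
    show "(\<lambda>x. bconv (fst (fst x)) (snd (fst x))) ` C \<subseteq> {0..1}"
      using bconv_nonneg bconv_le_1 by (auto simp: C_def)
  qed
  ultimately have "closed K" unfolding K_def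
    by (intro closed_Int continuous_on_closed_Collect_le compact_imp_closed C continuous_intros)
  moreover have "K = C \<inter> K" by (auto simp: K_def)
  ultimately have "compact K" using C by (metis compact_Int_closed)
  then have "compact (snd ` K)" by (intro compact_continuous_image continuous_intros)
  moreover have "snd ` K = rate_region"
  proof -
    have le1: "binary_entropy a \<le> 1" if "0 \<le> a" "a \<le> 1/2" for a
      using binary_entropy_mono[of a "1/2"] that by simp
    show ?thesis
    proof (intro equalityI subsetI)
      fix x assume "x \<in> snd ` K"
      then obtain y where "y \<in> K" "x = snd y" by blast
      then obtain a b where "((a, b), x) \<in> K" by (cases y) auto
      moreover obtain r s where "x = (r, s)" by fastforce
      ultimately have "a \<in> {0..1/2}" "b \<in> {0..1/2}" "x \<in> pentagon a b"
        by (simp_all add: K_def C_def pentagon_def)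
      then show "x \<in> rate_region" unfolding rate_region_def by blast
    next
      fix x assume "x \<in> rate_region"
      then obtain a b where *: "a \<in> {0..1/2}" "b \<in> {0..1/2}" "x \<in> pentagon a b"
        by (auto simp: rate_region_def)
      then have "((a, b), x) \<in> K"
        using le1[of a] le1[of b] by (cases x) (auto simp: K_def C_def pentagon_def)
      then show "x \<in> snd ` K" by (rule rev_image_eqI) simp
    qed
  qed
  ultimately show ?thesis by (simp add: compact_imp_closed)
qed

text \<open>Two applications of the intermediate value theorem: \<open>a\<close> is lowered until
  its entropy equals \<open>R\<close>, then the other parameter is raised to restore the erasure
  probability. There is enough room, since that probability reaches \<open>1/2\<close> when the
  second parameter does.\<close>

lemma exchange_parameters:
  assumes a: "a \<in> {0..1/2}" and b: "b \<in> {0..1/2}" and R: "0 \<le> R" "R \<le> binary_entropy a"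
  shows "\<exists>a'\<in>{0..1/2}. \<exists>b'\<in>{b..1/2}. binary_entropy a' = R \<and> bconv a' b' = bconv a b"
proof -
  have "\<exists>x. 0 \<le> x \<and> x \<le> a \<and> binary_entropy x = R"
    by (rule IVT') (use R a in \<open>auto intro: continuous_on_subset[OF continuous_on_binary_entropy]\<close>)
  then obtain a' where a': "0 \<le> a'" "a' \<le> a" "binary_entropy a' = R" by blast
  have "\<exists>x. b \<le> x \<and> x \<le> 1/2 \<and> bconv a' x = bconv a b"
  proof (rule IVT')
    show "bconv a' b \<le> bconv a b" using a' b by (intro bconv_mono_left) auto
    show "bconv a b \<le> bconv a' (1/2)" using bconv_le_half[OF a b] by simp
  qed (use b in \<open>auto simp: bconv_def intro!: continuous_intros\<close>)
  then show ?thesis using a' a by force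
qed

lemma phi_cross_eq: "phi_cross x y = bconv (phi x) (phi y)"
  by (simp add: phi_cross_def bconv_def)

text \<open>The inverse of \<open>u \<mapsto> phi (2 * u)\<close> is \<open>u = a * (1 - a)\<close>,
  because \<open>1 - 4 * a * (1 - a)\<close> is the square of \<open>1 - 2 * a\<close>. Only the
  first branch of \<open>phi\<close> occurs.\<close>

lemma phi_image: "(\<lambda>u. phi (2 * u)) ` {0..1/4} = {0..1/2}"
proof -
  have "phi (2 * u) \<in> {0..1/2}" if "u \<in> {0..1/4}" for u
    using that by (auto simp: phi_def)
  moreover have "\<exists>u\<in>{0..1/4}. phi (2 * u) = a" if "a \<in> {0..1/2}" for a
  proof
    have "a * (1 - a) \<le> 1/4" using zero_le_power2[of "1 - 2 * a"] by (simp add: power2_eq_square algebra_simps)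
    then show u: "a * (1 - a) \<in> {0..1/4}" using that by auto
    have "1 - 2 * (2 * (a * (1 - a))) = (1 - 2 * a)\<^sup>2" by (simp add: power2_eq_square algebra_simps)
    then show "phi (2 * (a * (1 - a))) = a" using that u by (simp add: phi_def)
  qed
  ultimately show ?thesis by (intro equalityI subsetI) (blast, metis image_eqI)
qed

section \<open>Entropy of uniform laws\<close>

text \<open>The law of total expectation in counting form; \<open>Z\<close> will be the input
  history.\<close>

lemma sum_eq_by_fibers:
  fixes F H :: "'a \<Rightarrow> real"
  assumes "finite S"
    and "\<And>x. x \<in> S \<Longrightarrow> (\<Sum>x'\<in>{x'\<in>S. Z x' = Z x}. F x') = (\<Sum>x'\<in>{x'\<in>S. Z x' = Z x}. H x')"
  shows "sum F S = sum H S"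
  unfolding sum.image_gen[OF assms(1), of F Z] sum.image_gen[OF assms(1), of H Z]
  by (rule sum.cong[OF refl]) (use assms(2) in auto)

text \<open>For \<open>w\<close> uniform on \<open>A\<close> the summand is the surprisal of the bit
  \<open>f w\<close>, so its mean is the entropy of that bit.\<close>

lemma sum_log_fiber_binary:
  fixes f :: "'a \<Rightarrow> nat"
  assumes A: "finite A" "A \<noteq> {}" and f: "\<And>w. w \<in> A \<Longrightarrow> f w \<in> {0, 1}"
  shows "(\<Sum>w\<in>A. log 2 (card A / card {w'\<in>A. f w' = f w}))
     = card A * binary_entropy (card {w\<in>A. f w = 1} / card A)"
proof -
  define A0 where "A0 = {w\<in>A. f w = 0}"
  define A1 where "A1 = {w\<in>A. f w = 1}"
  have fin: "finite A0" "finite A1" and un: "A = A0 \<union> A1" and dis: "A0 \<inter> A1 = {}"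
    using A f by (auto simp: A0_def A1_def)
  have c: "card A = card A0 + card A1" unfolding un using fin dis by (rule card_Un_disjoint)
  have pos: "card A > 0" using A by (simp add: card_gt_0_iff)
  define n0 where "n0 = real (card A0)"
  define n1 where "n1 = real (card A1)"
  define m where "m = real (card A)"
  have m: "m = n0 + n1" "m > 0" "n0 \<ge> 0" "n1 \<ge> 0" using c pos by (auto simp: n0_def n1_def m_def)
  have "(\<Sum>w\<in>A. log 2 (card A / card {w'\<in>A. f w' = f w}))
     = (\<Sum>w\<in>A0. log 2 (card A / card {w'\<in>A. f w' = f w})) + (\<Sum>w\<in>A1. log 2 (card A / card {w'\<in>A. f w' = f w}))"
    by (subst un, rule sum.union_disjoint) (use fin dis in auto)
  also have "(\<Sum>w\<in>A0. log 2 (card A / card {w'\<in>A. f w' = f w})) = (\<Sum>w\<in>A0. log 2 (m / n0))"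
    by (rule sum.cong) (auto simp: A0_def m_def n0_def)
  also have "(\<Sum>w\<in>A1. log 2 (card A / card {w'\<in>A. f w' = f w})) = (\<Sum>w\<in>A1. log 2 (m / n1))"
    by (rule sum.cong) (auto simp: A1_def m_def n1_def)
  also have "(\<Sum>w\<in>A0. log 2 (m / n0)) + (\<Sum>w\<in>A1. log 2 (m / n1)) = n0 * log 2 (m / n0) + n1 * log 2 (m / n1)"
    by (simp add: n0_def n1_def)
  also have "\<dots> = m * binary_entropy (n1 / m)"
  proof -
    have "1 - n1 / m = n0 / m" using m by (simp add: field_simps)
    moreover have "x * log 2 (m / x) = - (m * (x / m * log 2 (x / m)))" if "x \<ge> 0" for x
      using m(2) that by (cases "x = 0") (auto simp: log_divide algebra_simps)
    ultimately have "binary_entropy (n1 / m) = - (n1 / m) * log 2 (n1 / m) - n0 / m * log 2 (n0 / m)"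
      and "n0 * log 2 (m / n0) = - (m * (n0 / m * log 2 (n0 / m)))"
      and "n1 * log 2 (m / n1) = - (m * (n1 / m * log 2 (n1 / m)))"
      using m by (simp_all only: binary_entropy_def)
    then show ?thesis by (simp only: right_diff_distrib mult_minus_left mult_minus_right)
  qed
  finally show ?thesis by (simp add: m_def n1_def A1_def)
qed

text \<open>On bits the indicator of \<open>x + y = 1\<close> is the polynomial
  \<open>x + y - 2 * x * y\<close>, whose sum over a rectangle factors.\<close>

lemma sum_xor_product:
  fixes f :: "'a \<Rightarrow> nat" and g :: "'b \<Rightarrow> nat"
  assumes A: "finite A" "A \<noteq> {}" and f: "\<And>w. w \<in> A \<Longrightarrow> f w \<in> {0, 1}"
    and B: "finite B" "B \<noteq> {}" and g: "\<And>w. w \<in> B \<Longrightarrow> g w \<in> {0, 1}"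
  shows "(\<Sum>(v, w)\<in>A \<times> B. of_bool (f v + g w = 1))
     = card A * card B * bconv (card {w\<in>A. f w = 1} / card A) (card {w\<in>B. g w = 1} / card B)"
proof -
  have of: "of_bool (f v + g w = 1) = real (f v) + real (g w) - 2 * real (f v) * real (g w)"
    if "v \<in> A" "w \<in> B" for v w
    using f[OF that(1)] g[OF that(2)] by auto
  have s: "(\<Sum>w\<in>A. real (f w)) = card {w\<in>A. f w = 1}"
  proof -
    have "(\<Sum>w\<in>A. real (f w)) = (\<Sum>w\<in>A. if f w = 1 then 1 else 0)"
      using f by (intro sum.cong) auto
    then show ?thesis using A by (simp add: sum.If_cases Int_def)
  qed
  have t: "(\<Sum>w\<in>B. real (g w)) = card {w\<in>B. g w = 1}"
  proof -
    have "(\<Sum>w\<in>B. real (g w)) = (\<Sum>w\<in>B. if g w = 1 then 1 else 0)"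
      using g by (intro sum.cong) auto
    then show ?thesis using B by (simp add: sum.If_cases Int_def)
  qed
  have "(\<Sum>(v, w)\<in>A \<times> B. of_bool (f v + g w = 1))
      = (\<Sum>v\<in>A. \<Sum>w\<in>B. real (f v) + real (g w) - 2 * real (f v) * real (g w))"
    unfolding sum.cartesian_product by (rule sum.cong[OF refl], clarify, rule of)
  also have "\<dots> = card B * (\<Sum>w\<in>A. real (f w)) + card A * (\<Sum>w\<in>B. real (g w))
      - 2 * (\<Sum>w\<in>A. real (f w)) * (\<Sum>w\<in>B. real (g w))"
    by (simp add: sum.distrib sum_subtractf sum_distrib_left sum_distrib_right mult_ac)
  also have "\<dots> = card A * card B * bconv (card {w\<in>A. f w = 1} / card A) (card {w\<in>B. g w = 1} / card B)"
    using A B by (simp add: s t bconv_def field_simps card_gt_0_iff)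
  finally show ?thesis .
qed

text \<open>Fano's inequality for the uniform law on \<open>A\<close>; \<open>C\<close> is the set of correctly decoded messages.\<close>
lemma sum_log_fiber_le:
  assumes A: "finite A" and C: "C \<subseteq> A" "inj_on y C"
  shows "(\<Sum>w\<in>A. log 2 (card {w'\<in>A. y w' = y w})) \<le> card (A - C) * (1 + log 2 (card A))"
proof -
  let ?N = "\<lambda>w. card {w'\<in>A. y w' = y w}"
  let ?D = "\<lambda>w. card {w'\<in>A - C. y w' = y w}"
  have finC: "finite C" using A C finite_subset by blast
  \<comment> \<open>No other correctly decoded message shares the output of a correctly decoded
    \<open>w\<close>, so its fiber consists of \<open>w\<close> and wrongly decoded messages; then
    \<open>log 2 (1 + k) \<le> k\<close>.\<close>
  have 1: "log 2 (?N w) \<le> ?D w" if w: "w \<in> C" for w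
  proof -
    have "{w'\<in>A. y w' = y w} = insert w {w'\<in>A - C. y w' = y w}"
      using w C by (auto dest: inj_onD)
    then have "?N w = Suc (?D w)"
      using A w by simp
    moreover have "log 2 (Suc k) \<le> real k" for k
    proof -
      have "real (Suc k) \<le> 2 powr real k"
        using of_nat_mono[OF Suc_leI[OF less_exp[of k]], where 'a = real] by (simp add: powr_realpow)
      then show ?thesis by (simp add: log_le_iff)
    qed
    ultimately show ?thesis by simp
  qed
  have "(\<Sum>w\<in>C. real (?D w)) = (\<Sum>w\<in>C. \<Sum>w'\<in>A - C. of_bool (y w' = y w))"
    using A by (intro sum.cong) (auto simp: Int_def)
  also have "\<dots> = (\<Sum>w'\<in>A - C. \<Sum>w\<in>C. of_bool (y w' = y w))" by (rule sum.swap)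
  also have "\<dots> = (\<Sum>w'\<in>A - C. real (card {w\<in>C. y w' = y w}))"
    using finC by (intro sum.cong) (auto simp: Int_def)
  \<comment> \<open>Double counting: a wrongly decoded message lies in the fiber of at most one
    correctly decoded one.\<close>
  also have "\<dots> \<le> (\<Sum>w'\<in>A - C. 1)"
  proof (rule sum_mono)
    fix w'
    have "inj_on y {w\<in>C. y w' = y w}" using C by (auto intro: inj_on_subset)
    then have "card {w\<in>C. y w' = y w} = card (y ` {w\<in>C. y w' = y w})" by (simp add: card_image)
    also have "\<dots> \<le> card {y w'}" by (rule card_mono) auto
    finally show "real (card {w\<in>C. y w' = y w}) \<le> 1" by simp
  qed
  finally have 2: "(\<Sum>w\<in>C. log 2 (?N w)) \<le> card (A - C)"
    using order_trans[OF sum_mono[where K = C, OF 1]] by simp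
  have "(\<Sum>w\<in>A - C. log 2 (?N w)) \<le> (\<Sum>w\<in>A - C. log 2 (card A))"
  proof (rule sum_mono)
    fix w assume w: "w \<in> A - C"
    have "?N w \<le> card A" using A by (intro card_mono) auto
    moreover have "?N w > 0" using A w by (auto simp: card_gt_0_iff)
    ultimately show "log 2 (?N w) \<le> log 2 (card A)" by simp
  qed
  then have 3: "(\<Sum>w\<in>A - C. log 2 (?N w)) \<le> card (A - C) * log 2 (card A)" by simp
  have "(\<Sum>w\<in>A. log 2 (?N w))
     = (\<Sum>w\<in>A - C. log 2 (?N w)) + (\<Sum>w\<in>C. log 2 (?N w))"
    using sum.subset_diff[OF C(1) A] .
  then show ?thesis using 2 3 by (simp add: algebra_simps)
qed

text \<open>Entropy is at most cross entropy. The inequality \<open>ln x \<le> x - 1\<close> is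
  applied to the ratio of \<open>q\<close> to the law of \<open>y\<close> on uniform
  \<open>w\<close>.\<close>

lemma gibbs_uniform:
  assumes A: "finite A" "A \<noteq> {}" and q: "\<And>w. w \<in> A \<Longrightarrow> q (y w) > 0" "(\<Sum>v\<in>y ` A. q v) \<le> 1"
  shows "(\<Sum>w\<in>A. log 2 (card A / card {w'\<in>A. y w' = y w})) \<le> (\<Sum>w\<in>A. - log 2 (q (y w)))"
proof -
  define N where "N = (\<lambda>v. real (card {w'\<in>A. y w' = v}))"
  define m where "m = real (card A)"
  have m: "m > 0" using A by (simp add: m_def card_gt_0_iff)
  have N: "N (y w) > 0" if "w \<in> A" for w using that A by (auto simp: N_def card_gt_0_iff)
  have "(\<Sum>w\<in>A. log 2 (m / N (y w)) + log 2 (q (y w))) \<le> (\<Sum>w\<in>A. (q (y w) * m / N (y w) - 1) / ln 2)"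
  proof (rule sum_mono)
    fix w assume w: "w \<in> A"
    have "log 2 (m / N (y w)) + log 2 (q (y w)) = ln (q (y w) * m / N (y w)) / ln 2"
      using m N[OF w] q(1)[OF w] by (simp add: log_def ln_div ln_mult add_divide_distrib diff_divide_distrib)
    also have "\<dots> \<le> (q (y w) * m / N (y w) - 1) / ln 2"
      using m N[OF w] q(1)[OF w] by (intro divide_right_mono ln_le_minus_one) auto
    finally show "log 2 (m / N (y w)) + log 2 (q (y w)) \<le> (q (y w) * m / N (y w) - 1) / ln 2" .
  qed
  also have "\<dots> = ((\<Sum>w\<in>A. q (y w) * m / N (y w)) - m) / ln 2"
    by (simp add: sum_divide_distrib[symmetric] sum_subtractf m_def)
  also have "(\<Sum>w\<in>A. q (y w) * m / N (y w)) = (\<Sum>v\<in>y ` A. \<Sum>w\<in>{w\<in>A. y w = v}. q (y w) * m / N (y w))"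
    by (rule sum.image_gen[OF A(1)])
  also have "\<dots> = (\<Sum>v\<in>y ` A. q v * m)"
  proof (rule sum.cong)
    fix v assume v: "v \<in> y ` A"
    have "(\<Sum>w\<in>{w\<in>A. y w = v}. q (y w) * m / N (y w)) = (\<Sum>w\<in>{w\<in>A. y w = v}. q v * m / N v)"
      by (rule sum.cong) auto
    also have "\<dots> = N v * (q v * m / N v)" by (simp add: N_def)
    also have "\<dots> = q v * m"
    proof -
      have "N v > 0" using N v by blast
      then show ?thesis by simp
    qed
    finally show "(\<Sum>w\<in>{w\<in>A. y w = v}. q (y w) * m / N (y w)) = q v * m" .
  qed simp
  also have "((\<Sum>v\<in>y ` A. q v * m) - m) / ln 2 \<le> 0"
    using q(2) m by (simp add: sum_distrib_right[symmetric] divide_le_0_iff)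
  finally show ?thesis by (simp add: sum.distrib sum_negf N_def m_def)
qed

lemma sum_prod_list_words:
  fixes r :: "'a \<Rightarrow> real"
  assumes "finite Y"
  shows "(\<Sum>ys | length ys = n \<and> set ys \<subseteq> Y. prod_list (map r ys)) = (\<Sum>y\<in>Y. r y) ^ n"
proof (induction n)
  case 0
  have "{ys. length ys = 0 \<and> set ys \<subseteq> Y} = {[]}" by auto
  then show ?case by simp
next
  case (Suc n)
  let ?L = "{ys. length ys = n \<and> set ys \<subseteq> Y}"
  have eq: "{ys. length ys = Suc n \<and> set ys \<subseteq> Y} = (\<lambda>(y, ys). y # ys) ` (Y \<times> ?L)"
    by (auto simp: length_Suc_conv image_iff)
  have "(\<Sum>ys | length ys = Suc n \<and> set ys \<subseteq> Y. prod_list (map r ys))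
      = (\<Sum>(y, ys)\<in>Y \<times> ?L. r y * prod_list (map r ys))"
    unfolding eq by (subst sum.reindex) (auto simp: inj_on_def case_prod_unfold)
  also have "\<dots> = (\<Sum>y\<in>Y. r y) * (\<Sum>ys\<in>?L. prod_list (map r ys))"
    by (simp add: sum_product sum.cartesian_product)
  finally show ?case using Suc.IH by simp
qed

text \<open>Gibbs' inequality with an i.i.d. reference law: weight \<open>s\<close> for the erasure
  symbol 1, weight \<open>(1 - s) / 2\<close> for 0 and for 2. Since \<open>s\<close> is the erasure
  frequency over all positions and words, the cross entropy equals the right-hand side exactly. The
  choice of reference law thus does the averaging over time and the symmetrisation of 0 and 2 at
  once.\<close>

lemma sum_log_fiber_words_le:
  fixes y :: "'a \<Rightarrow> nat list"
  assumes A: "finite A" "A \<noteq> {}" and y: "\<And>w. w \<in> A \<Longrightarrow> length (y w) = n \<and> set (y w) \<subseteq> {0, 1, 2}"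
    and n: "n > 0"
  defines "s \<equiv> (\<Sum>(i, w)\<in>{..<n} \<times> A. of_bool (y w ! i = 1)) / (n * card A)"
  shows "(\<Sum>w\<in>A. log 2 (card A / card {w'\<in>A. y w' = y w})) \<le> n * card A * erasure_entropy s"
proof -
  define r where "r = (\<lambda>v::nat. if v = 1 then s else (1 - s) / 2)"
  define m where "m = real n * real (card A)"
  have m: "m > 0" using A n by (simp add: m_def card_gt_0_iff)
  define K where "K = (\<Sum>(i, w)\<in>{..<n} \<times> A. of_bool (y w ! i = 1) :: real)"
  have "s = K / m" by (simp only: s_def K_def m_def of_nat_mult)
  then have sK: "s * m = K" using m by simp
  have finI: "finite ({..<n} \<times> A)" using A by simp
  have Kc: "m - K = (\<Sum>(i, w)\<in>{..<n} \<times> A. of_bool (y w ! i \<noteq> 1) :: real)"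
  proof -
    have "K + (\<Sum>(i, w)\<in>{..<n} \<times> A. of_bool (y w ! i \<noteq> 1) :: real) = (\<Sum>(i, w)\<in>{..<n} \<times> A. 1)"
      unfolding K_def sum.distrib[symmetric] by (rule sum.cong[OF refl]) auto
    then show ?thesis by (simp add: m_def card_cartesian_product case_prod_unfold)
  qed
  have K0: "0 \<le> K" "K \<le> m"
  proof -
    show "0 \<le> K" unfolding K_def by (rule sum_nonneg) auto
    have "0 \<le> m - K" unfolding Kc by (rule sum_nonneg) auto
    then show "K \<le> m" by simp
  qed
  have s01: "0 \<le> s" "s \<le> 1" using K0 m sK by (auto simp: s_def K_def[symmetric] m_def[symmetric] divide_le_eq)
  \<comment> \<open>The reference weight could vanish only for \<open>s = 0\<close> or
    \<open>s = 1\<close>; a symbol that occurs makes its own total count positive and so excludes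
    the bad case.\<close>
  have rpos: "r (y w ! i) > 0" if iw: "i < n" "w \<in> A" for i w
  proof (cases "y w ! i = 1")
    case True
    have "of_bool (y w ! i = 1) \<le> K"
      unfolding K_def using member_le_sum[of "(i, w)" "{..<n} \<times> A" "\<lambda>(i, w). of_bool (y w ! i = 1) :: real"] iw finI by auto
    then have "s * m > 0" using True sK by simp
    then show ?thesis using True m by (simp add: r_def zero_less_mult_iff)
  next
    case False
    have "of_bool (y w ! i \<noteq> 1) \<le> m - K"
      unfolding Kc using member_le_sum[of "(i, w)" "{..<n} \<times> A" "\<lambda>(i, w). of_bool (y w ! i \<noteq> 1) :: real"] iw finI by auto
    then have "s * m < m" using False sK by simp
    then show ?thesis using False m by (simp add: r_def)
  qed
  have r0: "r v \<ge> 0" for v using s01 by (simp add: r_def)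
  have qpos: "prod_list (map r (y w)) > 0" if "w \<in> A" for w
    using rpos[OF _ that] y[OF that] by (auto simp: prod.list_conv_set_nth intro!: prod_pos)
  have "(\<Sum>v\<in>y ` A. prod_list (map r v)) \<le> (\<Sum>v | length v = n \<and> set v \<subseteq> {0, 1, 2}. prod_list (map r v))"
  proof (rule sum_mono2)
    show "finite {v :: nat list. length v = n \<and> set v \<subseteq> {0, 1, 2}}"
      using finite_lists_length_eq[of "{0, 1, 2 :: nat}" n] by (simp add: conj_commute)
    show "0 \<le> prod_list (map r b)" for b by (rule prod_list_nonneg) (auto simp: r0)
  qed (use y in auto)
  also have "\<dots> = 1" by (subst sum_prod_list_words) (auto simp: r_def)
  finally have "(\<Sum>v\<in>y ` A. prod_list (map r v)) \<le> 1" .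
  from gibbs_uniform[OF A qpos this]
  have "(\<Sum>w\<in>A. log 2 (card A / card {w'\<in>A. y w' = y w})) \<le> (\<Sum>w\<in>A. - log 2 (prod_list (map r (y w))))" .
  also have "\<dots> = (\<Sum>w\<in>A. \<Sum>i<n. - log 2 (r (y w ! i)))"
  proof (rule sum.cong)
    fix w assume w: "w \<in> A"
    have "log 2 (prod_list (map r (y w))) = log 2 (\<Prod>i<n. r (y w ! i))"
      using y[OF w] by (simp add: prod.list_conv_set_nth atLeast0LessThan)
    also have "\<dots> = (\<Sum>i<n. log 2 (r (y w ! i)))"
    proof -
      have nz: "r (y w ! i) \<noteq> 0" if "i < n" for i using rpos[OF that w] by simp
      show ?thesis
        by (subst log_def, subst ln_prod) (auto simp: nz log_def sum_divide_distrib)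
    qed
    finally show "- log 2 (prod_list (map r (y w))) = (\<Sum>i<n. - log 2 (r (y w ! i)))"
      by (simp add: sum_negf)
  qed simp
  also have "\<dots> = (\<Sum>(i, w)\<in>{..<n} \<times> A. - log 2 (r (y w ! i)))"
    by (subst sum.swap) (simp add: sum.cartesian_product)
  also have "\<dots> = (\<Sum>(i, w)\<in>{..<n} \<times> A. of_bool (y w ! i = 1) * (- log 2 s) + of_bool (y w ! i \<noteq> 1) * (- log 2 ((1 - s) / 2)))"
    by (intro sum.cong) (auto simp: r_def)
  also have "\<dots> = K * (- log 2 s) + (m - K) * (- log 2 ((1 - s) / 2))"
    unfolding Kc unfolding K_def by (simp add: case_prod_unfold sum.distrib sum_subtractf sum_distrib_right sum_negf)
  also have "\<dots> = m * (s * (- log 2 s) + (1 - s) * (- log 2 ((1 - s) / 2)))"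
    by (simp add: sK[symmetric] algebra_simps)
  also have "s * (- log 2 s) + (1 - s) * (- log 2 ((1 - s) / 2)) = erasure_entropy s"
    using s01 by (cases "s = 1") (auto simp: erasure_entropy_def binary_entropy_def log_divide algebra_simps)
  finally show ?thesis by (simp add: m_def)
qed

section \<open>Deterministic outputs of a feedback code\<close>

text \<open>The channel is deterministic, so this is the output word and not just its law.\<close>
primrec outputs ::
  "(nat \<Rightarrow> nat \<Rightarrow> nat list \<Rightarrow> nat) \<Rightarrow> (nat \<Rightarrow> nat \<Rightarrow> nat list \<Rightarrow> nat) \<Rightarrow> nat \<Rightarrow> nat \<times> nat \<Rightarrow> nat list" where
  "outputs e1 e2 0 w = []"
| "outputs e1 e2 (Suc i) w = outputs e1 e2 i w @
     [e1 (Suc i) (fst w) (outputs e1 e2 i w) + e2 (Suc i) (snd w) (outputs e1 e2 i w)]"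

lemma length_outputs [simp]: "length (outputs e1 e2 i w) = i"
  by (induction i) auto

lemma take_outputs: "j \<le> i \<Longrightarrow> take j (outputs e1 e2 i w) = outputs e1 e2 j w"
  by (induction i) (auto simp: le_Suc_eq)

lemma nth_outputs:
  "j < i \<Longrightarrow> outputs e1 e2 i w ! j =
     e1 (Suc j) (fst w) (outputs e1 e2 j w) + e2 (Suc j) (snd w) (outputs e1 e2 j w)"
  by (induction i) (auto simp: nth_append less_Suc_eq)

lemma outputs_swap: "outputs e2 e1 i (prod.swap w) = outputs e1 e2 i w"
  by (induction i) (simp_all add: add.commute)

lemma output_law_outputs:
  "binary_erasure.output_law e1 e2 w1 w2 i = return_pmf (outputs e1 e2 i (w1, w2))"
  by (induction i) (auto simp: bind_return_pmf)

text \<open>The uniform message pair is the only source of randomness, so from here on the error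
  probability is a count of message pairs.\<close>

lemma error_prob_outputs:
  assumes "M1 \<ge> 1" "M2 \<ge> 1"
  shows "binary_erasure.error_prob n M1 M2 e1 e2 g =
     card {w \<in> {1..M1} \<times> {1..M2}. g (outputs e1 e2 n w) \<noteq> w} / (M1 * M2)"
proof -
  let ?S = "{1..M1} \<times> {1..M2}"
  have ne: "?S \<noteq> {}" "finite ?S" using assms by auto
  have pair: "pmf_of_set ?S = pair_pmf (pmf_of_set {1..M1}) (pmf_of_set {1..M2})"
    using assms by (intro pmf_eqI) (auto simp: pmf_pair indicator_def card_cartesian_product)
  have "binary_erasure.message_output_law n M1 M2 e1 e2
      = map_pmf (\<lambda>w. (w, outputs e1 e2 n w)) (pmf_of_set ?S)"
    unfolding binary_erasure.message_output_law_def output_law_outputs pair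
    by (simp add: pair_pmf_def map_bind_pmf bind_return_pmf map_pmf_def bind_assoc_pmf)
  then have "binary_erasure.error_prob n M1 M2 e1 e2 g
      = measure_pmf.prob (pmf_of_set ?S) {w. g (outputs e1 e2 n w) \<noteq> w}"
    by (simp add: binary_erasure.error_prob_def vimage_def)
  also have "\<dots> = card (?S \<inter> {w. g (outputs e1 e2 n w) \<noteq> w}) / card ?S"
    by (rule measure_pmf_of_set[OF ne])
  finally show ?thesis by (simp add: Int_def card_cartesian_product)
qed

text \<open>The assumptions are symmetric in the users, so that results for user 1 can be
  transferred by interpreting the locale with the users exchanged.\<close>

locale feedback_code =
  fixes e1 e2 :: "nat \<Rightarrow> nat \<Rightarrow> nat list \<Rightarrow> nat" and W1 W2 :: "nat set" and n :: nat
  assumes fin: "finite W1" "finite W2" and ne: "W1 \<noteq> {}" "W2 \<noteq> {}"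
    and enc1: "\<And>i w ys. i < n \<Longrightarrow> w \<in> W1 \<Longrightarrow> length ys = i \<Longrightarrow> set ys \<subseteq> {0, 1, 2} \<Longrightarrow> e1 (Suc i) w ys \<in> {0, 1}"
    and enc2: "\<And>i w ys. i < n \<Longrightarrow> w \<in> W2 \<Longrightarrow> length ys = i \<Longrightarrow> set ys \<subseteq> {0, 1, 2} \<Longrightarrow> e2 (Suc i) w ys \<in> {0, 1}"
begin

abbreviation "out \<equiv> outputs e1 e2"

definition "in1 i w = e1 (Suc i) (fst w) (out i w)"
definition "in2 i w = e2 (Suc i) (snd w) (out i w)"

text \<open>
  The messages of user 1 that would have produced the same first \<open>i\<close> inputs as \<open>w\<close> if they had
  seen the same outputs; the messages with a given input history form a rectangle.
\<close>
definition "cell1 i w = {v \<in> W1. \<forall>j<i. e1 (Suc j) v (out j w) = in1 j w}"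
definition "cell2 i w = {v \<in> W2. \<forall>j<i. e2 (Suc j) v (out j w) = in2 j w}"

definition "hist i w = map (\<lambda>j. (in1 j w, in2 j w)) [0..<i]"

lemma set_out: "w \<in> W1 \<times> W2 \<Longrightarrow> i \<le> n \<Longrightarrow> set (out i w) \<subseteq> {0, 1, 2}"
proof (induction i)
  case (Suc i)
  then have "set (out i w) \<subseteq> {0, 1, 2}" by simp
  with Suc.prems enc1[of i "fst w" "out i w"] enc2[of i "snd w" "out i w"]
  show ?case by auto
qed simp

lemma hist_eq_iff: "hist i w = hist i w' \<longleftrightarrow> (\<forall>j<i. in1 j w = in1 j w' \<and> in2 j w = in2 j w')"
  by (auto simp: hist_def)

lemma out_Suc: "out (Suc i) w = out i w @ [in1 i w + in2 i w]"
  by (simp add: in1_def in2_def)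

lemma out_cong_hist: "hist i w = hist i w' \<Longrightarrow> j \<le> i \<Longrightarrow> out j w = out j w'"
  unfolding hist_eq_iff by (induction j) (simp_all add: out_Suc del: outputs.simps(2))

text \<open>Induction over time: as long as the outputs of \<open>w'\<close> agree with those of
  \<open>w\<close>, each encoder sees the past of \<open>w\<close> and, by membership in its cell,
  repeats the input of \<open>w\<close>, so the next outputs agree too.\<close>

lemma hist_fiber:
  assumes "w \<in> W1 \<times> W2"
  shows "{w' \<in> W1 \<times> W2. hist i w' = hist i w} = cell1 i w \<times> cell2 i w"
proof (intro equalityI subsetI)
  fix w' assume w': "w' \<in> {w' \<in> W1 \<times> W2. hist i w' = hist i w}"
  then have h: "hist i w' = hist i w" by simp
  have "out j w' = out j w" if "j < i" for j using out_cong_hist[OF h, of j] that by simp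
  then show "w' \<in> cell1 i w \<times> cell2 i w"
    using w' h unfolding hist_eq_iff by (cases w') (auto simp: cell1_def cell2_def in1_def in2_def)
next
  fix w' assume w': "w' \<in> cell1 i w \<times> cell2 i w"
  have "out j w' = out j w" if "j \<le> i" for j
    using that
  proof (induction j)
    case (Suc j)
    then have "out j w' = out j w" by simp
    then have "in1 j w' = in1 j w" "in2 j w' = in2 j w"
      using w' Suc.prems by (auto simp: cell1_def cell2_def in1_def[of _ w'] in2_def[of _ w'])
    then show ?case using \<open>out j w' = out j w\<close> by (simp only: out_Suc)
  qed simp
  then have "in1 j w' = in1 j w \<and> in2 j w' = in2 j w" if "j < i" for j
    using w' that by (auto simp: cell1_def cell2_def in1_def[of _ w'] in2_def[of _ w'])
  then show "w' \<in> {w' \<in> W1 \<times> W2. hist i w' = hist i w}"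
    using w' by (cases w') (auto simp: hist_eq_iff cell1_def cell2_def)
qed

lemma cell_cong:
  assumes "hist i w' = hist i w"
  shows "cell1 i w' = cell1 i w" "cell2 i w' = cell2 i w"
proof -
  have "out j w' = out j w" if "j < i" for j using out_cong_hist[OF assms, of j] that by simp
  then show "cell1 i w' = cell1 i w" "cell2 i w' = cell2 i w"
    using assms unfolding hist_eq_iff by (auto simp: cell1_def cell2_def)
qed

lemma cell1_Suc: "cell1 (Suc i) w = {v \<in> cell1 i w. e1 (Suc i) v (out i w) = e1 (Suc i) (fst w) (out i w)}"
  by (auto simp: cell1_def less_Suc_eq in1_def)

lemma self_in_cell: "w \<in> W1 \<times> W2 \<Longrightarrow> fst w \<in> cell1 i w" "w \<in> W1 \<times> W2 \<Longrightarrow> snd w \<in> cell2 i w"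
  by (auto simp: cell1_def cell2_def in1_def in2_def)

lemma finite_cell: "finite (cell1 i w)" "finite (cell2 i w)"
  using fin by (auto simp: cell1_def cell2_def)

text \<open>The conditional probability, given the input history before time \<open>i\<close>, that
  the next input of user 1 is 1.\<close>

definition "bias1 i w = card {v \<in> cell1 i w. e1 (Suc i) v (out i w) = 1} / card (cell1 i w)"
definition "bias2 i w = card {v \<in> cell2 i w. e2 (Suc i) v (out i w) = 1} / card (cell2 i w)"

lemma card_ratio_01: "finite A \<Longrightarrow> real (card {v \<in> A. P v}) / real (card A) \<in> {0..1}"
  using card_mono[of A "{v \<in> A. P v}"] by (auto simp: divide_le_eq_1)

lemma bias_01: "bias1 i w \<in> {0..1}" "bias2 i w \<in> {0..1}"
  unfolding bias1_def bias2_def by (rule card_ratio_01[OF finite_cell(1)], rule card_ratio_01[OF finite_cell(2)])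

text \<open>Both sides are the conditional entropy of the next input of user 1 given the history. On
  a rectangle the inner sum over \<open>cell1\<close> is the entropy of one bit, and
  \<open>cell2\<close> contributes only a factor.\<close>

lemma sum_log_cell1:
  assumes "i < n"
  shows "(\<Sum>w\<in>W1 \<times> W2. log 2 (card (cell1 i w) / card (cell1 (Suc i) w)))
     = (\<Sum>w\<in>W1 \<times> W2. binary_entropy (bias1 i w))"
proof (rule sum_eq_by_fibers[where Z = "hist i"])
  fix w assume w: "w \<in> W1 \<times> W2"
  define f where "f = (\<lambda>v. e1 (Suc i) v (out i w))"
  have fv: "e1 (Suc i) v (out i w) = f v" for v by (simp add: f_def)
  have f: "f v \<in> {0, 1}" if "v \<in> cell1 i w" for v
    unfolding f_def by (rule enc1) (use that assms set_out[OF w, of i] in \<open>auto simp: cell1_def\<close>)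
  have o: "out i w' = out i w" if "hist i w' = hist i w" for w' using out_cong_hist[OF that, of i] by simp
  let ?F = "{w' \<in> W1 \<times> W2. hist i w' = hist i w}"
  have "(\<Sum>w'\<in>?F. log 2 (card (cell1 i w') / card (cell1 (Suc i) w')))
      = (\<Sum>w'\<in>?F. log 2 (card (cell1 i w) / card {v \<in> cell1 i w. f v = f (fst w')}))"
  proof (rule sum.cong[OF refl])
    fix w' assume "w' \<in> ?F"
    then have h: "hist i w' = hist i w" by simp
    note c = o[OF h] cell_cong[OF h]
    show "log 2 (card (cell1 i w') / card (cell1 (Suc i) w')) = log 2 (card (cell1 i w) / card {v \<in> cell1 i w. f v = f (fst w')})"
      by (cases w') (use c in \<open>simp add: cell1_Suc f_def\<close>)
  qed
  also have "\<dots> = (\<Sum>v\<in>cell1 i w. \<Sum>u\<in>cell2 i w. log 2 (card (cell1 i w) / card {v' \<in> cell1 i w. f v' = f v}))"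
    unfolding hist_fiber[OF w] sum.cartesian_product by (simp add: case_prod_unfold)
  also have "\<dots> = card (cell2 i w) * (card (cell1 i w) * binary_entropy (bias1 i w))"
  proof -
    have "(\<Sum>v\<in>cell1 i w. log 2 (card (cell1 i w) / card {v' \<in> cell1 i w. f v' = f v}))
        = card (cell1 i w) * binary_entropy (bias1 i w)"
      unfolding bias1_def fv
      by (rule sum_log_fiber_binary) (use self_in_cell(1)[OF w, of i] finite_cell f in auto)
    then show ?thesis by (simp add: sum_distrib_left[symmetric])
  qed
  also have "\<dots> = (\<Sum>w'\<in>?F. binary_entropy (bias1 i w))"
    unfolding hist_fiber[OF w] by (simp add: card_cartesian_product)
  also have "\<dots> = (\<Sum>w'\<in>?F. binary_entropy (bias1 i w'))"
  proof (rule sum.cong[OF refl])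
    fix w' assume "w' \<in> ?F"
    then have h: "hist i w' = hist i w" by simp
    note c = o[OF h] cell_cong[OF h]
    show "binary_entropy (bias1 i w) = binary_entropy (bias1 i w')"
      by (cases w') (use c in \<open>simp add: bias1_def\<close>)
  qed
  finally show "(\<Sum>w'\<in>?F. log 2 (card (cell1 i w') / card (cell1 (Suc i) w'))) = (\<Sum>w'\<in>?F. binary_entropy (bias1 i w'))" .
qed (use fin in simp)

text \<open>A position is erased exactly when the two inputs differ, and on each rectangle they are
  independent bits with parameters \<open>bias1\<close> and \<open>bias2\<close>.\<close>

lemma sum_erasures:
  assumes "i < n"
  shows "(\<Sum>w\<in>W1 \<times> W2. of_bool (out n w ! i = 1)) = (\<Sum>w\<in>W1 \<times> W2. bconv (bias1 i w) (bias2 i w))"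
proof (rule sum_eq_by_fibers[where Z = "hist i"])
  fix w assume w: "w \<in> W1 \<times> W2"
  define f where "f = (\<lambda>v. e1 (Suc i) v (out i w))"
  have fv: "e1 (Suc i) v (out i w) = f v" for v by (simp add: f_def)
  define g where "g = (\<lambda>v. e2 (Suc i) v (out i w))"
  have gv: "e2 (Suc i) v (out i w) = g v" for v by (simp add: g_def)
  have f: "f v \<in> {0, 1}" if "v \<in> cell1 i w" for v
    unfolding f_def by (rule enc1) (use that assms set_out[OF w, of i] in \<open>auto simp: cell1_def\<close>)
  have g: "g v \<in> {0, 1}" if "v \<in> cell2 i w" for v
    unfolding g_def by (rule enc2) (use that assms set_out[OF w, of i] in \<open>auto simp: cell2_def\<close>)
  have o: "out i w' = out i w" if "hist i w' = hist i w" for w' using out_cong_hist[OF that, of i] by simp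
  let ?F = "{w' \<in> W1 \<times> W2. hist i w' = hist i w}"
  have "(\<Sum>w'\<in>?F. of_bool (out n w' ! i = 1)) = (\<Sum>(v, u)\<in>?F. of_bool (f v + g u = 1) :: real)"
  proof (rule sum.cong[OF refl])
    fix w' assume "w' \<in> ?F"
    then have h: "hist i w' = hist i w" by simp
    note c = o[OF h] cell_cong[OF h]
    show "of_bool (out n w' ! i = 1) = ((case w' of (v, u) \<Rightarrow> of_bool (f v + g u = 1)) :: real)"
      by (cases w') (use c in \<open>simp add: nth_outputs[OF assms] f_def g_def\<close>)
  qed
  also have "\<dots> = card (cell1 i w) * card (cell2 i w) * bconv (bias1 i w) (bias2 i w)"
    unfolding hist_fiber[OF w] bias1_def bias2_def fv gv
    by (rule sum_xor_product) (use self_in_cell[OF w, of i] finite_cell f g in auto)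
  also have "\<dots> = (\<Sum>w'\<in>?F. bconv (bias1 i w) (bias2 i w))"
    unfolding hist_fiber[OF w] by (simp add: card_cartesian_product)
  also have "\<dots> = (\<Sum>w'\<in>?F. bconv (bias1 i w') (bias2 i w'))"
  proof (rule sum.cong[OF refl])
    fix w' assume "w' \<in> ?F"
    then have h: "hist i w' = hist i w" by simp
    note c = o[OF h] cell_cong[OF h]
    show "bconv (bias1 i w) (bias2 i w) = bconv (bias1 i w') (bias2 i w')"
      by (cases w') (use c in \<open>simp add: bias1_def bias2_def\<close>)
  qed
  finally show "(\<Sum>w'\<in>?F. of_bool (out n w' ! i = 1)) = (\<Sum>w'\<in>?F. bconv (bias1 i w') (bias2 i w'))" .
qed (use fin in simp)

end

section \<open>The converse\<close>

context feedback_code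
begin

text \<open>With \<open>w2\<close> fixed, the inputs of user 2 can be subtracted from the outputs,
  which leaves the inputs of user 1. Thus the uncertainty about \<open>w1\<close> that Fano's
  inequality measures is a cell.\<close>

lemma output_fiber1:
  assumes "w1 \<in> W1" "w2 \<in> W2"
  shows "{v \<in> W1. out n (v, w2) = out n (w1, w2)} = cell1 n (w1, w2)"
proof (intro equalityI subsetI)
  fix v assume v: "v \<in> {v \<in> W1. out n (v, w2) = out n (w1, w2)}"
  have "e1 (Suc j) v (out j (w1, w2)) = in1 j (w1, w2)" if "j < n" for j
  proof -
    have o: "out j (v, w2) = out j (w1, w2)"
      using v that by (metis (mono_tags, lifting) mem_Collect_eq less_imp_le take_outputs)
    have "out n (v, w2) ! j = out n (w1, w2) ! j" using v by simp
    then show ?thesis by (simp add: nth_outputs[OF that] o in1_def)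
  qed
  then show "v \<in> cell1 n (w1, w2)" using v by (simp add: cell1_def)
next
  fix v assume v: "v \<in> cell1 n (w1, w2)"
  have "(v, w2) \<in> cell1 n (w1, w2) \<times> cell2 n (w1, w2)"
    using v self_in_cell(2)[of "(w1, w2)" n] assms by simp
  then have "hist n (v, w2) = hist n (w1, w2)" "v \<in> W1"
    using hist_fiber[of "(w1, w2)" n] assms by auto
  then show "v \<in> {v \<in> W1. out n (v, w2) = out n (w1, w2)}"
    using out_cong_hist[of n "(v, w2)" "(w1, w2)" n] by simp
qed

text \<open>The chain rule: the cell is all of \<open>W1\<close> at time 0 and shrinks to the
  messages still undecided at time \<open>n\<close>.\<close>

lemma telescope_cell1:
  assumes "w \<in> W1 \<times> W2"
  shows "(\<Sum>i<n. log 2 (card (cell1 i w) / card (cell1 (Suc i) w))) = log 2 (card W1) - log 2 (card (cell1 n w))"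
proof -
  have pos: "card (cell1 i w) > 0" for i
    using self_in_cell(1)[OF assms, of i] finite_cell(1)[of i w] by (auto simp: card_gt_0_iff)
  have "(\<Sum>i<n. log 2 (card (cell1 i w) / card (cell1 (Suc i) w)))
      = (\<Sum>i<n. log 2 (card (cell1 i w)) - log 2 (card (cell1 (Suc i) w)))"
    by (intro sum.cong refl log_divide_pos) (use pos in auto)
  also have "\<dots> = log 2 (card (cell1 0 w)) - log 2 (card (cell1 n w))"
    by (rule sum_lessThan_telescope')
  finally show ?thesis by (simp add: cell1_def)
qed

context
  fixes g :: "nat list \<Rightarrow> nat \<times> nat" and \<epsilon> :: real
  assumes error: "card {w \<in> W1 \<times> W2. g (out n w) \<noteq> w} \<le> \<epsilon> * card (W1 \<times> W2)"
    and npos: "n > 0"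
begin

lemma card_pos: "card W1 > 0" "card W2 > 0" "card (W1 \<times> W2) > 0"
  using fin ne by (auto simp: card_gt_0_iff)

text \<open>Fano's inequality is applied to user 1 for each fixed \<open>w2\<close> and summed over
  \<open>w2\<close>; giving the receiver the other message can only help, so this bounds the rate.
  The chain rule then turns the resolved uncertainty into conditional entropies of the
  inputs.\<close>

lemma rate1:
  "(1 - \<epsilon>) * log 2 (card W1) - \<epsilon> \<le> n * ((\<Sum>(i, w)\<in>{..<n} \<times> (W1 \<times> W2). binary_entropy (bias1 i w)) / card ({..<n} \<times> (W1 \<times> W2)))"
proof -
  let ?L = "log 2 (card W1)" and ?M = "real (card (W1 \<times> W2))"
  have L: "?L \<ge> 0" using card_pos by simp
  have "(\<Sum>w\<in>W1 \<times> W2. log 2 (card (cell1 n w))) = (\<Sum>w2\<in>W2. \<Sum>w1\<in>W1. log 2 (card (cell1 n (w1, w2))))"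
    by (subst sum.swap) (simp add: sum.cartesian_product)
  also have "\<dots> \<le> (\<Sum>w2\<in>W2. card {w1\<in>W1. g (out n (w1, w2)) \<noteq> (w1, w2)} * (1 + ?L))"
  proof (rule sum_mono)
    fix w2 assume w2: "w2 \<in> W2"
    let ?C = "{w1 \<in> W1. g (out n (w1, w2)) = (w1, w2)}"
    have "inj_on (\<lambda>v. out n (v, w2)) ?C" by (rule inj_onI) (metis (mono_tags, lifting) mem_Collect_eq prod.inject)
    then have "(\<Sum>w1\<in>W1. log 2 (card {v\<in>W1. out n (v, w2) = out n (w1, w2)})) \<le> card (W1 - ?C) * (1 + ?L)"
      by (intro sum_log_fiber_le fin) auto
    also have "W1 - ?C = {w1\<in>W1. g (out n (w1, w2)) \<noteq> (w1, w2)}" by auto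
    also have "(\<Sum>w1\<in>W1. log 2 (card {v\<in>W1. out n (v, w2) = out n (w1, w2)})) = (\<Sum>w1\<in>W1. log 2 (card (cell1 n (w1, w2))))"
      by (rule sum.cong[OF refl]) (simp add: output_fiber1 w2)
    finally show "(\<Sum>w1\<in>W1. log 2 (card (cell1 n (w1, w2)))) \<le> card {w1\<in>W1. g (out n (w1, w2)) \<noteq> (w1, w2)} * (1 + ?L)" .
  qed
  also have "\<dots> = real (\<Sum>w2\<in>W2. card {w1\<in>W1. g (out n (w1, w2)) \<noteq> (w1, w2)}) * (1 + ?L)"
    by (simp add: sum_distrib_right)
  also have "(\<Sum>w2\<in>W2. card {w1\<in>W1. g (out n (w1, w2)) \<noteq> (w1, w2)}) = card (SIGMA w2:W2. {w1\<in>W1. g (out n (w1, w2)) \<noteq> (w1, w2)})"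
    using fin by simp
  also have "\<dots> = card {w \<in> W1 \<times> W2. g (out n w) \<noteq> w}"
    by (rule bij_betw_same_card[where f = prod.swap]) (auto simp: bij_betw_def inj_on_def image_iff)
  also have "card {w \<in> W1 \<times> W2. g (out n w) \<noteq> w} * (1 + ?L) \<le> (\<epsilon> * ?M) * (1 + ?L)"
    using L by (intro mult_right_mono error) auto
  finally have 1: "(\<Sum>w\<in>W1 \<times> W2. log 2 (card (cell1 n w))) \<le> \<epsilon> * ?M * (1 + ?L)" .
  have "(\<Sum>(i, w)\<in>{..<n} \<times> (W1 \<times> W2). binary_entropy (bias1 i w))
      = (\<Sum>i<n. \<Sum>w\<in>W1 \<times> W2. log 2 (card (cell1 i w) / card (cell1 (Suc i) w)))"
    by (subst sum.cartesian_product[symmetric], rule sum.cong[OF refl]) (simp add: sum_log_cell1)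
  also have "\<dots> = (\<Sum>w\<in>W1 \<times> W2. ?L - log 2 (card (cell1 n w)))"
    by (subst sum.swap) (intro sum.cong refl telescope_cell1)
  also have "\<dots> = ?M * ?L - (\<Sum>w\<in>W1 \<times> W2. log 2 (card (cell1 n w)))"
    by (simp add: sum_subtractf)
  finally have "?M * ((1 - \<epsilon>) * ?L - \<epsilon>) \<le> (\<Sum>(i, w)\<in>{..<n} \<times> (W1 \<times> W2). binary_entropy (bias1 i w))"
    using 1 by (simp add: algebra_simps)
  then have "(1 - \<epsilon>) * ?L - \<epsilon> \<le> (\<Sum>(i, w)\<in>{..<n} \<times> (W1 \<times> W2). binary_entropy (bias1 i w)) / ?M"
    using card_pos(3) by (simp add: le_divide_eq mult.commute)
  then show ?thesis using npos by (simp add: card_cartesian_product)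
qed

text \<open>This is \<open>rate1\<close> for the code with the users exchanged; outputs, cells and
  error count are carried along \<open>prod.swap\<close>.\<close>

lemma rate2:
  "(1 - \<epsilon>) * log 2 (card W2) - \<epsilon> \<le> n * ((\<Sum>(i, w)\<in>{..<n} \<times> (W1 \<times> W2). binary_entropy (bias2 i w)) / card ({..<n} \<times> (W1 \<times> W2)))"
proof -
  interpret swapped: feedback_code e2 e1 W2 W1 n
    by unfold_locales (rule fin ne enc1 enc2; assumption)+
  let ?E = "{w \<in> W1 \<times> W2. g (out n w) \<noteq> w}"
  have "{w \<in> W2 \<times> W1. prod.swap (g (outputs e2 e1 n w)) \<noteq> w} = prod.swap ` ?E"
  proof (intro equalityI subsetI)
    fix w assume w: "w \<in> {w \<in> W2 \<times> W1. prod.swap (g (outputs e2 e1 n w)) \<noteq> w}"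
    have "out n (prod.swap w) = outputs e2 e1 n w" by (rule outputs_swap)
    then have "prod.swap w \<in> ?E" using w by (auto simp: prod.swap_def)
    then show "w \<in> prod.swap ` ?E" by (rule rev_image_eqI) simp
  next
    fix w assume "w \<in> prod.swap ` ?E"
    then obtain v where "w = prod.swap v" "v \<in> ?E" by blast
    then show "w \<in> {w \<in> W2 \<times> W1. prod.swap (g (outputs e2 e1 n w)) \<noteq> w}"
    proof -
      have "prod.swap (g (out n v)) \<noteq> prod.swap v"
        using \<open>v \<in> ?E\<close> by (simp add: inj_eq[OF inj_swap])
      moreover have "prod.swap v \<in> W2 \<times> W1" using \<open>v \<in> ?E\<close> by (cases v) simp
      ultimately show ?thesis using outputs_swap[of e2 e1 n v] \<open>w = prod.swap v\<close> by simp
    qed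
  qed
  then have "card {w \<in> W2 \<times> W1. prod.swap (g (outputs e2 e1 n w)) \<noteq> w} = card ?E"
    by (simp only: card_image inj_swap)
  then have err: "card {w \<in> W2 \<times> W1. (prod.swap \<circ> g) (outputs e2 e1 n w) \<noteq> w} \<le> \<epsilon> * card (W2 \<times> W1)"
    using error by (simp only: comp_apply card_cartesian_product mult.commute)
  have "swapped.cell1 i (prod.swap w) = cell2 i w" for i w
    by (simp add: swapped.cell1_def swapped.in1_def cell2_def in2_def outputs_swap)
  then have bias: "swapped.bias1 i (prod.swap w) = bias2 i w" for i w
    by (simp add: swapped.bias1_def bias2_def outputs_swap)
  have "(\<Sum>w\<in>W2 \<times> W1. binary_entropy (swapped.bias1 i w)) = (\<Sum>w\<in>W1 \<times> W2. binary_entropy (bias2 i w))" for i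
  proof -
    have "(\<Sum>w\<in>W2 \<times> W1. binary_entropy (swapped.bias1 i w)) = (\<Sum>w\<in>prod.swap ` (W1 \<times> W2). binary_entropy (swapped.bias1 i w))"
      by (simp only: product_swap)
    also have "\<dots> = (\<Sum>w\<in>W1 \<times> W2. binary_entropy (bias2 i w))"
      by (subst sum.reindex) (simp_all add: bias)
    finally show ?thesis .
  qed
  then show ?thesis
    using swapped.rate1[OF err npos]
    by (simp only: sum.cartesian_product[symmetric] card_cartesian_product mult.commute[of "card W2"])
qed

text \<open>Fano's inequality for the message pair leaves the entropy of the output word, which
  \<open>sum_log_fiber_words_le\<close> bounds through the erasure frequency;
  \<open>sum_erasures\<close> expresses that frequency by the biases.\<close>

lemma sum_rate:
  "(1 - \<epsilon>) * (log 2 (card W1) + log 2 (card W2)) - \<epsilon> \<le> n * erasure_entropy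
     ((\<Sum>(i, w)\<in>{..<n} \<times> (W1 \<times> W2). bconv (bias1 i w) (bias2 i w)) / card ({..<n} \<times> (W1 \<times> W2)))"
proof -
  let ?\<Omega> = "W1 \<times> W2"
  let ?L = "log 2 (card ?\<Omega>)" and ?M = "real (card ?\<Omega>)"
  let ?C = "{w \<in> ?\<Omega>. g (out n w) = w}"
  let ?s = "(\<Sum>(i, w)\<in>{..<n} \<times> ?\<Omega>. bconv (bias1 i w) (bias2 i w)) / card ({..<n} \<times> ?\<Omega>)"
  have \<Omega>: "finite ?\<Omega>" "?\<Omega> \<noteq> {}" using fin ne by auto
  have L: "?L \<ge> 0" using card_pos(3) by simp
  have "inj_on (out n) ?C" by (rule inj_onI) (metis (mono_tags, lifting) mem_Collect_eq)
  then have "(\<Sum>w\<in>?\<Omega>. log 2 (card {w'\<in>?\<Omega>. out n w' = out n w})) \<le> card (?\<Omega> - ?C) * (1 + ?L)"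
    by (intro sum_log_fiber_le \<Omega>) auto
  also have "?\<Omega> - ?C = {w \<in> ?\<Omega>. g (out n w) \<noteq> w}" by auto
  also have "card {w \<in> ?\<Omega>. g (out n w) \<noteq> w} * (1 + ?L) \<le> (\<epsilon> * ?M) * (1 + ?L)"
    using L by (intro mult_right_mono error) auto
  finally have 1: "(\<Sum>w\<in>?\<Omega>. log 2 (card {w'\<in>?\<Omega>. out n w' = out n w})) \<le> \<epsilon> * ?M * (1 + ?L)" .
  have s: "(\<Sum>(i, w)\<in>{..<n} \<times> ?\<Omega>. of_bool (out n w ! i = 1)) / (n * card ?\<Omega>) = ?s"
  proof -
    have "(\<Sum>(i, w)\<in>{..<n} \<times> ?\<Omega>. of_bool (out n w ! i = 1)) = (\<Sum>i<n. \<Sum>w\<in>?\<Omega>. of_bool (out n w ! i = 1) :: real)"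
      by (rule sum.cartesian_product[symmetric])
    also have "\<dots> = (\<Sum>i<n. \<Sum>w\<in>?\<Omega>. bconv (bias1 i w) (bias2 i w))"
      by (rule sum.cong[OF refl], rule sum_erasures) simp
    also have "\<dots> = (\<Sum>(i, w)\<in>{..<n} \<times> ?\<Omega>. bconv (bias1 i w) (bias2 i w))"
      by (rule sum.cartesian_product)
    finally show ?thesis by (simp add: card_cartesian_product)
  qed
  have pos: "card {w'\<in>?\<Omega>. out n w' = out n w} > 0" if "w \<in> ?\<Omega>" for w
    using that \<Omega> by (auto simp: card_gt_0_iff)
  have "?M * ?L - (\<Sum>w\<in>?\<Omega>. log 2 (card {w'\<in>?\<Omega>. out n w' = out n w}))
      = (\<Sum>w\<in>?\<Omega>. ?L - log 2 (card {w'\<in>?\<Omega>. out n w' = out n w}))" by (simp add: sum_subtractf)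
  also have "\<dots> = (\<Sum>w\<in>?\<Omega>. log 2 (card ?\<Omega> / card {w'\<in>?\<Omega>. out n w' = out n w}))"
    by (intro sum.cong refl log_divide_pos[symmetric]) (use pos card_pos(3) in \<open>auto simp del: card_cartesian_product\<close>)
  also have "\<dots> \<le> n * card ?\<Omega> * erasure_entropy ?s"
    unfolding s[symmetric] by (rule sum_log_fiber_words_le) (use \<Omega> npos set_out[of _ n] in auto)
  finally have "?M * ((1 - \<epsilon>) * ?L - \<epsilon>) \<le> ?M * (n * erasure_entropy ?s)"
    using 1 by (simp add: algebra_simps)
  then have "(1 - \<epsilon>) * ?L - \<epsilon> \<le> n * erasure_entropy ?s"
    using card_pos(3) by (simp only: mult_le_cancel_left_pos of_nat_0_less_iff)
  moreover have "?L = log 2 (card W1) + log 2 (card W2)"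
    using card_pos by (simp add: card_cartesian_product log_mult)
  ultimately show ?thesis by simp
qed

text \<open>The index set given to \<open>single_letter\<close> consists of all times and message
  pairs, so the average runs over both at once. The truncation at 0 is there because pentagons
  contain nonnegative rates only.\<close>

lemma converse_point:
  assumes R1: "R1 \<le> log 2 (card W1) / n" "0 \<le> R1" and R2: "R2 \<le> log 2 (card W2) / n" "0 \<le> R2"
    and eps: "0 < \<epsilon>" "\<epsilon> < 1"
  shows "(max 0 ((1 - \<epsilon>) * R1 - \<epsilon>), max 0 ((1 - \<epsilon>) * R2 - \<epsilon>)) \<in> rate_region"
proof -
  let ?I = "{..<n} \<times> (W1 \<times> W2)"
  have I: "finite ?I" "?I \<noteq> {}" using fin ne npos by auto
  let ?avg = "\<lambda>F. (\<Sum>i\<in>?I. F i) / card ?I"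
  let ?p = "\<lambda>(i, w). bias1 i w" and ?q = "\<lambda>(i, w). bias2 i w"
  obtain a b where ab: "a \<in> {0..1/2}" "b \<in> {0..1/2}"
    and a: "(\<Sum>i\<in>?I. binary_entropy (?p i)) / card ?I \<le> binary_entropy a"
    and b: "(\<Sum>i\<in>?I. binary_entropy (?q i)) / card ?I \<le> binary_entropy b"
    and c: "erasure_entropy ((\<Sum>i\<in>?I. bconv (?p i) (?q i)) / card ?I) \<le> erasure_entropy (bconv a b)"
    using single_letter[OF I, of ?p ?q] bias_01 by (auto simp: case_prod_unfold)
  \<comment> \<open>The Fano term contributes \<open>\<epsilon> / n\<close>, which is replaced by
    \<open>\<epsilon>\<close> to make the bound uniform in \<open>n\<close>.\<close>
  have scale: "(1 - \<epsilon>) * R - \<epsilon> \<le> H" if "R \<le> l / n" "(1 - \<epsilon>) * l - \<epsilon> \<le> n * H" for R l H :: real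
  proof -
    have "(1 - \<epsilon>) * R \<le> (1 - \<epsilon>) * (l / n)" using that(1) eps by (intro mult_left_mono) auto
    also have "\<dots> = ((1 - \<epsilon>) * l - \<epsilon>) / n + \<epsilon> / n" by (simp add: diff_divide_distrib)
    also have "\<dots> \<le> n * H / n + \<epsilon> / 1"
      using that(2) npos eps by (intro add_mono divide_right_mono divide_left_mono) auto
    finally show ?thesis using npos by simp
  qed
  have 1: "(1 - \<epsilon>) * R1 - \<epsilon> \<le> binary_entropy a"
    using scale[OF R1(1) rate1] a by (simp add: case_prod_unfold)
  have 2: "(1 - \<epsilon>) * R2 - \<epsilon> \<le> binary_entropy b"
    using scale[OF R2(1) rate2] b by (simp add: case_prod_unfold)
  have "R1 + R2 \<le> (log 2 (card W1) + log 2 (card W2)) / n"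
    using R1 R2 by (simp add: add_divide_distrib)
  from scale[OF this sum_rate] have 3: "(1 - \<epsilon>) * (R1 + R2) - \<epsilon> \<le> erasure_entropy (bconv a b)"
    using c by (simp add: case_prod_unfold)
  have h0: "0 \<le> binary_entropy a" "0 \<le> binary_entropy b" using ab by (auto intro: binary_entropy_nonneg)
  have "1 \<le> erasure_entropy (bconv a b)"
    using ab by (intro erasure_entropy_ge_1 bconv_nonneg bconv_le_half) auto
  moreover have "(1 - \<epsilon>) * (R1 + R2) = (1 - \<epsilon>) * R1 + (1 - \<epsilon>) * R2" by (simp add: algebra_simps)
  moreover have "0 \<le> (1 - \<epsilon>) * R1" "0 \<le> (1 - \<epsilon>) * R2" using R1 R2 eps by auto
  ultimately have "(max 0 ((1 - \<epsilon>) * R1 - \<epsilon>), max 0 ((1 - \<epsilon>) * R2 - \<epsilon>)) \<in> pentagon a b"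
    using 1 2 3 h0 eps by (simp add: pentagon_def max_def)
  then show ?thesis using ab unfolding rate_region_def by blast
qed

end

end

text \<open>The bound of \<open>converse_point\<close> holds at every positive block length, so one
  code for each \<open>\<epsilon>\<close> is enough; then \<open>\<epsilon>\<close> tends to 0
  inside a closed set.\<close>

lemma capacity_region_subset: "binary_erasure.capacity_region \<subseteq> rate_region"
  unfolding binary_erasure.capacity_region_def
proof (rule closure_minimal[OF _ closed_rate_region], clarify)
  fix R1 R2 assume ach: "binary_erasure.achievable R1 R2"
  then have R: "0 \<le> R1" "0 \<le> R2" unfolding binary_erasure.achievable_def by blast+
  have pt: "(max 0 ((1 - \<epsilon>) * R1 - \<epsilon>), max 0 ((1 - \<epsilon>) * R2 - \<epsilon>)) \<in> rate_region" if eps: "0 < \<epsilon>" "\<epsilon> < 1" for \<epsilon>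
  proof -
    have "\<forall>\<^sub>F n in sequentially. n > 0 \<and> (\<exists>M1 M2 e1 e2 g.
        binary_erasure.is_code n M1 M2 e1 e2 g \<and>
        R1 \<le> log 2 (real M1) / real n \<and> R2 \<le> log 2 (real M2) / real n \<and>
        binary_erasure.error_prob n M1 M2 e1 e2 g \<le> \<epsilon>)"
      using ach eps unfolding binary_erasure.achievable_def
      by (intro eventually_conj eventually_gt_at_top) blast
    then obtain n M1 M2 e1 e2 g where n: "n > 0" and code: "binary_erasure.is_code n M1 M2 e1 e2 g"
      and rates: "R1 \<le> log 2 (real M1) / real n" "R2 \<le> log 2 (real M2) / real n"
      and err: "binary_erasure.error_prob n M1 M2 e1 e2 g \<le> \<epsilon>"
      by (blast dest: eventually_happens'[OF sequentially_bot])
    have M: "M1 \<ge> 1" "M2 \<ge> 1" using code unfolding binary_erasure.is_code_def by blast+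
    have enc: "binary_erasure.feedback_encoder {0, 1 :: nat} n M1 e1"
      "binary_erasure.feedback_encoder {0, 1 :: nat} n M2 e2"
      using code unfolding binary_erasure.is_code_def by blast+
    interpret feedback_code e1 e2 "{1..M1}" "{1..M2}" n
    proof
      fix i w and ys :: "nat list" assume iw: "i < n" "length ys = i" "set ys \<subseteq> {0, 1, 2}"
      then have "Suc i \<in> {1..n}" "ys \<in> binary_erasure.words (Suc i - 1)"
        by (simp_all add: binary_erasure.words_def[unfolded One_nat_def])
      then show "w \<in> {1..M1} \<Longrightarrow> e1 (Suc i) w ys \<in> {0, 1}" "w \<in> {1..M2} \<Longrightarrow> e2 (Suc i) w ys \<in> {0, 1}"
        using enc unfolding binary_erasure.feedback_encoder_def by blast+
    qed (use M in auto)
    have "card {w \<in> {1..M1} \<times> {1..M2}. g (out n w) \<noteq> w} \<le> \<epsilon> * card ({1..M1} \<times> {1..M2})"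
      using err M unfolding error_prob_outputs[OF M]
      by (simp add: divide_le_eq card_cartesian_product mult_ac)
    from converse_point[OF this n _ R(1) _ R(2) eps] show ?thesis using rates by simp
  qed
  have "\<forall>\<^sub>F \<epsilon> in at_right 0. (max 0 ((1 - \<epsilon>) * R1 - \<epsilon>), max 0 ((1 - \<epsilon>) * R2 - \<epsilon>)) \<in> rate_region"
    by (rule eventually_at_rightI[of 0 1]) (auto intro: pt)
  moreover have "((\<lambda>\<epsilon>. (max 0 ((1 - \<epsilon>) * R1 - \<epsilon>), max 0 ((1 - \<epsilon>) * R2 - \<epsilon>))) \<longlongrightarrow>
      (max 0 ((1 - 0) * R1 - 0), max 0 ((1 - 0) * R2 - 0))) (at_right 0)"
    by (intro tendsto_intros)
  ultimately have "(max 0 ((1 - 0) * R1 - 0), max 0 ((1 - 0) * R2 - 0)) \<in> rate_region"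
    by (intro Lim_in_closed_set[OF closed_rate_region]) auto
  then show "(R1, R2) \<in> rate_region" using R by simp
qed

section \<open>Codes from causal inputs\<close>

text \<open>
  An encoder computes its next input from any message of the other user that explains the past outputs.
\<close>
lemma code_from_causal_inputs:
  fixes X1 X2 :: "'a \<times> 'b \<Rightarrow> nat \<Rightarrow> nat"
  assumes V: "finite V1" "finite V2" "V1 \<noteq> {}" "V2 \<noteq> {}"
    and bits: "\<And>v i. X1 v i \<in> {0, 1}" "\<And>v i. X2 v i \<in> {0, 1}"
    and causal1: "\<And>v1 v2 v2' i. v1 \<in> V1 \<Longrightarrow> v2 \<in> V2 \<Longrightarrow> v2' \<in> V2 \<Longrightarrow> i < n \<Longrightarrow>
      (\<And>j. j < i \<Longrightarrow> X1 (v1, v2) j + X2 (v1, v2) j = X1 (v1, v2') j + X2 (v1, v2') j) \<Longrightarrow>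
      X1 (v1, v2) i = X1 (v1, v2') i"
    and causal2: "\<And>v1 v1' v2 i. v1 \<in> V1 \<Longrightarrow> v1' \<in> V1 \<Longrightarrow> v2 \<in> V2 \<Longrightarrow> i < n \<Longrightarrow>
      (\<And>j. j < i \<Longrightarrow> X1 (v1, v2) j + X2 (v1, v2) j = X1 (v1', v2) j + X2 (v1', v2) j) \<Longrightarrow>
      X2 (v1, v2) i = X2 (v1', v2) i"
    and decode: "\<And>v v'. v \<in> V1 \<times> V2 \<Longrightarrow> v' \<in> V1 \<times> V2 \<Longrightarrow> v \<notin> Bad \<Longrightarrow>
      (\<And>j. j < n \<Longrightarrow> X1 v j + X2 v j = X1 v' j + X2 v' j) \<Longrightarrow> v = v'"
    and Bad: "Bad \<subseteq> V1 \<times> V2"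
  shows "\<exists>e1 e2 g. binary_erasure.is_code n (card V1) (card V2) e1 e2 g \<and>
    binary_erasure.error_prob n (card V1) (card V2) e1 e2 g \<le> card Bad / (card V1 * card V2)"
proof -
  define Y where "Y = (\<lambda>v j. X1 v j + X2 v j)"
  obtain b1 where b1: "bij_betw b1 {1..card V1} V1" using ex_bij_betw_nat_finite_1[OF V(1)] by blast
  obtain b2 where b2: "bij_betw b2 {1..card V2} V2" using ex_bij_betw_nat_finite_1[OF V(2)] by blast
  have M: "card V1 \<ge> 1" "card V2 \<ge> 1" using V by (auto simp: Suc_le_eq card_gt_0_iff)
  \<comment> \<open>Encoders count time from 1, the inputs \<open>X1\<close> and \<open>X2\<close>
    from 0, hence \<open>i - 1\<close>. The chosen \<open>v2\<close> need not be the true message;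
    \<open>causal1\<close> makes its input agree anyway.\<close>
  define e1 where "e1 = (\<lambda>i w ys. X1 (b1 w, SOME v2. v2 \<in> V2 \<and> (\<forall>j<i-1. Y (b1 w, v2) j = ys ! j)) (i-1))"
  define e2 where "e2 = (\<lambda>i w ys. X2 (SOME v1. v1 \<in> V1 \<and> (\<forall>j<i-1. Y (v1, b2 w) j = ys ! j), b2 w) (i-1))"
  have e1_Suc: "e1 (Suc i) w ys = X1 (b1 w, SOME v2. v2 \<in> V2 \<and> (\<forall>j<i. Y (b1 w, v2) j = ys ! j)) i" for i w ys
    by (simp add: e1_def)
  have e2_Suc: "e2 (Suc i) w ys = X2 (SOME v1. v1 \<in> V1 \<and> (\<forall>j<i. Y (v1, b2 w) j = ys ! j), b2 w) i" for i w ys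
    by (simp add: e2_def)
  let ?W = "{1..card V1} \<times> {1..card V2}"
  define ok where "ok = (\<lambda>ys w. w \<in> ?W \<and> (\<forall>j<n. Y (b1 (fst w), b2 (snd w)) j = ys ! j))"
  \<comment> \<open>A decoder must return a valid pair on every word, so output words that no
    message pair explains are mapped to \<open>(1, 1)\<close>.\<close>
  define g where "g = (\<lambda>ys. if \<exists>w. ok ys w then SOME w. ok ys w else (1, 1))"
  have g_ok: "ok ys (g ys)" if "ok ys w" for ys w
    unfolding g_def using that by (metis someI_ex)
  have g_in: "g ys \<in> ?W" for ys
  proof (cases "\<exists>w. ok ys w")
    case True
    then show ?thesis using g_ok unfolding ok_def by blast
  next
    case False
    then have "g ys = (1, 1)" unfolding g_def by argo
    then show ?thesis using M by simp
  qed
  have code: "binary_erasure.is_code n (card V1) (card V2) e1 e2 g"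
    unfolding binary_erasure.is_code_def binary_erasure.feedback_encoder_def
    using M g_in bits unfolding e1_def e2_def by blast
  have b_in: "b1 w1 \<in> V1" "b2 w2 \<in> V2" if "(w1, w2) \<in> ?W" for w1 w2
    using that bij_betwE[OF b1] bij_betwE[OF b2] by auto
  have out: "\<forall>j<i. outputs e1 e2 i w ! j = Y (b1 (fst w), b2 (snd w)) j" if "w \<in> ?W" "i \<le> n" for i w
    using that(2)
  proof (induction i)
    case (Suc i)
    obtain w1 w2 where w: "w = (w1, w2)" by fastforce
    let ?ys = "outputs e1 e2 i w"
    have IH: "Y (b1 w1, b2 w2) j = ?ys ! j" if "j < i" for j using Suc that by (simp add: w)
    have w_in: "b1 w1 \<in> V1" "b2 w2 \<in> V2" "i < n" using b_in[of w1 w2] that(1) w Suc.prems by auto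
    define u2 where "u2 = (SOME v2. v2 \<in> V2 \<and> (\<forall>j<i. Y (b1 w1, v2) j = ?ys ! j))"
    define u1 where "u1 = (SOME v1. v1 \<in> V1 \<and> (\<forall>j<i. Y (v1, b2 w2) j = ?ys ! j))"
    have "\<exists>v2. v2 \<in> V2 \<and> (\<forall>j<i. Y (b1 w1, v2) j = ?ys ! j)"
      using IH w_in(2) by blast
    from someI_ex[OF this] have u2: "u2 \<in> V2" "\<And>j. j < i \<Longrightarrow> Y (b1 w1, u2) j = ?ys ! j"
      unfolding u2_def by blast+
    have "\<exists>v1. v1 \<in> V1 \<and> (\<forall>j<i. Y (v1, b2 w2) j = ?ys ! j)"
      using IH w_in(1) by blast
    from someI_ex[OF this] have u1: "u1 \<in> V1" "\<And>j. j < i \<Longrightarrow> Y (u1, b2 w2) j = ?ys ! j"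
      unfolding u1_def by blast+
    have "X1 (b1 w1, u2) i = X1 (b1 w1, b2 w2) i"
    proof (rule causal1[OF w_in(1) u2(1) w_in(2,3)])
      fix j assume "j < i"
      from u2(2)[OF this] IH[OF this]
      show "X1 (b1 w1, u2) j + X2 (b1 w1, u2) j = X1 (b1 w1, b2 w2) j + X2 (b1 w1, b2 w2) j"
        unfolding Y_def by (rule trans[OF _ sym])
    qed
    moreover have "X2 (u1, b2 w2) i = X2 (b1 w1, b2 w2) i"
    proof (rule causal2[OF u1(1) w_in])
      fix j assume "j < i"
      from u1(2)[OF this] IH[OF this]
      show "X1 (u1, b2 w2) j + X2 (u1, b2 w2) j = X1 (b1 w1, b2 w2) j + X2 (b1 w1, b2 w2) j"
        unfolding Y_def by (rule trans[OF _ sym])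
    qed
    moreover have "e1 (Suc i) (fst w) ?ys = X1 (b1 w1, u2) i" "e2 (Suc i) (snd w) ?ys = X2 (u1, b2 w2) i"
      unfolding e1_Suc e2_Suc u1_def u2_def by (simp_all only: w fst_conv snd_conv)
    ultimately have "e1 (Suc i) (fst w) ?ys + e2 (Suc i) (snd w) ?ys = Y (b1 w1, b2 w2) i"
      by (simp only: Y_def)
    then have new: "outputs e1 e2 (Suc i) w ! i = Y (b1 w1, b2 w2) i" by (simp add: nth_append)
    show ?case
    proof (intro allI impI)
      fix j assume "j < Suc i"
      then show "outputs e1 e2 (Suc i) w ! j = Y (b1 (fst w), b2 (snd w)) j"
        using new IH[of j] by (cases "j = i") (simp_all add: nth_append w)
    qed
  qed simp
  define E where "E = {w \<in> ?W. g (outputs e1 e2 n w) \<noteq> w}"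
  have inj: "w = w'" if "w \<in> ?W" "w' \<in> ?W" "(b1 (fst w), b2 (snd w)) = (b1 (fst w'), b2 (snd w'))" for w w'
    using that inj_onD[OF bij_betw_imp_inj_on[OF b1], of "fst w" "fst w'"]
      inj_onD[OF bij_betw_imp_inj_on[OF b2], of "snd w" "snd w'"]
    by (simp add: mem_Times_iff prod_eq_iff)
  have in_V: "(b1 (fst w), b2 (snd w)) \<in> V1 \<times> V2" if "w \<in> ?W" for w
    using b_in[of "fst w" "snd w"] that by simp
  \<comment> \<open>The decoder returns some pair that explains the outputs, and outside
    \<open>Bad\<close> the true pair is the only one.\<close>
  have "(b1 (fst w), b2 (snd w)) \<in> Bad" if "w \<in> E" for w
  proof (rule ccontr)
    assume nb: "(b1 (fst w), b2 (snd w)) \<notin> Bad"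
    from that have w: "w \<in> ?W" and neq: "g (outputs e1 e2 n w) \<noteq> w" by (simp_all add: E_def)
    define w' where "w' = g (outputs e1 e2 n w)"
    have "ok (outputs e1 e2 n w) w"
      unfolding ok_def using out[OF w, of n] w by simp
    from g_ok[OF this] have w': "w' \<in> ?W" "\<And>j. j < n \<Longrightarrow> Y (b1 (fst w'), b2 (snd w')) j = outputs e1 e2 n w ! j"
      unfolding ok_def w'_def by blast+
    have "(b1 (fst w), b2 (snd w)) = (b1 (fst w'), b2 (snd w'))"
    proof (rule decode[OF in_V[OF w] in_V[OF w'(1)] nb])
      fix j assume j: "j < n"
      then have "Y (b1 (fst w), b2 (snd w)) j = Y (b1 (fst w'), b2 (snd w')) j"
        using w'(2)[OF j] out[OF w, of n] by simp
      then show "X1 (b1 (fst w), b2 (snd w)) j + X2 (b1 (fst w), b2 (snd w)) j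
          = X1 (b1 (fst w'), b2 (snd w')) j + X2 (b1 (fst w'), b2 (snd w')) j"
        by (simp only: Y_def)
    qed
    then have "w = w'" by (rule inj[OF w w'(1)])
    then show False using neq by (simp add: w'_def)
  qed
  then have sub: "(\<lambda>w. (b1 (fst w), b2 (snd w))) ` E \<subseteq> Bad" by blast
  have "inj_on (\<lambda>w. (b1 (fst w), b2 (snd w))) E"
  proof (rule inj_onI)
    fix w w' assume a: "w \<in> E" "w' \<in> E" "(b1 (fst w), b2 (snd w)) = (b1 (fst w'), b2 (snd w'))"
    from a(1,2) have "w \<in> ?W" "w' \<in> ?W" by (simp_all add: E_def)
    then show "w = w'" using a(3) by (rule inj)
  qed
  moreover have "finite Bad" using Bad V finite_subset by blast
  ultimately have "card E \<le> card Bad"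
    using sub card_inj_on_le by blast
  then have "binary_erasure.error_prob n (card V1) (card V2) e1 e2 g \<le> card Bad / (card V1 * card V2)"
    unfolding error_prob_outputs[OF M] E_def of_nat_mult by (intro divide_right_mono) auto
  then show ?thesis using code by blast
qed

section \<open>Block codes with backward decoding\<close>

text \<open>For the union bound: an ambiguous pair of messages and state prescribes the messages of
  two consecutive blocks.\<close>

lemma card_PiE_two_fixed:
  assumes "i < n" "j < n" "i \<noteq> j" "finite A"
  shows "card {f \<in> {..<n} \<rightarrow>\<^sub>E A. f i = u \<and> f j = v} \<le> card A ^ (n - 2)"
proof -
  let ?T = "\<lambda>k. if k \<in> {i, j} then (if k = i then {u} else {v}) else A"
  have "{f \<in> {..<n} \<rightarrow>\<^sub>E A. f i = u \<and> f j = v} \<subseteq> Pi\<^sub>E {..<n} ?T"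
    using assms by (auto simp: PiE_iff extensional_def)
  then have "card {f \<in> {..<n} \<rightarrow>\<^sub>E A. f i = u \<and> f j = v} \<le> card (Pi\<^sub>E {..<n} ?T)"
    using assms by (intro card_mono finite_PiE) auto
  also have "\<dots> = (\<Prod>k<n. if k \<in> {i, j} then 1 else card A)"
    by (subst card_PiE) (auto intro!: prod.cong)
  also have "\<dots> = card A ^ card ({..<n} - {i, j})"
  proof -
    have "{..<n} \<inter> - {k. k \<in> {i, j}} = {..<n} - {i, j}" by blast
    then show ?thesis
      by (simp only: prod.If_cases[OF finite_lessThan] prod.neutral_const prod_constant mult_1)
  qed
  also have "card ({..<n} - {i, j}) = n - 2"
    using assms by (subst card_Diff_subset) auto
  finally show ?thesis .
qed

lemma card_PiE_one_fixed:
  assumes "i < n" "finite A"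
  shows "card {f \<in> {..<n} \<rightarrow>\<^sub>E A. f i = u} \<le> card A ^ (n - 1)"
proof -
  let ?T = "\<lambda>k. if k \<in> {i} then {u} else A"
  have "{f \<in> {..<n} \<rightarrow>\<^sub>E A. f i = u} \<subseteq> Pi\<^sub>E {..<n} ?T"
    using assms by (auto simp: PiE_iff extensional_def)
  then have "card {f \<in> {..<n} \<rightarrow>\<^sub>E A. f i = u} \<le> card (Pi\<^sub>E {..<n} ?T)"
    using assms by (intro card_mono finite_PiE) auto
  also have "\<dots> = (\<Prod>k<n. if k \<in> {i} then 1 else card A)"
    by (subst card_PiE) (auto intro!: prod.cong)
  also have "\<dots> = card A ^ card ({..<n} - {i})"
    by (subst prod.If_cases) (auto simp: Diff_eq)
  also have "card ({..<n} - {i}) = n - 1"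
    using assms by (subst card_Diff_subset) auto
  finally show ?thesis .
qed

text \<open>Some section is no larger than the average one. It supplies the fixed messages
  \<open>w0\<close> of the last block.\<close>

lemma ex_small_section:
  assumes "finite A" "A \<noteq> {}" "finite S"
  shows "\<exists>a\<in>A. card {s \<in> S. (a, s) \<in> E} * card A \<le> card (E \<inter> A \<times> S)"
proof (rule ccontr)
  assume "\<not> ?thesis"
  then have *: "card (E \<inter> A \<times> S) < card {s \<in> S. (a, s) \<in> E} * card A" if "a \<in> A" for a
    using that by (meson not_less)
  have "E \<inter> A \<times> S = (SIGMA a:A. {s \<in> S. (a, s) \<in> E})" by auto
  then have c: "card (E \<inter> A \<times> S) = (\<Sum>a\<in>A. card {s \<in> S. (a, s) \<in> E})"
    using assms by simp
  have "(\<Sum>a\<in>A. card (E \<inter> A \<times> S)) < (\<Sum>a\<in>A. card {s \<in> S. (a, s) \<in> E} * card A)"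
    using assms * by (intro sum_strict_mono) auto
  moreover have "(\<Sum>a\<in>A. card {s \<in> S. (a, s) \<in> E} * card A) = card (E \<inter> A \<times> S) * card A"
    unfolding c by (rule sum_distrib_right[symmetric])
  ultimately show False by simp
qed

text \<open>
  A block code whose words depend on a state \<open>s\<close>, used in \<open>B + 1\<close> consecutive blocks of length
  \<open>N\<close>; the state in each block is the pair of messages sent in the block before.
\<close>
locale block_code =
  fixes A1 :: "'a set" and A2 :: "'b set" and N :: nat
    and x1 :: "'a \<times> 'b \<Rightarrow> 'a \<Rightarrow> nat \<Rightarrow> nat" and x2 :: "'a \<times> 'b \<Rightarrow> 'b \<Rightarrow> nat \<Rightarrow> nat"
  assumes fin: "finite A1" "finite A2" and ne: "A1 \<noteq> {}" "A2 \<noteq> {}" and N: "N > 0"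
    and bits: "\<And>s w j. x1 s w j \<in> {0, 1}" "\<And>s w j. x2 s w j \<in> {0, 1}"
    and inj1: "\<And>s w w'. s \<in> A1 \<times> A2 \<Longrightarrow> w \<in> A1 \<Longrightarrow> w' \<in> A1 \<Longrightarrow>
      (\<And>j. j < N \<Longrightarrow> x1 s w j = x1 s w' j) \<Longrightarrow> w = w'"
    and inj2: "\<And>s w w'. s \<in> A1 \<times> A2 \<Longrightarrow> w \<in> A2 \<Longrightarrow> w' \<in> A2 \<Longrightarrow>
      (\<And>j. j < N \<Longrightarrow> x2 s w j = x2 s w' j) \<Longrightarrow> w = w'"
begin

definition "y s w j = x1 s (fst w) j + x2 s (snd w) j"

text \<open>The cases in which a receiver that already knows the messages \<open>w\<close> of a
  block cannot read the state \<open>s\<close> off its outputs. Backward decoding can fail only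
  there.\<close>

definition "ambiguous = {(w, s) \<in> (A1 \<times> A2) \<times> (A1 \<times> A2). \<exists>s'\<in>A1 \<times> A2. s' \<noteq> s \<and> (\<forall>j<N. y s w j = y s' w j)}"

lemma unambiguous:
  assumes "w \<in> A1 \<times> A2" "s \<in> A1 \<times> A2" "s' \<in> A1 \<times> A2"
    "\<And>j. j < N \<Longrightarrow> y s w j = y s' w j" "(w, s) \<notin> ambiguous"
  shows "s = s'"
proof (rule ccontr)
  assume "s \<noteq> s'"
  then have "s' \<noteq> s" by simp
  moreover have "\<forall>j<N. y s w j = y s' w j" using assms(4) by blast
  ultimately have "(w, s) \<in> ambiguous"
    unfolding ambiguous_def mem_Collect_eq case_prod_conv using assms(1-3) by (intro conjI bexI[of _ s']) blast+
  then show False using assms(5) by contradiction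
qed

context
  fixes B :: nat and w0 :: "'a \<times> 'b"
  assumes B: "B \<ge> 1" and w0: "w0 \<in> A1 \<times> A2"
begin

definition "V1 = {..<B} \<rightarrow>\<^sub>E A1"
definition "V2 = {..<B} \<rightarrow>\<^sub>E A2"

text \<open>Blocks \<open>0\<close> to \<open>B - 1\<close> carry messages; block \<open>B\<close>
  repeats the known \<open>w0\<close>, so that backward decoding has a place to start. The same
  \<open>w0\<close> serves as the state of block 0.\<close>

definition msg :: "(nat \<Rightarrow> 'a) \<times> (nat \<Rightarrow> 'b) \<Rightarrow> nat \<Rightarrow> 'a \<times> 'b" where
  "msg v b = (if b < B then (fst v b, snd v b) else w0)"

definition state :: "(nat \<Rightarrow> 'a) \<times> (nat \<Rightarrow> 'b) \<Rightarrow> nat \<Rightarrow> 'a \<times> 'b" where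
  "state v b = (case b of 0 \<Rightarrow> w0 | Suc c \<Rightarrow> msg v c)"

text \<open>Time \<open>i\<close> is position \<open>i mod N\<close> of block
  \<open>i div N\<close>. Zeros after block \<open>B\<close> fill up lengths that are not multiples
  of the block length.\<close>

definition "X1 v i = (if i div N \<le> B then x1 (state v (i div N)) (fst (msg v (i div N))) (i mod N) else 0)"
definition "X2 v i = (if i div N \<le> B then x2 (state v (i div N)) (snd (msg v (i div N))) (i mod N) else 0)"

lemma msg_in: "v \<in> V1 \<times> V2 \<Longrightarrow> msg v b \<in> A1 \<times> A2"
  using w0 by (cases v) (auto simp: msg_def V1_def V2_def PiE_iff)

lemma state_in: "v \<in> V1 \<times> V2 \<Longrightarrow> state v b \<in> A1 \<times> A2"
  using msg_in w0 unfolding state_def by (cases b) simp_all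

lemma block_inputs:
  assumes "b \<le> B" "r < N"
  shows "X1 v (b * N + r) = x1 (state v b) (fst (msg v b)) r"
    "X2 v (b * N + r) = x2 (state v b) (snd (msg v b)) r"
  using assms N by (simp_all add: X1_def X2_def)

lemma block_position: "c < b \<Longrightarrow> r < N \<Longrightarrow> c * N + r < b * N"
proof -
  assume "c < b" "r < N"
  then have "c * N + r < Suc c * N" by simp
  also have "\<dots> \<le> b * N" using \<open>c < b\<close> by (intro mult_le_mono1) simp
  finally show ?thesis .
qed

text \<open>Causality for user 1. Block by block it knows the state and its own word, subtracts its
  inputs from the outputs, and recovers the other message by \<open>inj2\<close>; this message
  determines the next state.\<close>

lemma states_agree1:
  assumes v: "(f, g) \<in> V1 \<times> V2" "(f, g') \<in> V1 \<times> V2" and b: "b \<le> B"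
    and Y: "\<And>j. j < b * N \<Longrightarrow> X1 (f, g) j + X2 (f, g) j = X1 (f, g') j + X2 (f, g') j"
  shows "c \<le> b \<Longrightarrow> state (f, g) c = state (f, g') c"
proof (induction c)
  case 0
  show ?case by (simp add: state_def)
next
  case (Suc c)
  then have c: "c < b" "c < B" and IH: "state (f, g) c = state (f, g') c" using b by auto
  have "g c = g' c"
  proof (rule inj2[OF state_in[OF v(1), of c]])
    show "g c \<in> A2" "g' c \<in> A2" using v c by (auto simp: V2_def PiE_iff)
    fix r assume r: "r < N"
    have "X1 (f, g) (c * N + r) + X2 (f, g) (c * N + r) = X1 (f, g') (c * N + r) + X2 (f, g') (c * N + r)"
      by (rule Y) (rule block_position[OF c(1) r])
    then show "x2 (state (f, g) c) (g c) r = x2 (state (f, g) c) (g' c) r"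
      using c r by (simp add: block_inputs IH msg_def)
  qed
  then show ?case using c by (simp add: state_def msg_def)
qed

lemma states_agree2:
  assumes v: "(f, g) \<in> V1 \<times> V2" "(f', g) \<in> V1 \<times> V2" and b: "b \<le> B"
    and Y: "\<And>j. j < b * N \<Longrightarrow> X1 (f, g) j + X2 (f, g) j = X1 (f', g) j + X2 (f', g) j"
  shows "c \<le> b \<Longrightarrow> state (f, g) c = state (f', g) c"
proof (induction c)
  case 0
  show ?case by (simp add: state_def)
next
  case (Suc c)
  then have c: "c < b" "c < B" and IH: "state (f, g) c = state (f', g) c" using b by auto
  have "f c = f' c"
  proof (rule inj1[OF state_in[OF v(1), of c]])
    show "f c \<in> A1" "f' c \<in> A1" using v c by (auto simp: V1_def PiE_iff)
    fix r assume r: "r < N"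
    have "X1 (f, g) (c * N + r) + X2 (f, g) (c * N + r) = X1 (f', g) (c * N + r) + X2 (f', g) (c * N + r)"
      by (rule Y) (rule block_position[OF c(1) r])
    then show "x1 (state (f, g) c) (f c) r = x1 (state (f, g) c) (f' c) r"
      using c r by (simp add: block_inputs IH msg_def)
  qed
  then show ?case using c by (simp add: state_def msg_def)
qed

text \<open>The range starts at 1 because the state of block 0 is fixed and does not have to be
  recovered.\<close>

definition "bad = {v \<in> V1 \<times> V2. \<exists>b\<in>{1..B}. (msg v b, state v b) \<in> ambiguous}"

text \<open>Backward decoding: the messages of block \<open>b\<close> and its outputs determine its state.\<close>
lemma backward_decoding:
  assumes v: "v \<in> V1 \<times> V2" "v' \<in> V1 \<times> V2" "v \<notin> bad"
    and Y: "\<And>j. j < Suc B * N \<Longrightarrow> X1 v j + X2 v j = X1 v' j + X2 v' j"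
  shows "v = v'"
proof -
  \<comment> \<open>Induction on the distance \<open>d\<close> from the last block, whose messages
    are \<open>w0\<close> for every \<open>v\<close>.\<close>
  have "msg v (B - d) = msg v' (B - d)" for d
  proof (induction d)
    case 0
    show ?case by (simp add: msg_def)
  next
    case (Suc d)
    show ?case
    proof (cases "d < B")
      case False
      then show ?thesis using Suc by simp
    next
      case True
      define b where "b = B - d"
      have b: "1 \<le> b" "b \<le> B" "B - Suc d = b - 1" using True by (auto simp: b_def)
      have IH: "msg v b = msg v' b" using Suc by (simp add: b_def)
      have "y (state v b) (msg v b) r = y (state v' b) (msg v b) r" if r: "r < N" for r
      proof -
        have "b * N + r < Suc B * N" by (rule block_position[OF _ r]) (use b in simp)
        from Y[OF this] show ?thesis
          using b(2) r by (simp add: block_inputs y_def IH)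
      qed
      moreover have "(msg v b, state v b) \<notin> ambiguous" using v b unfolding bad_def by auto
      ultimately have "state v b = state v' b"
        by (rule unambiguous[OF msg_in[OF v(1)] state_in[OF v(1)] state_in[OF v(2)]])
      moreover have "b = Suc (b - 1)" using b by simp
      ultimately have "msg v (b - 1) = msg v' (b - 1)"
        unfolding state_def by (metis nat.case(2))
      then show ?thesis using b by simp
    qed
  qed
  then have m: "msg v b = msg v' b" if "b < B" for b
    using that diff_diff_cancel[of b B] by (metis less_imp_le)
  obtain f g f' g' where eq: "v = (f, g)" "v' = (f', g')" by fastforce
  have "f b = f' b" "g b = g' b" if "b < B" for b
    using m[OF that] that by (simp_all add: msg_def eq)
  then have "f = f'" "g = g'"
    using v(1,2) unfolding eq V1_def V2_def by (auto intro: PiE_ext[of f "{..<B}" "\<lambda>_. A1" f'] PiE_ext[of g "{..<B}" "\<lambda>_. A2" g'])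
  then show ?thesis by (simp add: eq)
qed

text \<open>A union bound over the blocks. For \<open>b < B\<close> the messages and the state of
  block \<open>b\<close> are two independent uniform coordinates, so they are ambiguous with
  frequency \<open>card ambiguous / (card A1 * card A2)^2\<close>. For \<open>b = B\<close> the
  messages are fixed to \<open>w0\<close>, and \<open>w0_min\<close> gives the same bound.\<close>

lemma card_bad:
  assumes w0_min: "card {s \<in> A1 \<times> A2. (w0, s) \<in> ambiguous} * card (A1 \<times> A2) \<le> card ambiguous"
  shows "card bad * (card A1 * card A2)\<^sup>2 \<le> B * card ambiguous * (card V1 * card V2)"
proof -
  let ?E = "\<lambda>b. {v \<in> V1 \<times> V2. (msg v b, state v b) \<in> ambiguous}"
  let ?a = "card A1 * card A2"
  have finV: "finite V1" "finite V2" using fin by (auto simp: V1_def V2_def intro!: finite_PiE)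
  have cV: "card V1 * card V2 = ?a ^ B"
    by (simp add: V1_def V2_def card_PiE power_mult_distrib)
  have amb: "ambiguous \<subseteq> (A1 \<times> A2) \<times> (A1 \<times> A2)" unfolding ambiguous_def by blast
  have fin_amb: "finite ambiguous" by (rule finite_subset[OF amb]) (use fin in auto)
  have one: "card (?E b) * ?a\<^sup>2 \<le> card ambiguous * ?a ^ B"
    if b: "b \<in> {1..B}" for b
  proof (cases "b < B")
    case True
    define c where "c = b - 1"
    have c: "c < B" "c \<noteq> b" "b = Suc c" using True b by (auto simp: c_def)
    let ?F = "\<lambda>p. {f \<in> V1. f b = fst (fst p) \<and> f c = fst (snd p)} \<times> {g \<in> V2. g b = snd (fst p) \<and> g c = snd (snd p)}"
    have "(?E b) \<subseteq> (\<Union>p\<in>ambiguous. ?F p)"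
    proof
      fix v assume v: "v \<in> (?E b)"
      then have "v \<in> ?F (msg v b, state v b)"
        using True unfolding c(3) by (simp add: msg_def state_def mem_Times_iff)
      then show "v \<in> (\<Union>p\<in>ambiguous. ?F p)" using v by blast
    qed
    moreover have "finite (\<Union>p\<in>ambiguous. ?F p)" using finV fin_amb by simp
    ultimately have "card (?E b) \<le> card (\<Union>p\<in>ambiguous. ?F p)"
      by (intro card_mono)
    also have "\<dots> \<le> (\<Sum>p\<in>ambiguous. card (?F p))" by (rule card_UN_le[OF fin_amb])
    also have "\<dots> \<le> (\<Sum>p\<in>ambiguous. ?a ^ (B - 2))"
    proof (rule sum_mono)
      fix p
      have "card (?F p) \<le> card A1 ^ (B - 2) * card A2 ^ (B - 2)"
        unfolding card_cartesian_product V1_def V2_def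
        by (intro mult_le_mono card_PiE_two_fixed) (use c True fin in auto)
      then show "card (?F p) \<le> ?a ^ (B - 2)" by (simp only: power_mult_distrib)
    qed
    also have "\<dots> = card ambiguous * ?a ^ (B - 2)" by simp
    finally have "card (?E b) * ?a\<^sup>2 \<le> card ambiguous * ?a ^ (B - 2) * ?a\<^sup>2"
      by (rule mult_le_mono1)
    also have "\<dots> = card ambiguous * ?a ^ (B - 2 + 2)" by (simp only: power_add mult.assoc)
    also have "B - 2 + 2 = B" using True b by simp
    finally show ?thesis .
  next
    case False
    moreover have "b \<le> B" using b by simp
    ultimately have bB: "b = B" by linarith
    define c where "c = B - 1"
    have c: "c < B" "B = Suc c" unfolding c_def using B by linarith+
    let ?S = "{s \<in> A1 \<times> A2. (w0, s) \<in> ambiguous}"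
    let ?F = "\<lambda>p. {f \<in> V1. f c = fst p} \<times> {g \<in> V2. g c = snd p}"
    have finS: "finite ?S" by (rule finite_subset[of _ "A1 \<times> A2"]) (use fin in auto)
    have "(?E b) \<subseteq> (\<Union>p\<in>?S. ?F p)"
    proof
      fix v assume v: "v \<in> (?E b)"
      have "b = Suc c" using bB c(2) by simp
      then have st: "state v b = (fst v c, snd v c)" by (simp add: state_def msg_def c(1))
      then have "v \<in> ?F (state v b)"
        using v unfolding st by (simp add: mem_Times_iff)
      moreover have "state v b \<in> ?S"
      proof -
        have m: "msg v b = w0" unfolding msg_def bB by (simp only: less_irrefl if_False)
        from v have "v \<in> V1 \<times> V2" and "(msg v b, state v b) \<in> ambiguous" by (simp_all only: mem_Collect_eq)
        then show ?thesis unfolding m by (intro CollectI conjI state_in)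
      qed
      ultimately show "v \<in> (\<Union>p\<in>?S. ?F p)" by (rule UN_I[rotated])
    qed
    moreover have "finite (\<Union>p\<in>?S. ?F p)" using finV finS by simp
    ultimately have "card (?E b) \<le> card (\<Union>p\<in>?S. ?F p)"
      by (intro card_mono)
    also have "\<dots> \<le> (\<Sum>p\<in>?S. card (?F p))" by (rule card_UN_le[OF finS])
    also have "\<dots> \<le> (\<Sum>p\<in>?S. ?a ^ (B - 1))"
    proof (rule sum_mono)
      fix p
      have "card (?F p) \<le> card A1 ^ (B - 1) * card A2 ^ (B - 1)"
        unfolding card_cartesian_product V1_def V2_def
        by (intro mult_le_mono card_PiE_one_fixed) (use c fin in auto)
      then show "card (?F p) \<le> ?a ^ (B - 1)" by (simp only: power_mult_distrib)
    qed
    also have "\<dots> = card ?S * ?a ^ (B - 1)" by simp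
    finally have "card (?E b) * ?a\<^sup>2 \<le> card ?S * ?a ^ (B - 1) * ?a\<^sup>2"
      by (rule mult_le_mono1)
    also have "\<dots> = (card ?S * ?a) * ?a ^ Suc (B - 1)" by (simp only: power2_eq_square power_Suc mult_ac)
    also have "Suc (B - 1) = B" using B by simp
    also have "(card ?S * ?a) * ?a ^ B \<le> card ambiguous * ?a ^ B"
      using w0_min by (intro mult_le_mono1) (simp add: card_cartesian_product)
    finally show ?thesis .
  qed
  have "bad = (\<Union>b\<in>{1..B}. (?E b))"
    unfolding bad_def by blast
  then have "card bad \<le> (\<Sum>b\<in>{1..B}. card (?E b))"
    by (simp only: card_UN_le finite_atLeastAtMost)
  then have "card bad * ?a\<^sup>2 \<le> (\<Sum>b\<in>{1..B}. card (?E b)) * ?a\<^sup>2"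
    by (rule mult_le_mono1)
  also have "\<dots> = (\<Sum>b\<in>{1..B}. card (?E b) * ?a\<^sup>2)"
    by (rule sum_distrib_right)
  also have "\<dots> \<le> (\<Sum>b\<in>{1..B}. card ambiguous * ?a ^ B)"
    by (rule sum_mono) (rule one)
  also have "\<dots> = B * card ambiguous * (card V1 * card V2)" by (simp add: cV)
  finally show ?thesis .
qed

lemma block_scheme:
  assumes w0_min: "card {s \<in> A1 \<times> A2. (w0, s) \<in> ambiguous} * card (A1 \<times> A2) \<le> card ambiguous"
    and n: "n \<ge> Suc B * N"
  shows "\<exists>e1 e2 g. binary_erasure.is_code n (card A1 ^ B) (card A2 ^ B) e1 e2 g \<and>
    binary_erasure.error_prob n (card A1 ^ B) (card A2 ^ B) e1 e2 g
      \<le> B * (card ambiguous / (card A1 * card A2)\<^sup>2)"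
proof -
  have finV: "finite V1" "finite V2" using fin by (auto simp: V1_def V2_def intro!: finite_PiE)
  have neV: "V1 \<noteq> {}" "V2 \<noteq> {}" using ne by (auto simp: V1_def V2_def PiE_eq_empty_iff)
  have cV: "card V1 = card A1 ^ B" "card V2 = card A2 ^ B" by (simp_all add: V1_def V2_def card_PiE)
  have "\<exists>e1 e2 g. binary_erasure.is_code n (card V1) (card V2) e1 e2 g \<and>
    binary_erasure.error_prob n (card V1) (card V2) e1 e2 g \<le> card bad / (card V1 * card V2)"
  proof (rule code_from_causal_inputs[OF finV neV, where ?X1.0 = X1 and ?X2.0 = X2])
    show "X1 v i \<in> {0, 1}" "X2 v i \<in> {0, 1}" for v i using bits by (simp_all add: X1_def X2_def)
    show "bad \<subseteq> V1 \<times> V2" unfolding bad_def by blast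
    show "v = v'" if "v \<in> V1 \<times> V2" "v' \<in> V1 \<times> V2" "v \<notin> bad"
      "\<And>j. j < n \<Longrightarrow> X1 v j + X2 v j = X1 v' j + X2 v' j" for v v'
      using n by (intro backward_decoding[OF that(1-3)] that(4)) simp
    show "X1 (f, g) i = X1 (f, g') i" if "f \<in> V1" "g \<in> V2" "g' \<in> V2"
      and Y: "\<And>j. j < i \<Longrightarrow> X1 (f, g) j + X2 (f, g) j = X1 (f, g') j + X2 (f, g') j" for f g g' i
    proof (cases "i div N \<le> B")
      case True
      have "state (f, g) (i div N) = state (f, g') (i div N)"
        by (rule states_agree1[OF _ _ True])
           (use that in simp, use that in simp, rule Y, rule less_le_trans[OF _ div_times_less_eq_dividend], assumption, rule order_refl)
      then show ?thesis by (simp add: X1_def msg_def)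
    qed (simp add: X1_def)
    show "X2 (f, g) i = X2 (f', g) i" if "f \<in> V1" "f' \<in> V1" "g \<in> V2"
      and Y: "\<And>j. j < i \<Longrightarrow> X1 (f, g) j + X2 (f, g) j = X1 (f', g) j + X2 (f', g) j" for f f' g i
    proof (cases "i div N \<le> B")
      case True
      have "state (f, g) (i div N) = state (f', g) (i div N)"
        by (rule states_agree2[OF _ _ True])
           (use that in simp, use that in simp, rule Y, rule less_le_trans[OF _ div_times_less_eq_dividend], assumption, rule order_refl)
      then show ?thesis by (simp add: X2_def msg_def)
    qed (simp add: X2_def)
  qed
  moreover have "card bad / (card V1 * card V2) \<le> B * (card ambiguous / (card A1 * card A2)\<^sup>2)"
  proof -
    have pos: "card V1 * card V2 > 0" "card A1 * card A2 > 0"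
      using finV neV fin ne by (simp_all add: card_gt_0_iff)
    have "real (card bad * (card A1 * card A2)\<^sup>2) \<le> real (B * card ambiguous * (card V1 * card V2))"
      by (rule of_nat_mono, rule card_bad[OF w0_min])
    then have "real (card bad) * (real (card A1 * card A2))\<^sup>2 \<le> real B * real (card ambiguous) * real (card V1 * card V2)"
      by (simp only: of_nat_mult of_nat_power)
    moreover have "real (card V1 * card V2) > 0" "(real (card A1 * card A2))\<^sup>2 > 0" using pos by simp_all
    ultimately show ?thesis
      by (simp only: of_nat_power times_divide_eq_right pos_divide_le_eq pos_le_divide_eq times_divide_eq_left)
  qed
  ultimately show ?thesis unfolding cV by (meson order_trans)
qed

end

lemma multi_block_code:
  assumes "B \<ge> 1" "n \<ge> Suc B * N"
  shows "\<exists>e1 e2 g. binary_erasure.is_code n (card A1 ^ B) (card A2 ^ B) e1 e2 g \<and>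
    binary_erasure.error_prob n (card A1 ^ B) (card A2 ^ B) e1 e2 g
      \<le> B * (card ambiguous / (card A1 * card A2)\<^sup>2)"
proof -
  have A: "finite (A1 \<times> A2)" "A1 \<times> A2 \<noteq> {}" using fin ne by auto
  have "ambiguous \<inter> (A1 \<times> A2) \<times> (A1 \<times> A2) = ambiguous" unfolding ambiguous_def by blast
  then obtain w0 where "w0 \<in> A1 \<times> A2"
    "card {s \<in> A1 \<times> A2. (w0, s) \<in> ambiguous} * card (A1 \<times> A2) \<le> card ambiguous"
    using ex_small_section[OF A A(1), of ambiguous] by auto
  from block_scheme[OF assms(1) this assms(2)] show ?thesis .
qed

end

section \<open>Random scrambling\<close>

text \<open>
  Choosing the \<open>\<omega> s\<close> one after the other, each better than average, keeps the total number of
  collisions below its mean for independent uniform choices.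
\<close>
lemma greedy_few_collisions:
  fixes y :: "'w \<Rightarrow> 'o \<Rightarrow> 'z" and K :: real
  assumes \<Omega>: "finite \<Omega>" "\<Omega> \<noteq> {}" and W: "finite W" and K: "K \<ge> 0"
    and unif: "\<And>w z. w \<in> W \<Longrightarrow> card {\<omega> \<in> \<Omega>. y w \<omega> = z} * K \<le> card \<Omega>"
    and S: "finite S"
  shows "\<exists>f. (\<forall>s\<in>S. f s \<in> \<Omega>) \<and>
    K * (\<Sum>w\<in>W. card {(s, s'). s \<in> S \<and> s' \<in> S \<and> s \<noteq> s' \<and> y w (f s) = y w (f s')}) \<le> card W * (card S)\<^sup>2"
  using S
proof (induction S)
  case empty
  show ?case by simp
next
  case (insert s0 S)
  then obtain f where f: "\<And>s. s \<in> S \<Longrightarrow> f s \<in> \<Omega>" and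
    IH: "K * (\<Sum>w\<in>W. card {(s, s'). s \<in> S \<and> s' \<in> S \<and> s \<noteq> s' \<and> y w (f s) = y w (f s')}) \<le> card W * (card S)\<^sup>2"
    by blast
  \<comment> \<open>Collisions of a candidate for \<open>s0\<close> with the states already treated.
    By \<open>unif\<close> the mean of \<open>K * cost\<close> over the candidates is at most
    \<open>card W * card S\<close>. Ordered pairs count each new collision twice, and
    \<open>m^2 + 2 * m \<le> (m + 1)^2\<close> closes the induction.\<close>
  define cost where "cost = (\<lambda>\<omega>. \<Sum>w\<in>W. card {s \<in> S. y w (f s) = y w \<omega>})"
  have "\<exists>\<omega>\<in>\<Omega>. K * cost \<omega> \<le> card W * card S"
  proof (rule ccontr)
    assume "\<not> ?thesis"
    then have *: "real (card W * card S) < K * cost \<omega>" if "\<omega> \<in> \<Omega>" for \<omega> using that by (meson not_le)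
    have "real (card \<Omega>) * real (card W * card S) = (\<Sum>\<omega>\<in>\<Omega>. real (card W * card S))" by simp
    also have "\<dots> < (\<Sum>\<omega>\<in>\<Omega>. K * cost \<omega>)" by (rule sum_strict_mono[OF \<Omega>]) (rule *)
    also have "(\<Sum>\<omega>\<in>\<Omega>. K * cost \<omega>) = K * (\<Sum>\<omega>\<in>\<Omega>. \<Sum>w\<in>W. \<Sum>s\<in>S. of_bool (y w \<omega> = y w (f s)))"
      unfolding cost_def sum_distrib_left[symmetric]
    proof (rule arg_cong[where f = "\<lambda>x. K * x"], simp only: of_nat_sum, intro sum.cong refl)
      fix \<omega> w
      have "real (card {s \<in> S. y w (f s) = y w \<omega>}) = (\<Sum>s\<in>S. of_bool (y w (f s) = y w \<omega>))"
        using insert.hyps(1) by (simp add: Int_def)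
      then show "real (card {s \<in> S. y w (f s) = y w \<omega>}) = (\<Sum>s\<in>S. of_bool (y w \<omega> = y w (f s)))"
        by (simp only: eq_commute)
    qed
    also have "(\<Sum>\<omega>\<in>\<Omega>. \<Sum>w\<in>W. \<Sum>s\<in>S. of_bool (y w \<omega> = y w (f s))) = (\<Sum>w\<in>W. \<Sum>s\<in>S. \<Sum>\<omega>\<in>\<Omega>. of_bool (y w \<omega> = y w (f s)) :: real)"
      by (subst sum.swap, rule sum.cong[OF refl], rule sum.swap)
    also have "\<dots> = (\<Sum>w\<in>W. \<Sum>s\<in>S. real (card {\<omega> \<in> \<Omega>. y w \<omega> = y w (f s)}))"
      using \<Omega> by (simp add: Int_def)
    also have "K * \<dots> = (\<Sum>w\<in>W. \<Sum>s\<in>S. real (card {\<omega> \<in> \<Omega>. y w \<omega> = y w (f s)}) * K)"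
      by (simp add: sum_distrib_left mult.commute)
    also have "\<dots> \<le> (\<Sum>w\<in>W. \<Sum>s\<in>S. real (card \<Omega>))"
      by (intro sum_mono unif)
    also have "\<dots> = real (card \<Omega>) * real (card W * card S)" by simp
    finally show False by simp
  qed
  then obtain \<omega> where \<omega>: "\<omega> \<in> \<Omega>" "K * cost \<omega> \<le> card W * card S" by blast
  let ?f = "f(s0 := \<omega>)"
  let ?C = "\<lambda>f S w. {(s, s'). s \<in> S \<and> s' \<in> S \<and> s \<noteq> s' \<and> y w (f s) = y w (f s')}"
  have "card (?C ?f (insert s0 S) w) \<le> card (?C f S w) + 2 * card {s \<in> S. y w (f s) = y w \<omega>}" for w
  proof -
    let ?T = "{s \<in> S. y w (f s) = y w \<omega>}"
    have fin: "finite (?C f S w)" "finite ?T"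
      using insert.hyps(1) by (auto intro: finite_subset[of _ "S \<times> S"])
    have "?C ?f (insert s0 S) w \<subseteq> ?C f S w \<union> ((\<lambda>s. (s, s0)) ` ?T \<union> (\<lambda>s. (s0, s)) ` ?T)"
      using insert.hyps(2) by (auto split: if_splits)
    then have "card (?C ?f (insert s0 S) w) \<le> card (?C f S w \<union> ((\<lambda>s. (s, s0)) ` ?T \<union> (\<lambda>s. (s0, s)) ` ?T))"
      using fin by (intro card_mono finite_UnI finite_imageI)
    also have "\<dots> \<le> card (?C f S w) + (card ((\<lambda>s. (s, s0)) ` ?T) + card ((\<lambda>s. (s0, s)) ` ?T))"
      by (meson card_Un_le add_left_mono order_trans)
    also have "\<dots> \<le> card (?C f S w) + (card ?T + card ?T)"
      by (intro add_mono order_refl card_image_le fin)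
    finally show ?thesis by simp
  qed
  then have "(\<Sum>w\<in>W. card (?C ?f (insert s0 S) w)) \<le> (\<Sum>w\<in>W. card (?C f S w) + 2 * card {s \<in> S. y w (f s) = y w \<omega>})"
    by (rule sum_mono)
  also have "\<dots> = (\<Sum>w\<in>W. card (?C f S w)) + 2 * cost \<omega>"
    by (simp add: sum.distrib sum_distrib_left cost_def)
  finally have "real (\<Sum>w\<in>W. card (?C ?f (insert s0 S) w)) \<le> real ((\<Sum>w\<in>W. card (?C f S w)) + 2 * cost \<omega>)"
    by (rule of_nat_mono)
  then have "K * real (\<Sum>w\<in>W. card (?C ?f (insert s0 S) w)) \<le> K * real ((\<Sum>w\<in>W. card (?C f S w)) + 2 * cost \<omega>)"
    by (rule mult_left_mono[OF _ K])
  also have "\<dots> = K * real (\<Sum>w\<in>W. card (?C f S w)) + 2 * (K * cost \<omega>)"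
    by (simp only: of_nat_add of_nat_mult of_nat_numeral distrib_left mult.left_commute)
  also have "\<dots> \<le> real (card W) * (real (card S))\<^sup>2 + 2 * (real (card W) * real (card S))"
    using IH \<omega>(2) by (intro add_mono mult_left_mono) simp_all
  also have "\<dots> \<le> real (card W) * (real (card S) + 1)\<^sup>2"
    by (simp add: power2_eq_square algebra_simps)
  also have "\<dots> = card W * (card (insert s0 S))\<^sup>2"
    using insert.hyps by (simp add: add.commute)
  finally have "K * real (\<Sum>w\<in>W. card (?C ?f (insert s0 S) w)) \<le> card W * (card (insert s0 S))\<^sup>2" .
  moreover have "\<forall>s\<in>insert s0 S. ?f s \<in> \<Omega>" using f \<omega>(1) by simp
  ultimately show ?case by blast
qed

section \<open>Counting permutations and scramblers\<close>

lemma ex_permutation_onto: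
  assumes "finite S" "D \<subseteq> S" "D' \<subseteq> S" "card D = card D'"
  shows "\<exists>p. p permutes S \<and> p ` D = D'"
proof -
  have fin: "finite D" "finite D'" using assms finite_subset by blast+
  obtain f where f: "bij_betw f D D'" using finite_same_card_bij[OF fin assms(4)] by blast
  have "card (S - D) = card (S - D')" using assms fin by (simp add: card_Diff_subset)
  then obtain g where g: "bij_betw g (S - D) (S - D')"
    using finite_same_card_bij[of "S - D" "S - D'"] assms(1) by blast
  define p where "p = (\<lambda>x. if x \<in> D then f x else if x \<in> S then g x else x)"
  have 1: "bij_betw p D D'" using f by (rule bij_betw_cong[THEN iffD1, rotated]) (simp add: p_def)
  have 2: "bij_betw p (S - D) (S - D')" using g by (rule bij_betw_cong[THEN iffD1, rotated]) (simp add: p_def)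
  have "bij_betw p (D \<union> (S - D)) (D' \<union> (S - D'))" by (rule bij_betw_combine[OF 1 2]) blast
  then have "bij_betw p S S" using assms(2,3) by (simp add: Un_absorb1)
  then have "p permutes S" by (rule bij_imp_permutes) (use assms(2) in \<open>auto simp: p_def\<close>)
  moreover have "p ` D = D'" using 1 by (simp add: bij_betw_def)
  ultimately show ?thesis by blast
qed

text \<open>Composing with a permutation that carries \<open>E\<close> to \<open>E'\<close> shows
  that every image of the same size is attained equally often, and these images partition all
  permutations.\<close>

lemma card_permutations_onto:
  assumes S: "finite S" and D: "D \<subseteq> S" "D' \<subseteq> S" "card D = card D'"
  shows "card {p. p permutes S \<and> p ` D = D'} * (card S choose card D) = fact (card S)"
proof -
  let ?P = "\<lambda>D'. {p. p permutes S \<and> p ` D = D'}"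
  have fin: "finite (?P E)" for E by (rule finite_subset[OF _ finite_permutations[OF S]]) blast
  have le: "card (?P E) \<le> card (?P E')" if E: "E \<subseteq> S" "E' \<subseteq> S" "card E = card E'" for E E'
  proof -
    obtain q where q: "q permutes S" "q ` E = E'" using ex_permutation_onto[OF S E] by blast
    have "(\<lambda>p. q \<circ> p) ` ?P E \<subseteq> ?P E'"
      using q by (auto simp: permutes_compose image_comp[symmetric])
    moreover have "inj_on (\<lambda>p. q \<circ> p) (?P E)"
      by (rule inj_onI) (metis comp_assoc permutes_inv_o(2)[OF q(1)] id_comp)
    ultimately show ?thesis using card_inj_on_le fin by blast
  qed
  let ?C = "{E. E \<subseteq> S \<and> card E = card D}"
  have eq: "card (?P E) = card (?P D')" if "E \<in> ?C" for E
    using le[of E D'] le[of D' E] that D by (intro antisym) auto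
  have "{p. p permutes S} = (\<Union>E\<in>?C. ?P E)"
  proof (intro equalityI subsetI)
    fix p assume p: "p \<in> {p. p permutes S}"
    then have "p ` D \<subseteq> S" using D(1) permutes_image[of p S] by blast
    moreover have "card (p ` D) = card D"
      using p by (intro card_image) (auto intro: inj_on_subset[OF permutes_inj])
    ultimately show "p \<in> (\<Union>E\<in>?C. ?P E)" using p by blast
  qed blast
  then have "fact (card S) = card (\<Union>E\<in>?C. ?P E)"
    using card_permutations[OF refl S] by simp
  also have "\<dots> = (\<Sum>E\<in>?C. card (?P E))"
    by (rule card_UN_disjoint) (use fin S in \<open>auto intro: finite_subset[of _ "Pow S"]\<close>)
  also have "\<dots> = (\<Sum>E\<in>?C. card (?P D'))" by (rule sum.cong[OF refl]) (rule eq)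
  also have "\<dots> = card (?P D') * card ?C" by simp
  also have "card ?C = card S choose card D" by (rule n_subsets[OF S])
  finally show ?thesis by simp
qed

text \<open>Subsets of \<open>{..<N}\<close> stand for binary words and \<open>sym_diff\<close> for
  addition modulo 2. Both users apply the same \<open>\<omega>\<close>, so the number of erasures is
  unchanged while their positions and the remaining symbols are randomised.\<close>

definition scramble :: "(nat \<Rightarrow> nat) \<times> nat set \<Rightarrow> nat set \<Rightarrow> nat set" where
  "scramble \<omega> w = sym_diff (fst \<omega> ` w) (snd \<omega>)"

definition scramblers :: "nat \<Rightarrow> ((nat \<Rightarrow> nat) \<times> nat set) set" where
  "scramblers N = {p. p permutes {..<N}} \<times> Pow {..<N}"

lemma finite_scramblers: "finite (scramblers N)" and card_scramblers: "card (scramblers N) = fact N * 2 ^ N"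
  unfolding scramblers_def
  by (auto simp: finite_permutations card_cartesian_product card_permutations card_Pow)

lemma scramblers_nonempty: "scramblers N \<noteq> {}"
  using card_scramblers[of N] by force

text \<open>
  The erased and the doubled positions of the sum of two scrambled words; a uniform scrambler maps
  a pair of words uniformly onto the outputs with the same number of erasures.
\<close>
definition sum_pattern :: "nat set \<times> nat set \<Rightarrow> (nat \<Rightarrow> nat) \<times> nat set \<Rightarrow> nat set \<times> nat set" where
  "sum_pattern w \<omega> = (sym_diff (scramble \<omega> (fst w)) (scramble \<omega> (snd w)), scramble \<omega> (fst w) \<inter> scramble \<omega> (snd w))"

text \<open>The translation cancels in the erased set, so the permutation must carry the difference
  set of the two words onto \<open>D\<close>: a fraction 1 over \<open>N choose e\<close>. Off
  \<open>D\<close> both scrambled words equal \<open>P\<close>, which forces the translation there;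
  on \<open>D\<close> at most \<open>2 ^ e\<close> choices remain.\<close>

lemma card_sum_pattern:
  assumes w: "fst w \<subseteq> {..<N}" "snd w \<subseteq> {..<N}"
  defines "e \<equiv> card (sym_diff (fst w) (snd w))"
  shows "card {\<omega> \<in> scramblers N. sum_pattern w \<omega> = z} * ((N choose e) * 2 ^ (N - e)) \<le> card (scramblers N)"
proof (cases "\<exists>\<omega>\<in>scramblers N. sum_pattern w \<omega> = z")
  case False
  then have "{\<omega> \<in> scramblers N. sum_pattern w \<omega> = z} = {}" by blast
  then show ?thesis by (simp only: card.empty mult_0 le0)
next
  case True
  let ?Z = "{\<omega> \<in> scramblers N. sum_pattern w \<omega> = z}" and ?S = "{..<N}" and ?D0 = "sym_diff (fst w) (snd w)"
  obtain D P where z: "z = (D, P)" by fastforce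
  have D0: "?D0 \<subseteq> ?S" using w by blast
  have img: "sym_diff (scramble \<omega> (fst w)) (scramble \<omega> (snd w)) = fst \<omega> ` ?D0" if "\<omega> \<in> scramblers N" for \<omega>
  proof -
    have "inj (fst \<omega>)" using that by (auto simp: scramblers_def permutes_inj)
    then have "fst \<omega> ` ?D0 = sym_diff (fst \<omega> ` fst w) (fst \<omega> ` snd w)"
      by (simp add: image_Un image_set_diff)
    then show ?thesis by (auto simp: scramble_def)
  qed
  have "D \<subseteq> ?S" "card D = e"
  proof -
    from True obtain \<omega> where \<omega>: "\<omega> \<in> scramblers N" "sum_pattern w \<omega> = z" by blast
    then have "D = fst \<omega> ` ?D0" using img[OF \<omega>(1)] by (simp add: sum_pattern_def z)
    moreover have p: "fst \<omega> permutes ?S" using \<omega>(1) by (auto simp: scramblers_def)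
    moreover have "card (fst \<omega> ` ?D0) = e"
      unfolding e_def by (rule card_image) (rule inj_on_subset[OF permutes_inj[OF p]], simp)
    ultimately show "D \<subseteq> ?S" "card D = e" using D0 permutes_image[OF p] by blast+
  qed
  note D = this
  have e: "e \<le> N" using card_mono[OF _ D(1)] D(2) by simp
  let ?Q = "{p. p permutes ?S \<and> p ` ?D0 = D}"
  let ?R = "\<lambda>p. {t \<in> Pow ?S. t - D = sym_diff (p ` fst w) P - D}"
  have sub: "?Z \<subseteq>
      (SIGMA p:?Q. ?R p)"
  proof
    fix \<omega> assume \<omega>: "\<omega> \<in> ?Z"
    obtain p t where pt: "\<omega> = (p, t)" by fastforce
    have p: "p permutes ?S" and t: "t \<subseteq> ?S" using \<omega> by (auto simp: scramblers_def pt)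
    have D1: "p ` ?D0 = D" using \<omega> img[of \<omega>] by (simp add: sum_pattern_def z pt)
    have D2: "sym_diff (scramble (p, t) (fst w)) (scramble (p, t) (snd w)) = D"
      and P: "scramble (p, t) (fst w) \<inter> scramble (p, t) (snd w) = P"
      using \<omega> by (simp_all add: sum_pattern_def z pt)
    have "t - D = sym_diff (p ` fst w) P - D"
      unfolding P[symmetric] D2[symmetric] scramble_def fst_conv snd_conv by blast
    then show "\<omega> \<in> (SIGMA p:?Q. ?R p)"
      using p t D1 by (simp add: pt)
  qed
  have finQ: "finite ?Q" by (rule finite_subset[OF _ finite_permutations[of ?S]]) auto
  have "card {t \<in> Pow ?S. t - D = R} \<le> 2 ^ e" for R
  proof -
    have "inj_on (\<lambda>t. t \<inter> D) {t \<in> Pow ?S. t - D = R}" by (rule inj_onI) blast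
    moreover have "(\<lambda>t. t \<inter> D) ` {t \<in> Pow ?S. t - D = R} \<subseteq> Pow D" by blast
    moreover have "finite (Pow D)" using D(1) finite_subset by blast
    ultimately have "card {t \<in> Pow ?S. t - D = R} \<le> card (Pow D)" by (rule card_inj_on_le)
    also have "\<dots> = 2 ^ e" using D finite_subset[OF D(1)] by (simp add: card_Pow)
    finally show ?thesis .
  qed
  then have "(\<Sum>p\<in>?Q. card (?R p)) \<le> (\<Sum>p\<in>?Q. 2 ^ e)"
    by (intro sum_mono)
  moreover have finR: "\<forall>p\<in>?Q. finite (?R p)" by simp
  ultimately have "card (SIGMA p:?Q. ?R p) \<le> (\<Sum>p\<in>?Q. 2 ^ e)"
    by (simp only: card_SigmaI[OF finQ finR])
  moreover have "finite (SIGMA p:?Q. ?R p)"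
    by (rule finite_SigmaI[OF finQ]) simp
  ultimately have "card ?Z \<le> (\<Sum>p\<in>?Q. 2 ^ e)"
    using card_mono[OF _ sub] order_trans by blast
  then have "card ?Z \<le> card ?Q * 2 ^ e"
    by (simp only: sum_constant of_nat_id)
  then have "card ?Z * ((N choose e) * 2 ^ (N - e))
      \<le> card ?Q * 2 ^ e * ((N choose e) * 2 ^ (N - e))" by (rule mult_le_mono1)
  also have "\<dots> = (card ?Q * (N choose e)) * 2 ^ (e + (N - e))" by (simp only: power_add mult_ac)
  also have "card ?Q * (N choose e) = fact N"
    using card_permutations_onto[OF _ D0 D(1)] D(2) by (simp add: e_def)
  also have "e + (N - e) = N" using e by simp
  finally show ?thesis by (simp only: card_scramblers)
qed

section \<open>Concentration of intersections\<close>

lemma card_subsets_containing: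
  assumes "finite S" "I \<subseteq> S" "card I \<le> k"
  shows "card {w. w \<subseteq> S \<and> card w = k \<and> I \<subseteq> w} = (card S - card I) choose (k - card I)"
proof -
  have finI: "finite I" using assms finite_subset by blast
  have "bij_betw (\<lambda>w. w - I) {w. w \<subseteq> S \<and> card w = k \<and> I \<subseteq> w} {v. v \<subseteq> S - I \<and> card v = k - card I}"
  proof (rule bij_betw_byWitness[where f' = "\<lambda>v. v \<union> I"])
    show "(\<lambda>w. w - I) ` {w. w \<subseteq> S \<and> card w = k \<and> I \<subseteq> w} \<subseteq> {v. v \<subseteq> S - I \<and> card v = k - card I}"
      using finI by (auto simp: card_Diff_subset)
    show "(\<lambda>v. v \<union> I) ` {v. v \<subseteq> S - I \<and> card v = k - card I} \<subseteq> {w. w \<subseteq> S \<and> card w = k \<and> I \<subseteq> w}"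
    proof clarify
      fix v assume v: "v \<subseteq> S - I" "card v = k - card I"
      have "finite v" using v assms finite_subset by blast
      then have "card (v \<union> I) = card v + card I" using v finI by (intro card_Un_disjoint) auto
      then show "v \<union> I \<subseteq> S \<and> card (v \<union> I) = k \<and> I \<subseteq> v \<union> I" using v assms by auto
    qed
  qed auto
  then have "card {w. w \<subseteq> S \<and> card w = k \<and> I \<subseteq> w} = card {v. v \<subseteq> S - I \<and> card v = k - card I}"
    by (rule bij_betw_same_card)
  also have "\<dots> = card (S - I) choose (k - card I)" using assms by (intro n_subsets) simp
  finally show ?thesis using assms finI by (simp add: card_Diff_subset)
qed

context
  fixes N k :: nat and A :: "nat set set"
  assumes N: "N > 0" and k: "k \<le> N"
  defines "A \<equiv> {w. w \<subseteq> {..<N} \<and> card w = k}"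
begin

lemma finite_weight_class: "finite A"
  unfolding A_def by (rule finite_subset[of _ "Pow {..<N}"]) auto

lemma card_weight_class: "card A = N choose k"
  unfolding A_def using n_subsets[of "{..<N}" k] by simp

lemma card_containing_one:
  assumes "i < N"
  shows "real N * card {w \<in> A. i \<in> w} = real k * card A"
proof (cases "k = 0")
  case True
  then have "{w \<in> A. i \<in> w} = {}" unfolding A_def by (auto dest: finite_subset)
  then have "card {w \<in> A. i \<in> w} = 0" by (simp only: card.empty)
  then show ?thesis using True by simp
next
  case False
  have "{w \<in> A. i \<in> w} = {w. w \<subseteq> {..<N} \<and> card w = k \<and> {i} \<subseteq> w}" unfolding A_def by auto
  then have "card {w \<in> A. i \<in> w} = (N - 1) choose (k - 1)"
    using card_subsets_containing[of "{..<N}" "{i}" k] assms False by simp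
  moreover have "k * (N choose k) = N * ((N - 1) choose (k - 1))"
    using False by (intro times_binomial_minus1_eq) simp
  ultimately show ?thesis unfolding card_weight_class by (metis of_nat_mult)
qed

text \<open>Negative correlation: the exact proportion is
  \<open>k * (k - 1) / (N * (N - 1))\<close>, and
  \<open>(k - 1) * N \<le> k * (N - 1)\<close>.\<close>

lemma card_containing_two:
  assumes "i < N" "j < N" "i \<noteq> j"
  shows "(real N)\<^sup>2 * card {w \<in> A. i \<in> w \<and> j \<in> w} \<le> (real k)\<^sup>2 * card A"
proof (cases "k \<ge> 2")
  case False
  have "{w \<in> A. i \<in> w \<and> j \<in> w} = {}"
  proof (rule ccontr)
    assume "{w \<in> A. i \<in> w \<and> j \<in> w} \<noteq> {}"
    then obtain w where w: "w \<subseteq> {..<N}" "card w = k" "{i, j} \<subseteq> w" unfolding A_def by auto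
    have "card {i, j} \<le> card w" using w by (intro card_mono) (auto dest: finite_subset)
    then show False using False w(2) assms(3) by simp
  qed
  then show ?thesis by (simp only: card.empty) simp
next
  case True
  have N2: "N \<ge> 2" using assms by linarith
  have "{w \<in> A. i \<in> w \<and> j \<in> w} = {w. w \<subseteq> {..<N} \<and> card w = k \<and> {i, j} \<subseteq> w}" unfolding A_def by auto
  then have c: "card {w \<in> A. i \<in> w \<and> j \<in> w} = (N - 2) choose (k - 2)"
    using card_subsets_containing[of "{..<N}" "{i, j}" k] assms True by (simp add: numeral_2_eq_2)
  have 1: "k * (N choose k) = N * ((N - 1) choose (k - 1))"
    using True by (intro times_binomial_minus1_eq) simp
  have 2: "(k - 1) * ((N - 1) choose (k - 1)) = (N - 1) * ((N - 2) choose (k - 2))"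
    using times_binomial_minus1_eq[of "k - 1" "N - 1"] True by (simp add: numeral_2_eq_2)
  have "(k - 1) * (k * (N choose k)) = N * ((N - 1) * ((N - 2) choose (k - 2)))"
    unfolding 1 using 2 by (simp add: mult.left_commute)
  then have "real ((k - 1) * (k * (N choose k))) = real (N * ((N - 1) * ((N - 2) choose (k - 2))))" by (simp only:)
  then have eq: "real (k - 1) * real k * real (card A) = real N * real (N - 1) * real (card {w \<in> A. i \<in> w \<and> j \<in> w})"
    unfolding c card_weight_class by (simp only: of_nat_mult mult.assoc)
  have le: "real (k - 1) * real N \<le> real k * real (N - 1)"
    using k N True by (simp add: of_nat_diff algebra_simps)
  have "real (N - 1) * ((real N)\<^sup>2 * card {w \<in> A. i \<in> w \<and> j \<in> w})
      = real N * (real N * real (N - 1) * real (card {w \<in> A. i \<in> w \<and> j \<in> w}))"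
    by (simp add: power2_eq_square)
  also have "\<dots> = (real (k - 1) * real N) * (real k * card A)"
    unfolding eq[symmetric] by (simp only: mult_ac)
  also have "\<dots> \<le> (real k * real (N - 1)) * (real k * card A)"
    by (rule mult_right_mono[OF le]) simp
  also have "\<dots> = real (N - 1) * ((real k)\<^sup>2 * card A)"
    by (simp add: power2_eq_square)
  finally show ?thesis using N2 by simp
qed

lemma real_card_Int_eq_sum:
  assumes "v \<subseteq> {..<N}"
  shows "real (card (w \<inter> v)) = (\<Sum>i\<in>v. of_bool (i \<in> w))"
proof -
  have "finite v" using assms finite_subset by blast
  then show ?thesis by (simp add: Int_def conj_commute)
qed

text \<open>In the second moment the diagonal contributes \<open>\<mu>\<close> and, by negative
  correlation, the rest at most the square of \<open>\<mu>\<close>, so the variance is at most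
  \<open>\<mu> \<le> N\<close>.\<close>

lemma intersection_variance:
  assumes v: "v \<subseteq> {..<N}"
  defines "\<mu> \<equiv> real k * real (card v) / real N"
  shows "(\<Sum>w\<in>A. (real (card (w \<inter> v)) - \<mu>)\<^sup>2) \<le> real N * card A"
proof -
  have finv: "finite v" using v finite_subset by blast
  let ?T = "real (card A)" and ?l = "real (card v)"
  have one: "real (card {w \<in> A. i \<in> w}) = real k / real N * ?T" if "i \<in> v" for i
    using card_containing_one[of i] v that N by (auto simp: field_simps)
  have two: "real (card {w \<in> A. i \<in> w \<and> j \<in> w}) \<le> (real k / real N)\<^sup>2 * ?T" if "i \<in> v" "j \<in> v" "i \<noteq> j" for i j
    using card_containing_two[of i j] v that N by (auto simp: power_divide field_simps)
  have S1: "(\<Sum>w\<in>A. real (card (w \<inter> v))) = \<mu> * ?T"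
  proof -
    have "(\<Sum>w\<in>A. real (card (w \<inter> v))) = (\<Sum>i\<in>v. \<Sum>w\<in>A. of_bool (i \<in> w))"
      unfolding real_card_Int_eq_sum[OF v] by (rule sum.swap)
    also have "\<dots> = (\<Sum>i\<in>v. real k / real N * ?T)"
      by (rule sum.cong[OF refl]) (use finite_weight_class one in \<open>simp add: Int_def\<close>)
    finally show ?thesis by (simp add: \<mu>_def)
  qed
  have S2: "(\<Sum>w\<in>A. (real (card (w \<inter> v)))\<^sup>2) \<le> \<mu> * ?T + \<mu>\<^sup>2 * ?T"
  proof -
    have "(\<Sum>w\<in>A. (real (card (w \<inter> v)))\<^sup>2) = (\<Sum>w\<in>A. \<Sum>i\<in>v. \<Sum>j\<in>v. of_bool (i \<in> w \<and> j \<in> w))"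
      unfolding real_card_Int_eq_sum[OF v] power2_eq_square sum_product by (simp add: of_bool_conj)
    also have "\<dots> = (\<Sum>i\<in>v. \<Sum>j\<in>v. \<Sum>w\<in>A. of_bool (i \<in> w \<and> j \<in> w))"
      by (subst sum.swap, rule sum.cong[OF refl], rule sum.swap)
    also have "\<dots> \<le> (\<Sum>i\<in>v. \<Sum>j\<in>v. of_bool (i = j) * (real k / real N * ?T) + (real k / real N)\<^sup>2 * ?T)"
    proof (intro sum_mono)
      fix i j assume ij: "i \<in> v" "j \<in> v"
      have "(\<Sum>w\<in>A. of_bool (i \<in> w \<and> j \<in> w)) = real (card {w \<in> A. i \<in> w \<and> j \<in> w})"
        using finite_weight_class by (simp add: Int_def)
      also have "\<dots> \<le> of_bool (i = j) * (real k / real N * ?T) + (real k / real N)\<^sup>2 * ?T"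
      proof (cases "i = j")
        case True
        then show ?thesis using one[OF ij(1)] by simp
      next
        case False
        then show ?thesis using two[OF ij] by simp
      qed
      finally show "(\<Sum>w\<in>A. of_bool (i \<in> w \<and> j \<in> w)) \<le> of_bool (i = j) * (real k / real N * ?T) + (real k / real N)\<^sup>2 * ?T" .
    qed
    also have "\<dots> = ?l * (real k / real N * ?T) + ?l * (?l * ((real k / real N)\<^sup>2 * ?T))"
    proof -
      have "(\<Sum>j\<in>v. of_bool (i = j) * c) = c" if "i \<in> v" for i and c :: real
      proof -
        have "(\<Sum>j\<in>v. of_bool (i = j) * c) = (\<Sum>j\<in>v. if i = j then c else 0)"
          by (rule sum.cong) auto
        then show ?thesis using finv that by simp
      qed
      note diag = this
      have "(\<Sum>i\<in>v. \<Sum>j\<in>v. of_bool (i = j) * c + d) = ?l * c + ?l * (?l * d)" for c d :: real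
      proof -
        have "(\<Sum>i\<in>v. \<Sum>j\<in>v. of_bool (i = j) * c + d) = (\<Sum>i\<in>v. c + ?l * d)"
          by (rule sum.cong[OF refl]) (simp only: sum.distrib diag sum_constant)
        then show ?thesis by (simp add: distrib_left)
      qed
      then show ?thesis .
    qed
    also have "\<dots> = \<mu> * ?T + \<mu>\<^sup>2 * ?T" by (simp add: \<mu>_def power2_eq_square mult_ac)
    finally show ?thesis .
  qed
  have "(\<Sum>w\<in>A. (real (card (w \<inter> v)) - \<mu>)\<^sup>2)
     = (\<Sum>w\<in>A. (real (card (w \<inter> v)))\<^sup>2) - 2 * \<mu> * (\<Sum>w\<in>A. real (card (w \<inter> v))) + \<mu>\<^sup>2 * ?T"
    by (simp add: power2_diff sum.distrib sum_subtractf sum_distrib_left mult_ac)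
  also have "\<dots> \<le> \<mu> * ?T + \<mu>\<^sup>2 * ?T - 2 * \<mu> * (\<mu> * ?T) + \<mu>\<^sup>2 * ?T"
    unfolding S1 using S2 by linarith
  also have "\<dots> = \<mu> * ?T" by (simp add: power2_eq_square)
  also have "\<dots> \<le> real N * ?T"
  proof (rule mult_right_mono)
    have "card v \<le> N" using card_mono[OF _ v] by simp
    then have "real k * real (card v) \<le> real N * real N" using k by (intro mult_mono) simp_all
    then show "\<mu> \<le> real N" using N by (simp add: \<mu>_def divide_le_eq)
  qed simp
  finally show ?thesis .
qed

text \<open>Chebyshev's inequality for a fixed \<open>v\<close>. Holding for every \<open>v\<close>,
  it permits an arbitrary set of words for user 2.\<close>

lemma card_atypical_intersection:
  fixes \<eta> :: real
  assumes v: "v \<subseteq> {..<N}" and \<eta>: "\<eta> > 0"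
  defines "\<mu> \<equiv> real k * real (card v) / real N"
  shows "card {w \<in> A. \<bar>real (card (w \<inter> v)) - \<mu>\<bar> \<ge> \<eta> * N} \<le> card A / (\<eta>\<^sup>2 * N)"
proof -
  let ?B = "{w \<in> A. \<bar>real (card (w \<inter> v)) - \<mu>\<bar> \<ge> \<eta> * N}"
  have "real (card ?B) * (\<eta> * N)\<^sup>2 = (\<Sum>w\<in>?B. (\<eta> * N)\<^sup>2)" by simp
  also have "\<dots> \<le> (\<Sum>w\<in>?B. (real (card (w \<inter> v)) - \<mu>)\<^sup>2)"
  proof (rule sum_mono)
    fix w assume "w \<in> ?B"
    then have "\<eta> * N \<le> \<bar>real (card (w \<inter> v)) - \<mu>\<bar>" by simp
    then have "(\<eta> * N)\<^sup>2 \<le> \<bar>real (card (w \<inter> v)) - \<mu>\<bar>\<^sup>2" using \<eta> by (intro power_mono) auto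
    then show "(\<eta> * N)\<^sup>2 \<le> (real (card (w \<inter> v)) - \<mu>)\<^sup>2" by simp
  qed
  also have "\<dots> \<le> (\<Sum>w\<in>A. (real (card (w \<inter> v)) - \<mu>)\<^sup>2)"
    by (rule sum_mono2) (use finite_weight_class in auto)
  also have "\<dots> \<le> real N * card A" unfolding \<mu>_def by (rule intersection_variance[OF v])
  finally have "(real (card ?B) * (\<eta>\<^sup>2 * N)) * N \<le> real (card A) * N"
    by (simp add: power2_eq_square mult_ac)
  then have "real (card ?B) * (\<eta>\<^sup>2 * N) \<le> real (card A)" using N by simp
  then show ?thesis using \<eta> N by (simp add: le_divide_eq)
qed

end

section \<open>Existence of good block codes\<close>

lemma scramble_subset: "\<omega> \<in> scramblers N \<Longrightarrow> w \<subseteq> {..<N} \<Longrightarrow> scramble \<omega> w \<subseteq> {..<N}"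
proof -
  assume \<omega>: "\<omega> \<in> scramblers N" and w: "w \<subseteq> {..<N}"
  have p: "fst \<omega> permutes {..<N}" and t: "snd \<omega> \<subseteq> {..<N}" using \<omega> by (auto simp: scramblers_def)
  have "fst \<omega> ` w \<subseteq> {..<N}" using permutes_image[OF p] w by blast
  then show ?thesis using t unfolding scramble_def by blast
qed

lemma scramble_inject: "\<omega> \<in> scramblers N \<Longrightarrow> scramble \<omega> w = scramble \<omega> w' \<Longrightarrow> w = w'"
proof -
  assume \<omega>: "\<omega> \<in> scramblers N" and eq: "scramble \<omega> w = scramble \<omega> w'"
  have "inj (fst \<omega>)" using \<omega> by (auto simp: scramblers_def permutes_inj)
  moreover have "fst \<omega> ` w = fst \<omega> ` w'" using eq unfolding scramble_def by blast
  ultimately show ?thesis by (simp add: inj_image_eq_iff)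
qed

lemma of_bool_add_eqD:
  "of_bool a + of_bool b = (of_bool c + of_bool d :: nat) \<Longrightarrow> (a \<and> b) = (c \<and> d) \<and> (a \<or> b) = (c \<or> d)"
  by (cases a; cases b; cases c; cases d) simp_all

text \<open>Message pairs are split by whether the intersection of their words is near its mean.
  Atypical pairs give the term \<open>1 / (\<eta>^2 * N)\<close> by Chebyshev's inequality. For
  typical ones a scrambler reaches each output with frequency at most \<open>1 / K\<close>, and
  \<open>greedy_few_collisions\<close> bounds the ambiguous states by a fraction
  \<open>card A1 * card A2 / K\<close>.\<close>

lemma good_block_code:
  fixes N k1 k2 :: nat and A2 :: "nat set set" and \<eta> K :: real
  defines "A1 \<equiv> {w. w \<subseteq> {..<N} \<and> card w = k1}"
  assumes N: "N > 0" and k1: "k1 \<le> N" and \<eta>: "\<eta> > 0" and K: "K > 0"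
    and A2: "A2 \<subseteq> {w. w \<subseteq> {..<N} \<and> card w = k2}" "A2 \<noteq> {}"
    and large: "\<And>e. e \<le> N \<Longrightarrow> \<bar>real e - (real k1 + real k2 - 2 * (real k1 * real k2 / real N))\<bar> \<le> 2 * \<eta> * N
      \<Longrightarrow> K \<le> real ((N choose e) * 2 ^ (N - e))"
  shows "\<exists>x1 x2. block_code A1 A2 N x1 x2 \<and>
    card (block_code.ambiguous A1 A2 N x1 x2)
      \<le> (card A1 * card A2)\<^sup>2 * (1 / (\<eta>\<^sup>2 * N) + card A1 * card A2 / K)"
proof -
  let ?\<mu> = "real k1 * real k2 / real N"
  have finA1: "finite A1" unfolding A1_def by (rule finite_subset[of _ "Pow {..<N}"]) auto
  have finA2: "finite A2" by (rule finite_subset[of _ "Pow {..<N}"]) (use A2 in auto)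
  have cA1: "card A1 = N choose k1" unfolding A1_def using n_subsets[of "{..<N}" k1] by simp
  have neA1: "A1 \<noteq> {}" using cA1 k1 by (metis card.empty binomial_eq_0_iff not_less)
  let ?S = "A1 \<times> A2"
  have finS: "finite ?S" using finA1 finA2 by simp
  define W where "W = {w \<in> ?S. \<bar>real (card (fst w \<inter> snd w)) - ?\<mu>\<bar> < \<eta> * N}"
  have finW: "finite W" unfolding W_def using finS by simp
  have sub: "fst w \<subseteq> {..<N}" "snd w \<subseteq> {..<N}" "card (fst w) = k1" "card (snd w) = k2" if "w \<in> ?S" for w
  proof -
    have "fst w \<in> A1" "snd w \<in> A2" using that by auto
    then show "fst w \<subseteq> {..<N}" "snd w \<subseteq> {..<N}" "card (fst w) = k1" "card (snd w) = k2"
      using A2(1) unfolding A1_def by blast+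
  qed
  have unif: "card {\<omega> \<in> scramblers N. sum_pattern w \<omega> = z} * K \<le> card (scramblers N)" if w: "w \<in> W" for w z
  proof -
    let ?e = "card (sym_diff (fst w) (snd w))"
    have wS: "w \<in> ?S" using w by (simp add: W_def)
    note s = sub[OF wS]
    have fin: "finite (fst w)" "finite (snd w)" using s finite_subset by blast+
    have "?e = card (fst w - snd w) + card (snd w - fst w)"
      by (rule card_Un_disjoint) (use fin in auto)
    moreover have "card (fst w) = card (fst w \<inter> snd w) + card (fst w - snd w)"
      using card_Int_Diff[OF fin(1)] .
    moreover have "card (snd w) = card (fst w \<inter> snd w) + card (snd w - fst w)"
      using card_Int_Diff[OF fin(2), of "fst w"] by (simp add: Int_commute)
    \<comment> \<open>The erasure number depends on the intersection with factor 2, which explains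
      the tolerance \<open>2 * \<eta> * N\<close> in \<open>large\<close>.\<close>
    ultimately have "real ?e = real k1 + real k2 - 2 * real (card (fst w \<inter> snd w))" using s by linarith
    then have "\<bar>real ?e - (real k1 + real k2 - 2 * ?\<mu>)\<bar> \<le> 2 * \<eta> * N"
      using w by (simp add: W_def abs_if split: if_splits)
    moreover have "?e \<le> N" using card_mono[of "{..<N}" "sym_diff (fst w) (snd w)"] s by auto
    ultimately have "K \<le> real ((N choose ?e) * 2 ^ (N - ?e))" by (intro large)
    then have "real (card {\<omega> \<in> scramblers N. sum_pattern w \<omega> = z}) * K
       \<le> real (card {\<omega> \<in> scramblers N. sum_pattern w \<omega> = z}) * real ((N choose ?e) * 2 ^ (N - ?e))"
      by (intro mult_left_mono) simp_all
    also have "\<dots> \<le> real (card (scramblers N))"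
      unfolding of_nat_mult[symmetric] by (rule of_nat_mono) (rule card_sum_pattern[OF s(1,2)])
    finally show ?thesis .
  qed
  from greedy_few_collisions[where y = sum_pattern, OF finite_scramblers scramblers_nonempty finW less_imp_le[OF K] unif finS]
  obtain f where ff: "(\<forall>s\<in>?S. f s \<in> scramblers N) \<and>
      K * (\<Sum>w\<in>W. card {(s, s'). s \<in> ?S \<and> s' \<in> ?S \<and> s \<noteq> s' \<and>
        sum_pattern w (f s) = sum_pattern w (f s')}) \<le> card W * (card ?S)\<^sup>2" ..
  note f0 = conjunct1[OF ff] and coll = conjunct2[OF ff]
  have f: "f s \<in> scramblers N" if "s \<in> ?S" for s using f0 that by (rule bspec)
  define x :: "nat set \<times> nat set \<Rightarrow> nat set \<Rightarrow> nat \<Rightarrow> nat"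
    where "x = (\<lambda>s w j. of_bool (j \<in> scramble (f s) w))"
  have x_inj: "w = w'" if s: "s \<in> ?S" and w: "w \<subseteq> {..<N}" "w' \<subseteq> {..<N}"
    and eq: "\<And>j. j < N \<Longrightarrow> x s w j = x s w' j" for s w w'
  proof (rule scramble_inject[OF f[OF s]])
    have "j \<in> scramble (f s) w \<longleftrightarrow> j \<in> scramble (f s) w'" if "j < N" for j
      using eq[OF that] unfolding x_def by (simp only: of_bool_eq_iff)
    then show "scramble (f s) w = scramble (f s) w'"
      using scramble_subset[OF f[OF s] w(1)] scramble_subset[OF f[OF s] w(2)] by blast
  qed
  have bc: "block_code A1 A2 N x x"
  proof
    show "w = w'" if "s \<in> ?S" "w \<in> A1" "w' \<in> A1" "\<And>j. j < N \<Longrightarrow> x s w j = x s w' j" for s w w'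
      using that by (intro x_inj[of s w w']) (auto simp: A1_def)
    show "w = w'" if "s \<in> ?S" "w \<in> A2" "w' \<in> A2" "\<And>j. j < N \<Longrightarrow> x s w j = x s w' j" for s w w'
      using that A2 by (intro x_inj[of s w w']) auto
  qed (use finA1 finA2 neA1 A2 N in \<open>simp_all add: x_def\<close>)
  interpret block_code A1 A2 N x x by (rule bc)
  let ?C = "\<lambda>w. {(s, s'). s \<in> ?S \<and> s' \<in> ?S \<and> s \<noteq> s' \<and> sum_pattern w (f s) = sum_pattern w (f s')}"
  have finC: "finite (?C w)" for w by (rule finite_subset[of _ "?S \<times> ?S"]) (use finS in auto)
  have pattern: "sum_pattern w (f s) = sum_pattern w (f s')"
    if w: "w \<in> ?S" and s: "s \<in> ?S" "s' \<in> ?S" and eq: "\<forall>j<N. y s w j = y s' w j" for w s s'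
  proof -
    have ss: "scramble (f s) v \<subseteq> {..<N}" "scramble (f s') v \<subseteq> {..<N}" if "v \<subseteq> {..<N}" for v
      using scramble_subset[OF f[OF s(1)] that] scramble_subset[OF f[OF s(2)] that] by blast+
    note ss = ss[OF sub(1)[OF w]] ss[OF sub(2)[OF w]]
    have j: "(j \<in> scramble (f s) (fst w) \<and> j \<in> scramble (f s) (snd w)) =
             (j \<in> scramble (f s') (fst w) \<and> j \<in> scramble (f s') (snd w)) \<and>
             (j \<in> scramble (f s) (fst w) \<or> j \<in> scramble (f s) (snd w)) =
             (j \<in> scramble (f s') (fst w) \<or> j \<in> scramble (f s') (snd w))" if "j < N" for j
      using eq[rule_format, OF that] unfolding y_def unfolding x_def by (rule of_bool_add_eqD)
    have "sym_diff (scramble (f s) (fst w)) (scramble (f s) (snd w))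
        = sym_diff (scramble (f s') (fst w)) (scramble (f s') (snd w))"
      using j ss by blast
    moreover have "scramble (f s) (fst w) \<inter> scramble (f s) (snd w)
        = scramble (f s') (fst w) \<inter> scramble (f s') (snd w)"
      using j ss by blast
    ultimately show ?thesis by (simp add: sum_pattern_def)
  qed
  have "ambiguous \<subseteq> (SIGMA w:W. fst ` ?C w) \<union> (?S - W) \<times> ?S"
  proof
    fix p assume p: "p \<in> ambiguous"
    obtain w s where ws: "p = (w, s)" by (cases p)
    from p obtain s' where w: "w \<in> ?S" and s: "s \<in> ?S" "s' \<in> ?S" "s' \<noteq> s" and eq: "\<forall>j<N. y s w j = y s' w j"
      unfolding ambiguous_def ws by blast
    show "p \<in> (SIGMA w:W. fst ` ?C w) \<union> (?S - W) \<times> ?S"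
    proof (cases "w \<in> W")
      case True
      have "(s, s') \<in> ?C w" using s pattern[OF w s(1,2) eq] by simp
      then have "s \<in> fst ` ?C w" by (rule rev_image_eqI) simp
      then show ?thesis using True by (simp add: ws)
    next
      case False
      then show ?thesis using w s(1) by (simp add: ws)
    qed
  qed
  then have "card ambiguous \<le> card ((SIGMA w:W. fst ` ?C w) \<union> (?S - W) \<times> ?S)"
    by (rule card_mono[rotated])
       (intro finite_UnI finite_SigmaI finite_imageI finite_Diff finW finC finA1 finA2)
  also have "\<dots> \<le> card (SIGMA w:W. fst ` ?C w) + card ((?S - W) \<times> ?S)" by (rule card_Un_le)
  also have "card (SIGMA w:W. fst ` ?C w) = (\<Sum>w\<in>W. card (fst ` ?C w))"
    by (rule card_SigmaI[OF finW]) (use finC in blast)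
  also have "\<dots> \<le> (\<Sum>w\<in>W. card (?C w))"
    by (intro sum_mono card_image_le finC)
  finally have "real (card ambiguous) \<le> real ((\<Sum>w\<in>W. card (?C w)) + card ((?S - W) \<times> ?S))"
    by (intro of_nat_mono) simp
  also have "\<dots> = real (\<Sum>w\<in>W. card (?C w)) + real (card (?S - W)) * real (card ?S)"
    by (simp only: of_nat_add card_cartesian_product of_nat_mult)
  also have "real (\<Sum>w\<in>W. card (?C w)) \<le> real (card ?S) * (real (card ?S))\<^sup>2 / K"
  proof -
    have "real (card W) * (real (card ?S))\<^sup>2 \<le> real (card ?S) * (real (card ?S))\<^sup>2"
      by (intro mult_right_mono of_nat_mono card_mono finS) (auto simp: W_def)
    then show ?thesis using coll K by (simp add: le_divide_eq mult.commute)
  qed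
  also have "real (card (?S - W)) * real (card ?S) \<le> real (card ?S) / (\<eta>\<^sup>2 * N) * real (card ?S)"
  proof (rule mult_right_mono)
    let ?B = "\<lambda>v. {w \<in> A1. \<bar>real (card (w \<inter> v)) - real k1 * real (card v) / real N\<bar> \<ge> \<eta> * N}"
    have "?S - W \<subseteq> prod.swap ` (SIGMA v:A2. ?B v)"
    proof
      fix w assume w: "w \<in> ?S - W"
      then have "fst w \<in> A1" "snd w \<in> A2" "\<not> \<bar>real (card (fst w \<inter> snd w)) - ?\<mu>\<bar> < \<eta> * N"
        unfolding W_def by auto
      then have "prod.swap w \<in> (SIGMA v:A2. ?B v)"
        using sub(4)[of w] w by (simp add: prod.swap_def not_less)
      then have "prod.swap (prod.swap w) \<in> prod.swap ` (SIGMA v:A2. ?B v)" by (rule imageI)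
      then show "w \<in> prod.swap ` (SIGMA v:A2. ?B v)" by simp
    qed
    then have "card (?S - W) \<le> card (SIGMA v:A2. ?B v)"
      using finA1 finA2 by (intro surj_card_le finite_SigmaI) simp_all
    also have "\<dots> = (\<Sum>v\<in>A2. card (?B v))" using finA1 finA2 by (intro card_SigmaI) simp_all
    finally have "real (card (?S - W)) \<le> real (\<Sum>v\<in>A2. card (?B v))" by (rule of_nat_mono)
    also have "\<dots> = (\<Sum>v\<in>A2. real (card (?B v)))" by (rule of_nat_sum)
    also have "\<dots> \<le> (\<Sum>v\<in>A2. card A1 / (\<eta>\<^sup>2 * N))"
    proof (rule sum_mono)
      fix v assume "v \<in> A2"
      then have "v \<subseteq> {..<N}" using A2 by blast
      then show "real (card (?B v)) \<le> card A1 / (\<eta>\<^sup>2 * N)"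
        unfolding A1_def by (rule card_atypical_intersection[OF N k1 _ \<eta>])
    qed
    also have "\<dots> = real (card ?S) / (\<eta>\<^sup>2 * N)" by (simp add: card_cartesian_product)
    finally show "real (card (?S - W)) \<le> real (card ?S) / (\<eta>\<^sup>2 * N)" .
  qed simp
  finally have "card ambiguous \<le> (card A1 * card A2)\<^sup>2 * (1 / (\<eta>\<^sup>2 * N) + card A1 * card A2 / K)"
    by (simp add: card_cartesian_product power2_eq_square algebra_simps)
  then show ?thesis using bc by blast
qed

section \<open>Binomial coefficients and entropy\<close>

text \<open>The terms are unnormalised binomial probabilities for success parameter
  \<open>k / N\<close>. Consecutive terms have ratio \<open>(N - j) * k\<close> to
  \<open>Suc j * (N - k)\<close>, so they grow up to \<open>j = k\<close> and fall
  afterwards.\<close>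

lemma binomial_term_le_mode:
  fixes N k j :: nat
  assumes "k \<le> N" "j \<le> N"
  shows "(N choose j) * (k ^ j * (N - k) ^ (N - j)) \<le> (N choose k) * (k ^ k * (N - k) ^ (N - k))"
proof -
  define t where "t = (\<lambda>j. (N choose j) * (k ^ j * (N - k) ^ (N - j)))"
  have step: "Suc j * (N - k) * t (Suc j) = (N - j) * k * t j" if "j < N" for j
  proof -
    have "Suc j * (N choose Suc j) = (N - j) * (N choose j)"
      by (simp only: binomial_absorb_comp binomial_absorption)
    moreover have "(N - k) * (N - k) ^ (N - Suc j) = (N - k) ^ (N - j)"
      using that by (simp add: Suc_diff_Suc flip: power_Suc)
    ultimately show ?thesis
      unfolding t_def power_Suc by (metis (no_types, lifting) mult.assoc mult.left_commute)
  qed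
  have up: "t j \<le> t (Suc j)" if "Suc j \<le> k" for j
  proof (cases "k = N")
    case True
    then show ?thesis using that by (simp add: t_def power_0_left)
  next
    case False
    then have pos: "0 < Suc j * (N - k)" using assms by simp
    have "Suc j * (N - k) \<le> (N - j) * k"
      using mult_le_mono[OF that diff_le_mono2[of j k N]] that by (simp add: mult.commute)
    then have "Suc j * (N - k) * t j \<le> (N - j) * k * t j" by (rule mult_le_mono1)
    also have "\<dots> = Suc j * (N - k) * t (Suc j)" using step[of j] that assms by simp
    finally show ?thesis using pos by (simp only: mult_le_cancel1)
  qed
  have down: "t (Suc j) \<le> t j" if "k \<le> j" "j < N" for j
  proof -
    have pos: "0 < Suc j * (N - k)" using that by simp
    have "(N - j) * k \<le> Suc j * (N - k)"
      using mult_le_mono[of "N - j" "N - k" k "Suc j"] that by (simp add: mult.commute)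
    then have "(N - j) * k * t j \<le> Suc j * (N - k) * t j" by (rule mult_le_mono1)
    then have "Suc j * (N - k) * t (Suc j) \<le> Suc j * (N - k) * t j" using step[of j] that by simp
    then show ?thesis using pos by (simp only: mult_le_cancel1)
  qed
  have "t j \<le> t k"
  proof (cases "j \<le> k")
    case True
    then show ?thesis
    proof (induction rule: inc_induct)
      case (step n)
      then show ?case using up[of n] by simp
    qed simp
  next
    case False
    then have "k \<le> j" by simp
    then show ?thesis using assms(2)
    proof (induction rule: dec_induct)
      case (step n)
      then show ?case using down[of n] by simp
    qed simp
  qed
  then show ?thesis by (simp only: t_def)
qed

text \<open>The binomial expansion of \<open>(k + (N - k)) ^ N\<close> has \<open>N + 1\<close>
  terms, the largest being \<open>t k\<close>, so \<open>t k\<close> lies between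
  \<open>N ^ N / (N + 1)\<close> and \<open>N ^ N\<close>. Taking logarithms gives both
  bounds.\<close>

lemma binomial_entropy_bounds:
  assumes k: "k \<le> N" and N: "N > 0"
  shows "log 2 (real (N choose k)) \<le> real N * binary_entropy (real k / real N)"
    and "real N * binary_entropy (real k / real N) \<le> log 2 (real (N choose k)) + log 2 (real N + 1)"
proof -
  define t where "t = (\<lambda>j. (N choose j) * (k ^ j * (N - k) ^ (N - j)))"
  have sum: "N ^ N = (\<Sum>j\<le>N. t j)"
    using binomial[of k "N - k" N] k by (simp add: t_def mult.assoc)
  have "t k \<le> N ^ N" unfolding sum by (rule member_le_sum) (use k in simp_all)
  moreover have "N ^ N \<le> (\<Sum>j\<le>N. t k)"
    unfolding sum by (rule sum_mono) (unfold t_def, rule binomial_term_le_mode, use k in simp_all)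
  ultimately have nat: "t k \<le> N ^ N" "N ^ N \<le> (N + 1) * t k" by simp_all
  have tpos: "t k > 0" using k unfolding t_def by (cases "k = 0"; cases "k = N") auto
  have lt: "log 2 (t k) = log 2 (N choose k) + (real k * log 2 (real k) + real (N - k) * log 2 (real (N - k)))"
  proof -
    have p: "log 2 (real (m ^ m)) = real m * log 2 (real m)" for m
      by (cases "m = 0") (simp_all add: log_nat_power)
    have "real (t k) = real (N choose k) * (real (k ^ k) * real ((N - k) ^ (N - k)))" by (simp add: t_def)
    moreover have "real (m ^ m) > 0" for m by (cases "m = 0") simp_all
    moreover have "real (N choose k) > 0" using k by simp
    ultimately show ?thesis by (simp only: log_mult_pos mult_pos_pos p)
  qed
  have lN: "log 2 (N ^ N) = real N * log 2 (real N)" using N by (simp add: log_nat_power)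
  have h: "N * binary_entropy (k / N) = real N * log 2 (real N) - (real k * log 2 (real k) + real (N - k) * log 2 (real (N - k)))"
  proof -
    have "1 - real k / real N = real (N - k) / real N" using k N by (simp add: of_nat_diff field_simps)
    moreover have "real N * (real m / real N * log 2 (real m / real N)) = real m * (log 2 (real m) - log 2 (real N))" for m
      using N by (cases "m = 0") (simp_all add: log_divide_pos)
    moreover have "real N = real k + real (N - k)" using k by simp
    ultimately have "N * binary_entropy (k / N) = - (real k * (log 2 (real k) - log 2 (real N))) - real (N - k) * (log 2 (real (N - k)) - log 2 (real N))"
      unfolding binary_entropy_def by (simp only: right_diff_distrib mult_minus_right mult_minus_left)
    also have "\<dots> = (real k + real (N - k)) * log 2 (real N) - (real k * log 2 (real k) + real (N - k) * log 2 (real (N - k)))"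
      by (simp only: right_diff_distrib distrib_right)
    finally show ?thesis using k by (simp add: of_nat_diff)
  qed
  have "log 2 (t k) \<le> log 2 (N ^ N)" using nat(1) tpos N by (simp del: of_nat_power of_nat_mult)
  then show "log 2 (real (N choose k)) \<le> real N * binary_entropy (real k / real N)" unfolding lt lN h by simp
  have "log 2 (N ^ N) \<le> log 2 (real ((N + 1) * t k))"
    using nat(2) tpos N by (simp del: of_nat_power of_nat_mult)
  also have "\<dots> = log 2 (real (N + 1)) + log 2 (real (t k))"
    unfolding of_nat_mult by (rule log_mult_pos) (use tpos in simp_all)
  finally show "real N * binary_entropy (real k / real N) \<le> log 2 (real (N choose k)) + log 2 (real N + 1)"
    unfolding lt lN h by (simp add: add.commute)
qed

lemma floor_fraction_tendsto:
  assumes "0 \<le> a"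
  shows "(\<lambda>N::nat. real (nat \<lfloor>a * real N\<rfloor>) / real N) \<longlonglongrightarrow> a"
proof (rule tendsto_sandwich[of "\<lambda>N::nat. a - 1 / real N" _ _ "\<lambda>_. a"])
  have "a * real N - 1 \<le> real (nat \<lfloor>a * real N\<rfloor>)" "real (nat \<lfloor>a * real N\<rfloor>) \<le> a * real N" for N :: nat
    using assms by (simp_all add: of_nat_nat)
  note b = this
  show "\<forall>\<^sub>F N in sequentially. a - 1 / real N \<le> real (nat \<lfloor>a * real N\<rfloor>) / real N"
    using eventually_gt_at_top[of 0]
  proof eventually_elim
    case (elim N)
    have "a - 1 / real N = (a * real N - 1) / real N" using elim by (simp add: field_simps)
    also have "\<dots> \<le> real (nat \<lfloor>a * real N\<rfloor>) / real N" by (rule divide_right_mono[OF b(1)]) simp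
    finally show ?case .
  qed
  show "\<forall>\<^sub>F N in sequentially. real (nat \<lfloor>a * real N\<rfloor>) / real N \<le> a"
    using eventually_gt_at_top[of 0]
  proof eventually_elim
    case (elim N)
    then show ?case using b(2)[of N] by (simp add: divide_le_eq)
  qed
  show "(\<lambda>N::nat. a - 1 / real N) \<longlonglongrightarrow> a" by real_asymp
qed simp

lemma binary_entropy_tendsto:
  assumes "(x \<longlonglongrightarrow> a)" "a \<in> {0..1}" "\<And>N. x N \<in> {0..1}"
  shows "(\<lambda>N. binary_entropy (x N)) \<longlonglongrightarrow> binary_entropy a"
  by (rule continuous_on_tendsto_compose[OF continuous_on_binary_entropy assms(1,2)])
     (rule always_eventually, use assms(3) in blast)

text \<open>The alternatives \<open>R2 = 0\<close> and \<open>\<rho> \<le> 0\<close> admit a user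
  whose parameter has zero entropy, where no nonnegative rate is strictly smaller.\<close>

lemma good_block_codes:
  fixes a b R2 \<rho> \<beta> :: real
  assumes a: "a \<in> {0..1/2}" and b: "b \<in> {0..1/2}"
    and R2: "0 \<le> R2" "R2 = 0 \<or> R2 < binary_entropy b"
    and sum: "binary_entropy a + R2 < erasure_entropy (bconv a b)"
    and \<rho>: "\<rho> \<le> 0 \<or> \<rho> < binary_entropy a" and \<beta>: "\<beta> > 0"
  shows "\<forall>\<^sub>F N in sequentially. \<exists>(A1 :: nat set set) (A2 :: nat set set) x1 x2. block_code A1 A2 N x1 x2 \<and>
    N * \<rho> \<le> log 2 (card A1) \<and> N * R2 \<le> log 2 (card A2) \<and>
    card (block_code.ambiguous A1 A2 N x1 x2) \<le> (card A1 * card A2)\<^sup>2 * \<beta>"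
proof -
  let ?s = "bconv a b"
  define k1 where "k1 = (\<lambda>N::nat. nat \<lfloor>a * real N\<rfloor>)"
  define k2 where "k2 = (\<lambda>N::nat. nat \<lfloor>b * real N\<rfloor>)"
  have le: "nat \<lfloor>c * real N\<rfloor> \<le> N" if "c \<in> {0..1/2}" for c N
  proof -
    have "c * real N \<le> 1 * real N" using that by (intro mult_right_mono) auto
    then have "\<lfloor>c * real N\<rfloor> \<le> int N" by linarith
    then show ?thesis by simp
  qed
  have k_le: "k1 N \<le> N" "k2 N \<le> N" for N unfolding k1_def k2_def using le[OF a] le[OF b] by blast+
  have k_01: "real (k1 N) / real N \<in> {0..1}" "real (k2 N) / real N \<in> {0..1}" for N
    using k_le[of N] by (auto simp: divide_le_eq_1)
  have lim1: "(\<lambda>N. real (k1 N) / real N) \<longlonglongrightarrow> a" unfolding k1_def using a by (intro floor_fraction_tendsto) simp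
  have lim2: "(\<lambda>N. real (k2 N) / real N) \<longlonglongrightarrow> b" unfolding k2_def using b by (intro floor_fraction_tendsto) simp
  have limh1: "(\<lambda>N. binary_entropy (real (k1 N) / real N)) \<longlonglongrightarrow> binary_entropy a"
    by (rule binary_entropy_tendsto[OF lim1 _ k_01(1)]) (use a in auto)
  have limh2: "(\<lambda>N. binary_entropy (real (k2 N) / real N)) \<longlonglongrightarrow> binary_entropy b"
    by (rule binary_entropy_tendsto[OF lim2 _ k_01(2)]) (use b in auto)
  have lims: "(\<lambda>N. bconv (real (k1 N) / real N) (real (k2 N) / real N)) \<longlonglongrightarrow> ?s"
    unfolding bconv_def by (intro tendsto_intros lim1 lim2)
  have s01: "?s \<in> {0..1}" using a b bconv_nonneg[of a b] bconv_le_1[of a b] by simp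
  \<comment> \<open>A quarter of the slack in the sum rate: one \<open>\<tau>\<close> pays for the
    size of \<open>A1\<close>, one for \<open>K\<close>, and the remaining two give the decay
    \<open>2 powr (- 2 * \<tau> * N)\<close>.\<close>
  define \<tau> where "\<tau> = (erasure_entropy ?s - binary_entropy a - R2) / 4"
  have \<tau>: "\<tau> > 0" using sum by (simp add: \<tau>_def)
  obtain d where d: "d > 0" "\<And>x. x \<in> {0..1} \<Longrightarrow> dist x ?s < d \<Longrightarrow> dist (erasure_entropy x) (erasure_entropy ?s) < \<tau>"
    using continuous_on_erasure_entropy s01 \<tau> unfolding continuous_on_iff by meson
  \<comment> \<open>The deviation \<open>2 * \<eta>\<close> allowed to the erasure frequency is
    \<open>d / 2\<close>; the other half of \<open>d\<close> covers the rounding of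
    \<open>a * N\<close> and \<open>b * N\<close>.\<close>
  define \<eta> where "\<eta> = d / 4"
  have \<eta>: "\<eta> > 0" using d by (simp add: \<eta>_def)
  define K where "K = (\<lambda>N::nat. 2 powr (real N * (erasure_entropy ?s - \<tau>)) / (real N + 1))"
  define M2 where "M2 = (\<lambda>N::nat. nat \<lceil>2 powr (real N * R2)\<rceil>)"
  have M2: "2 powr (real N * R2) \<le> real (M2 N)" "real (M2 N) \<le> 2 * 2 powr (real N * R2)" for N
  proof -
    have "1 \<le> 2 powr (real N * R2)" using R2 by (simp add: ge_one_powr_ge_zero)
    then show "2 powr (real N * R2) \<le> real (M2 N)" "real (M2 N) \<le> 2 * 2 powr (real N * R2)"
      unfolding M2_def by linarith+
  qed
  have "\<forall>\<^sub>F N in sequentially. M2 N \<le> N choose k2 N"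
  proof (cases "R2 = 0")
    case True
    have "1 \<le> N choose k2 N" for N using k_le(2)[of N] by (simp add: Suc_le_eq)
    then show ?thesis using True by (simp add: M2_def)
  next
    case False
    define \<sigma> where "\<sigma> = (binary_entropy b - R2) / 2"
    have \<sigma>: "\<sigma> > 0" "R2 + \<sigma> < binary_entropy b" using R2 False by (auto simp: \<sigma>_def field_simps)
    \<comment> \<open>The exponential absorbs the factor 2 from rounding up in \<open>M2\<close> and
      the factor \<open>N + 1\<close> from the binomial bound.\<close>
    have "\<forall>\<^sub>F N in sequentially. 2 * (real N + 1) \<le> 2 powr (real N * \<sigma>)"
      using \<sigma>(1) by real_asymp
    moreover have "\<forall>\<^sub>F N in sequentially. R2 + \<sigma> < binary_entropy (real (k2 N) / real N)"
      by (rule order_tendstoD(1)[OF limh2 \<sigma>(2)])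
    ultimately show ?thesis using eventually_gt_at_top[of 0]
    proof eventually_elim
      case (elim N)
      have "real N * (R2 + \<sigma>) \<le> real N * binary_entropy (real (k2 N) / real N)"
        using elim by (intro mult_left_mono) auto
      also have "\<dots> \<le> log 2 (N choose k2 N) + log 2 (real N + 1)"
        by (rule binomial_entropy_bounds(2)[OF k_le(2)]) (use elim in simp)
      finally have "real N * (R2 + \<sigma>) \<le> log 2 (real (N choose k2 N) * (real N + 1))"
        using k_le(2)[of N] by (subst log_mult_pos) (simp_all add: add.commute)
      then have "2 powr (real N * (R2 + \<sigma>)) \<le> real (N choose k2 N) * (real N + 1)"
        using k_le(2)[of N] by (subst (asm) le_log_iff) simp_all
      moreover have "2 powr (real N * (R2 + \<sigma>)) = 2 powr (real N * R2) * 2 powr (real N * \<sigma>)"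
        by (simp add: distrib_left powr_add)
      moreover have "2 powr (real N * R2) * (2 * (real N + 1)) \<le> 2 powr (real N * R2) * 2 powr (real N * \<sigma>)"
        using elim by (intro mult_left_mono) auto
      ultimately have "2 * 2 powr (real N * R2) * (real N + 1) \<le> real (N choose k2 N) * (real N + 1)"
        by (simp only: mult_ac)
      then have "2 * 2 powr (real N * R2) \<le> real (N choose k2 N)"
        by (rule mult_right_le_imp_le) simp
      then have "real (M2 N) \<le> real (N choose k2 N)" using M2(2)[of N] by linarith
      then show ?case by simp
    qed
  qed
  moreover have "\<forall>\<^sub>F N in sequentially. N * \<rho> \<le> log 2 (N choose k1 N)"
  proof (cases "\<rho> \<le> 0")
    case True
    have "N * \<rho> \<le> log 2 (N choose k1 N)" for N :: nat
    proof -
      have "0 < real (N choose k1 N)" using k_le(1)[of N] by simp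
      moreover have "1 \<le> real (N choose k1 N)" using k_le(1)[of N] by (simp add: Suc_le_eq)
      ultimately have "0 \<le> log 2 (real (N choose k1 N))" by (subst zero_le_log_cancel_iff) simp_all
      moreover have "N * \<rho> \<le> 0" using True by (simp add: mult_nonneg_nonpos)
      ultimately show ?thesis by linarith
    qed
    then show ?thesis by simp
  next
    case False
    define \<sigma> where "\<sigma> = (binary_entropy a - \<rho>) / 2"
    have \<sigma>: "\<sigma> > 0" "\<rho> + \<sigma> < binary_entropy a" using \<rho> False by (auto simp: \<sigma>_def field_simps)
    have "\<forall>\<^sub>F N in sequentially. log 2 (real N + 1) \<le> real N * \<sigma>"
      using \<sigma>(1) by real_asymp
    moreover have "\<forall>\<^sub>F N in sequentially. \<rho> + \<sigma> < binary_entropy (real (k1 N) / real N)"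
      by (rule order_tendstoD(1)[OF limh1 \<sigma>(2)])
    ultimately show ?thesis using eventually_gt_at_top[of 0]
    proof eventually_elim
      case (elim N)
      have "real N * (\<rho> + \<sigma>) \<le> real N * binary_entropy (real (k1 N) / real N)"
        using elim by (intro mult_left_mono) auto
      also have "\<dots> \<le> log 2 (N choose k1 N) + log 2 (real N + 1)"
        by (rule binomial_entropy_bounds(2)[OF k_le(1)]) (use elim in simp)
      finally show ?case using elim(1) unfolding distrib_left by linarith
    qed
  qed
  moreover have "\<forall>\<^sub>F N in sequentially. dist (bconv (real (k1 N) / real N) (real (k2 N) / real N)) ?s < d / 2"
    using tendstoD[OF lims, of "d / 2"] d(1) by simp
  moreover have "\<forall>\<^sub>F N in sequentially. binary_entropy (real (k1 N) / real N) < binary_entropy a + \<tau>"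
    by (rule order_tendstoD(2)[OF limh1]) (use \<tau> in simp)
  moreover have "\<forall>\<^sub>F N in sequentially. 1 / (\<eta>\<^sup>2 * real N) + 2 * (real N + 1) * 2 powr (- 2 * \<tau> * real N) < \<beta>"
  proof (rule order_tendstoD(2)[OF _ \<beta>])
    show "(\<lambda>N::nat. 1 / (\<eta>\<^sup>2 * real N) + 2 * (real N + 1) * 2 powr (- 2 * \<tau> * real N)) \<longlonglongrightarrow> 0"
      using \<eta> \<tau> by real_asymp
  qed
  ultimately show ?thesis using eventually_gt_at_top[of 0]
  proof eventually_elim
    case (elim N)
    note N = elim(6)
    let ?A1 = "{w. w \<subseteq> {..<N} \<and> card w = k1 N}"
    have c1: "card ?A1 = N choose k1 N" using n_subsets[of "{..<N}" "k1 N"] by simp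
    have "card {w. w \<subseteq> {..<N} \<and> card w = k2 N} = N choose k2 N" using n_subsets[of "{..<N}" "k2 N"] by simp
    then have "M2 N \<le> card {w. w \<subseteq> {..<N} \<and> card w = k2 N}" using elim(1) by (simp only:)
    then obtain A2 where A2: "A2 \<subseteq> {w. w \<subseteq> {..<N} \<and> card w = k2 N}" "card A2 = M2 N"
      by (rule obtain_subset_with_card_n)
    have "0 < real (M2 N)" using M2(1)[of N] by (rule less_le_trans[rotated]) simp
    then have neA2: "A2 \<noteq> {}" unfolding A2(2)[symmetric] by (metis card.empty less_irrefl of_nat_0)
    have K: "K N > 0" by (simp add: K_def add_nonneg_pos)
    have large: "K N \<le> real ((N choose e) * 2 ^ (N - e))"
      if e: "e \<le> N" "\<bar>real e - (real (k1 N) + real (k2 N) - 2 * (real (k1 N) * real (k2 N) / real N))\<bar> \<le> 2 * \<eta> * N" for e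
    proof -
      let ?c = "bconv (real (k1 N) / real N) (real (k2 N) / real N)"
      have "real e / real N - ?c = (real e - (real (k1 N) + real (k2 N) - 2 * (real (k1 N) * real (k2 N) / real N))) / real N"
        using N by (simp add: bconv_def diff_divide_distrib add_divide_distrib)
      then have "\<bar>real e / real N - ?c\<bar> \<le> 2 * \<eta>"
        using e(2) N by (simp add: divide_le_eq)
      then have "dist (real e / real N) ?s < d"
        using elim(3) d(1) unfolding \<eta>_def dist_real_def by linarith
      moreover have "real e / real N \<in> {0..1}" using e(1) N by simp
      ultimately have "\<bar>erasure_entropy (real e / real N) - erasure_entropy ?s\<bar> < \<tau>"
        using d(2) by (simp add: dist_real_def)
      then have "real N * (erasure_entropy ?s - \<tau>) \<le> real N * erasure_entropy (real e / real N)"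
        by (intro mult_left_mono) auto
      also have "\<dots> = real N * binary_entropy (real e / real N) + (real N - real e)"
        using N by (simp add: erasure_entropy_def distrib_left right_diff_distrib)
      also have "\<dots> \<le> log 2 (N choose e) + log 2 (real N + 1) + real (N - e)"
        using binomial_entropy_bounds(2)[OF e(1) N] e(1) by (simp only: of_nat_diff add_le_cancel_right)
      also have "\<dots> = log 2 (real (N choose e) * 2 ^ (N - e) * (real N + 1))"
      proof -
        have pos: "0 < real (N choose e)" "0 < (2::real) ^ (N - e)" "0 < real N + 1" using e(1) by simp_all
        have "log 2 ((2::real) ^ (N - e)) = real (N - e)" by (simp add: log_nat_power)
        then show ?thesis using pos by (simp only: log_mult_pos mult_pos_pos)
      qed
      finally have "2 powr (real N * (erasure_entropy ?s - \<tau>)) \<le> real (N choose e) * 2 ^ (N - e) * (real N + 1)"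
        using e(1) by (subst (asm) le_log_iff) simp_all
      then show ?thesis by (simp add: K_def divide_le_eq)
    qed
    from good_block_code[OF N k_le(1) \<eta> K A2(1) neA2 large]
    obtain x1 x2 where bc: "block_code ?A1 A2 N x1 x2" and
      amb: "card (block_code.ambiguous ?A1 A2 N x1 x2)
        \<le> (card ?A1 * card A2)\<^sup>2 * (1 / (\<eta>\<^sup>2 * N) + card ?A1 * card A2 / K N)"
      by blast
    have "log 2 (N choose k1 N) \<le> real N * (binary_entropy a + \<tau>)"
      using binomial_entropy_bounds(1)[OF k_le(1) N] mult_left_mono[OF less_imp_le[OF elim(4)], of "real N"] by simp
    then have "real (N choose k1 N) \<le> 2 powr (real N * (binary_entropy a + \<tau>))"
      using k_le(1)[of N] by (subst (asm) log_le_iff) simp_all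
    then have "real (card ?A1) * real (card A2) \<le> 2 powr (real N * (binary_entropy a + \<tau>)) * (2 * 2 powr (real N * R2))"
      unfolding c1 A2(2) by (intro mult_mono M2(2)) simp_all
    then have "real (card ?A1) * real (card A2) / K N \<le> 2 powr (real N * (binary_entropy a + \<tau>)) * (2 * 2 powr (real N * R2)) / K N"
      using K by (intro divide_right_mono) simp_all
    also have "\<dots> = 2 * (real N + 1) * (2 powr (real N * (binary_entropy a + \<tau>)) * 2 powr (real N * R2) / 2 powr (real N * (erasure_entropy ?s - \<tau>)))"
      by (simp add: K_def)
    also have "2 powr (real N * (binary_entropy a + \<tau>)) * 2 powr (real N * R2) / 2 powr (real N * (erasure_entropy ?s - \<tau>))
        = 2 powr (- 2 * \<tau> * real N)"
    proof -
      have "erasure_entropy ?s = binary_entropy a + R2 + 4 * \<tau>" by (simp add: \<tau>_def field_simps)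
      then have "real N * (binary_entropy a + \<tau>) + real N * R2 - real N * (erasure_entropy ?s - \<tau>) = - 2 * \<tau> * real N"
        by (simp add: algebra_simps)
      then show ?thesis by (simp only: powr_add[symmetric] powr_diff[symmetric])
    qed
    finally have "1 / (\<eta>\<^sup>2 * N) + card ?A1 * card A2 / K N \<le> \<beta>" using elim(5) by simp
    then have "(real (card ?A1 * card A2))\<^sup>2 * (1 / (\<eta>\<^sup>2 * N) + card ?A1 * card A2 / K N) \<le> (real (card ?A1 * card A2))\<^sup>2 * \<beta>"
      by (rule mult_left_mono) simp
    then have amb': "card (block_code.ambiguous ?A1 A2 N x1 x2) \<le> (card ?A1 * card A2)\<^sup>2 * \<beta>"
      using amb by simp
    have "log 2 (2 powr (real N * R2)) \<le> log 2 (real (M2 N))"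
      using M2(1)[of N] \<open>0 < real (M2 N)\<close> by (subst log_le_cancel_iff) simp_all
    then have "N * R2 \<le> log 2 (card A2)" by (simp add: A2(2))
    moreover have "N * \<rho> \<le> log 2 (card ?A1)" using elim(2) unfolding c1 .
    ultimately show ?case using bc amb' by blast
  qed
qed

section \<open>Achievability\<close>

text \<open>With block length \<open>n div Suc B\<close> at most \<open>B\<close> channel uses are
  left over, a loss that the strict inequality absorbs for large \<open>n\<close>.\<close>

lemma block_count_eventually:
  fixes c r :: real
  assumes r: "0 \<le> r" and c: "c = 0 \<or> c * (real B + 1) < B * r"
  shows "\<forall>\<^sub>F n in sequentially. c * real n \<le> B * (real (n div Suc B) * r)"
proof (cases "c = 0")
  case True
  then show ?thesis using r by simp
next
  case False
  then have d: "0 < B * r - c * (real B + 1)" using c by simp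
  have "\<forall>\<^sub>F n in sequentially. B * (B * r) \<le> real n * (B * r - c * (real B + 1))"
    using d by real_asymp
  then show ?thesis
  proof eventually_elim
    case (elim n)
    have "n = n div Suc B * Suc B + n mod Suc B" by (rule div_mult_mod_eq[symmetric])
    moreover have "n mod Suc B \<le> B" using mod_less_divisor[of "Suc B" n] by simp
    ultimately have "n \<le> n div Suc B * Suc B + B" by linarith
    then have "real n \<le> real (n div Suc B * Suc B + B)" by (rule of_nat_mono)
    then have "real n - B \<le> real (n div Suc B) * (real B + 1)" by (simp add: algebra_simps)
    then have "(real n - B) * (B * r) \<le> real (n div Suc B) * (real B + 1) * (B * r)"
      using r by (intro mult_right_mono) simp_all
    moreover have "c * real n * (real B + 1) \<le> (real n - B) * (B * r)"
      using elim by (simp add: algebra_simps)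
    ultimately have "c * real n * (real B + 1) \<le> B * (real (n div Suc B) * r) * (real B + 1)"
      by (simp only: mult_ac)
    then show ?case by (rule mult_right_le_imp_le) simp
  qed
qed

text \<open>Only \<open>B\<close> of the \<open>B + 1\<close> blocks carry messages; this loss
  disappears for large \<open>B\<close>.\<close>

lemma ex_block_number:
  fixes c r :: real
  assumes "c < r"
  shows "\<forall>\<^sub>F B in sequentially. c * (real B + 1) < B * r"
  using assms by real_asymp

text \<open>The number \<open>B\<close> of blocks is fixed before \<open>n\<close>, so the union
  bound over the blocks costs a constant: an ambiguity fraction \<open>\<epsilon> / B\<close>
  suffices, and it is reached because the block length grows with \<open>n\<close>.\<close>

lemma achievable_inside:
  fixes a b R2 \<rho>1 \<rho>2 :: real
  assumes a: "a \<in> {0..1/2}" and b: "b \<in> {0..1/2}"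
    and R2: "0 \<le> R2" "R2 = 0 \<or> R2 < binary_entropy b"
    and sum: "binary_entropy a + R2 < erasure_entropy (bconv a b)"
    and \<rho>1: "0 \<le> \<rho>1" "\<rho>1 = 0 \<or> \<rho>1 < binary_entropy a"
    and \<rho>2: "0 \<le> \<rho>2" "\<rho>2 = 0 \<or> \<rho>2 < R2"
  shows "binary_erasure.achievable \<rho>1 \<rho>2"
proof -
  have ha: "0 \<le> binary_entropy a" using a by (intro binary_entropy_nonneg) auto
  \<comment> \<open>An intermediate rate: the gap below \<open>binary_entropy a\<close> pays for the
    binomial bound, the gap above \<open>\<rho>1\<close> for the extra block and the left-over
    symbols.\<close>
  define R1 where "R1 = (if \<rho>1 = 0 then 0 else (\<rho>1 + binary_entropy a) / 2)"
  have R1: "0 \<le> R1" "R1 \<le> 0 \<or> R1 < binary_entropy a" "\<rho>1 = 0 \<or> \<rho>1 < R1"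
    using \<rho>1 ha unfolding R1_def by (cases "\<rho>1 = 0"; simp)+
  have "\<forall>\<^sub>F B in sequentially. \<rho>1 = 0 \<or> \<rho>1 * (real B + 1) < B * R1"
    using ex_block_number[of \<rho>1 R1] R1(3) by (auto elim: eventually_mono)
  moreover have "\<forall>\<^sub>F B in sequentially. \<rho>2 = 0 \<or> \<rho>2 * (real B + 1) < B * R2"
    using ex_block_number[of \<rho>2 R2] \<rho>2(2) by (auto elim: eventually_mono)
  ultimately have "\<forall>\<^sub>F B in sequentially. (\<rho>1 = 0 \<or> \<rho>1 * (real B + 1) < B * R1) \<and>
      (\<rho>2 = 0 \<or> \<rho>2 * (real B + 1) < B * R2) \<and> B \<ge> 1"
    using eventually_ge_at_top[of 1] by eventually_elim (intro conjI)
  from eventually_happens'[OF sequentially_bot this] obtain B :: nat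
    where BB: "(\<rho>1 = 0 \<or> \<rho>1 * (real B + 1) < B * R1) \<and> (\<rho>2 = 0 \<or> \<rho>2 * (real B + 1) < B * R2) \<and> B \<ge> 1" ..
  note B = conjunct1[OF BB] conjunct1[OF conjunct2[OF BB]] conjunct2[OF conjunct2[OF BB]]
  have lim: "filterlim (\<lambda>n. n div Suc B) sequentially sequentially"
    unfolding filterlim_at_top
  proof
    fix Z
    show "\<forall>\<^sub>F n in sequentially. Z \<le> n div Suc B"
      using eventually_ge_at_top[of "Z * Suc B"]
      by eventually_elim (rule less_eq_div_iff_mult_less_eq[THEN iffD2], simp_all)
  qed
  have "\<forall>\<^sub>F n in sequentially. \<exists>M1 M2 e1 e2 g. binary_erasure.is_code n M1 M2 e1 e2 g \<and>
      \<rho>1 \<le> log 2 (real M1) / real n \<and> \<rho>2 \<le> log 2 (real M2) / real n \<and>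
      binary_erasure.error_prob n M1 M2 e1 e2 g \<le> \<epsilon>" if \<epsilon>: "\<epsilon> > 0" for \<epsilon>
  proof -
    have "\<epsilon> / B > 0" using \<epsilon> B(3) by simp
    from eventually_compose_filterlim[OF good_block_codes[OF a b R2 sum R1(2) this] lim]
    have codes: "\<forall>\<^sub>F n in sequentially. \<exists>(A1 :: nat set set) (A2 :: nat set set) x1 x2.
      block_code A1 A2 (n div Suc B) x1 x2 \<and>
      real (n div Suc B) * R1 \<le> log 2 (card A1) \<and> real (n div Suc B) * R2 \<le> log 2 (card A2) \<and>
      card (block_code.ambiguous A1 A2 (n div Suc B) x1 x2) \<le> (card A1 * card A2)\<^sup>2 * (\<epsilon> / B)" .
    have "\<forall>\<^sub>F n in sequentially. \<rho>1 * real n \<le> B * (real (n div Suc B) * R1)"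
      "\<forall>\<^sub>F n in sequentially. \<rho>2 * real n \<le> B * (real (n div Suc B) * R2)"
      by (rule block_count_eventually; use B R1 R2 in blast)+
    with codes show ?thesis using eventually_gt_at_top[of 0]
    proof eventually_elim
      case (elim n)
      let ?N = "n div Suc B"
      from elim(1) obtain A1 A2 :: "nat set set" and x1 x2 where bc: "block_code A1 A2 ?N x1 x2"
        and r1: "real ?N * R1 \<le> log 2 (card A1)" and r2: "real ?N * R2 \<le> log 2 (card A2)"
        and amb: "card (block_code.ambiguous A1 A2 ?N x1 x2) \<le> (card A1 * card A2)\<^sup>2 * (\<epsilon> / B)"
        by (elim exE conjE) (rule that)
      interpret block_code A1 A2 ?N x1 x2 by (rule bc)
      have cA: "0 < real (card A1 * card A2)" using fin ne by (simp add: card_gt_0_iff)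
      have "n \<ge> Suc B * ?N" using div_times_less_eq_dividend[of n "Suc B"] by (simp only: mult.commute)
      from multi_block_code[OF B(3) this] obtain e1 e2 g
        where code: "binary_erasure.is_code n (card A1 ^ B) (card A2 ^ B) e1 e2 g"
          and err: "binary_erasure.error_prob n (card A1 ^ B) (card A2 ^ B) e1 e2 g
            \<le> B * (card ambiguous / (card A1 * card A2)\<^sup>2)"
        by (elim exE conjE) (rule that)
      have "card ambiguous / (card A1 * card A2)\<^sup>2 \<le> \<epsilon> / B"
      proof -
        have "0 < real ((card A1 * card A2)\<^sup>2)" using cA by (simp only: of_nat_power zero_less_power)
        then show ?thesis using amb by (simp only: pos_divide_le_eq mult.commute)
      qed
      then have "B * (card ambiguous / (card A1 * card A2)\<^sup>2) \<le> B * (\<epsilon> / B)"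
        by (rule mult_left_mono) simp
      also have "\<dots> = \<epsilon>" using B(3) by simp
      finally have err: "binary_erasure.error_prob n (card A1 ^ B) (card A2 ^ B) e1 e2 g \<le> \<epsilon>"
        using err by (rule order_trans[rotated])
      have rate: "\<rho> \<le> log 2 (real (m ^ B)) / real n"
        if "\<rho> * real n \<le> B * (real ?N * R)" "real ?N * R \<le> log 2 (real m)" "m > 0" for \<rho> R and m :: nat
      proof -
        have "B * (real ?N * R) \<le> B * log 2 (real m)" using that(2) by (rule mult_left_mono) simp
        also have "\<dots> = log 2 (real (m ^ B))" using that(3) by (simp add: log_nat_power)
        finally show ?thesis using that(1) elim(4) by (simp only: pos_le_divide_eq of_nat_0_less_iff)
      qed
      have "card A1 > 0" "card A2 > 0" using fin ne by (simp_all add: card_gt_0_iff)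
      from rate[OF elim(2) r1 this(1)] rate[OF elim(3) r2 this(2)] code err
      show ?case by (intro exI conjI)
    qed
  qed
  then show ?thesis
    unfolding binary_erasure.achievable_def using \<rho>1(1) \<rho>2(1) by blast
qed

lemma rate_region_subset: "rate_region \<subseteq> binary_erasure.capacity_region"
proof
  fix R assume "R \<in> rate_region"
  then obtain a b where a: "a \<in> {0..1/2}" and b: "b \<in> {0..1/2}" and "R \<in> pentagon a b"
    unfolding rate_region_def by blast
  moreover obtain R1 R2 where R: "R = (R1, R2)" by (cases R)
  ultimately have nn: "0 \<le> R1" "0 \<le> R2" and h: "R1 \<le> binary_entropy a" "R2 \<le> binary_entropy b"
    and s: "R1 + R2 \<le> erasure_entropy (bconv a b)"
    by (simp_all add: pentagon_def)
  let ?C = "{(R1, R2). binary_erasure.achievable R1 R2}"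
  have ach: "(t * R1, t * R2) \<in> ?C" if t: "t \<in> {0<..<1}" for t
  proof -
    \<comment> \<open>Two successive contractions: scaling by \<open>\<mu>\<close> makes the sum
      constraint strict and fixes the exchanged parameter by
      \<open>binary_entropy a' = \<mu> * R1\<close>; scaling further down to \<open>t\<close> leaves
      a gap below the rates of the block code.\<close>
    define \<mu> where "\<mu> = (1 + t) / 2"
    have \<mu>: "t < \<mu>" "0 < \<mu>" "\<mu> < 1" using t by (auto simp: \<mu>_def)
    have shrink: "\<mu> * r \<le> r" "r = 0 \<or> \<mu> * r < r" "t * r = 0 \<or> t * r < \<mu> * r" "0 \<le> t * r" "0 \<le> \<mu> * r"
      if "0 \<le> r" for r
    proof -
      have "r = 0 \<or> 0 < r" using that by linarith
      then show "\<mu> * r \<le> r" "r = 0 \<or> \<mu> * r < r" "t * r = 0 \<or> t * r < \<mu> * r" "0 \<le> t * r" "0 \<le> \<mu> * r"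
        using \<mu> t by (elim disjE; simp)+
    qed
    have "\<mu> * R1 \<le> binary_entropy a" using shrink(1)[OF nn(1)] h(1) by linarith
    from exchange_parameters[OF a b shrink(5)[OF nn(1)] this]
    obtain a' b' where ab': "a' \<in> {0..1/2}" "b' \<in> {b..1/2}" and ha: "binary_entropy a' = \<mu> * R1"
      and eq: "bconv a' b' = bconv a b"
      by blast
    have b': "b' \<in> {0..1/2}" using ab'(2) b by simp
    have hb: "binary_entropy b \<le> binary_entropy b'" using ab'(2) b by (intro binary_entropy_mono) auto
    have "binary_erasure.achievable (t * R1) (t * R2)"
    proof (rule achievable_inside[OF ab'(1) b' shrink(5)[OF nn(2)]])
      show "\<mu> * R2 = 0 \<or> \<mu> * R2 < binary_entropy b'"
        using shrink(2)[OF nn(2)] h(2) hb by auto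
      \<comment> \<open>Scaling gives no strict inequality for the pair of zero rates; there the
        positive sum bound does.\<close>
      have G: "1 \<le> erasure_entropy (bconv a b)"
        using a b by (intro erasure_entropy_ge_1 bconv_nonneg bconv_le_half) auto
      have "R1 + R2 = 0 \<or> \<mu> * (R1 + R2) < R1 + R2" using shrink(2)[of "R1 + R2"] nn by simp
      then have "\<mu> * (R1 + R2) < erasure_entropy (bconv a b)"
      proof
        assume "R1 + R2 = 0"
        then show ?thesis using G by simp
      qed (use s in linarith)
      then show "binary_entropy a' + \<mu> * R2 < erasure_entropy (bconv a' b')"
        unfolding eq ha by (simp only: distrib_left)
      show "0 \<le> t * R1" "t * R1 = 0 \<or> t * R1 < binary_entropy a'"
        unfolding ha by (rule shrink[OF nn(1)])+
      show "0 \<le> t * R2" "t * R2 = 0 \<or> t * R2 < \<mu> * R2" by (rule shrink[OF nn(2)])+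
    qed
    then show ?thesis by simp
  qed
  have "\<forall>\<^sub>F t in at_left 1. (t * R1, t * R2) \<in> closure ?C"
    by (rule eventually_at_leftI[of 0]) (use ach closure_subset[of ?C] in blast, simp)
  moreover have "((\<lambda>t. (t * R1, t * R2)) \<longlongrightarrow> (1 * R1, 1 * R2)) (at_left 1)"
    by (intro tendsto_intros)
  ultimately have "(1 * R1, 1 * R2) \<in> closure ?C"
    by (intro Lim_in_closed_set[OF closed_closure]) auto
  then show "R \<in> binary_erasure.capacity_region"
    unfolding binary_erasure.capacity_region_def R by (simp only: mult_1)
qed

section \<open>The uniform auxiliary variable\<close>

abbreviation cube :: "(nat \<times> nat \<times> nat) set" where
  "cube \<equiv> {0, 1} \<times> {0, 1} \<times> {0, 1}"

lemma measure_pmf_cube: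
  assumes "set_pmf P \<subseteq> cube"
  shows "measure (measure_pmf P) A = (\<Sum>t\<in>{0, 1}. \<Sum>x\<in>{0, 1}. \<Sum>y\<in>{0, 1}. pmf P (t, x, y) * of_bool ((t, x, y) \<in> A))"
proof -
  have "measure (measure_pmf P) A = measure (measure_pmf P) (A \<inter> cube)"
  proof -
    have "A \<inter> set_pmf P = (A \<inter> cube) \<inter> set_pmf P" using assms by blast
    then show ?thesis by (metis measure_Int_set_pmf)
  qed
  also have "\<dots> = (\<Sum>z\<in>A \<inter> cube. pmf P z)" by (rule measure_measure_pmf_finite) simp
  also have "\<dots> = (\<Sum>z\<in>cube. pmf P z * of_bool (z \<in> A))"
  proof (rule sum.mono_neutral_cong_left)
    show "finite cube" by (intro finite_cartesian_product) simp_all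
    show "A \<inter> cube \<subseteq> cube" by (rule Int_lower2)
    show "\<forall>z\<in>cube - A \<inter> cube. pmf P z * of_bool (z \<in> A) = 0"
      by (intro ballI) (elim DiffE, simp only: Int_iff simp_thms of_bool_eq mult_zero_right)
    show "pmf P z = pmf P z * of_bool (z \<in> A)" if "z \<in> A \<inter> cube" for z
      using that by (simp only: Int_iff simp_thms of_bool_eq mult_1_right)
  qed
  also have "\<dots> = (\<Sum>t\<in>{0, 1}. \<Sum>x\<in>{0, 1}. \<Sum>y\<in>{0, 1}. pmf P (t, x, y) * of_bool ((t, x, y) \<in> A))"
    by (simp only: sum.cartesian_product case_prod_unfold prod.collapse)
  finally show ?thesis .
qed

text \<open>The requirements for \<open>T = 0\<close> and for \<open>T = 1\<close> both say that
  \<open>X1\<close> equals \<open>T\<close> with probability \<open>a1\<close>, and likewise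
  \<open>X2\<close> with \<open>a2\<close>.\<close>

definition aux_weight :: "real \<Rightarrow> real \<Rightarrow> nat \<times> nat \<times> nat \<Rightarrow> real" where
  "aux_weight a1 a2 = (\<lambda>(t, x, y). (if x = t then a1 else 1 - a1) * (if y = t then a2 else 1 - a2) / 2)"

text \<open>The masses \<open>p\<close>, \<open>q\<close>, \<open>r\<close>, \<open>s\<close> of the bit pairs 00, 01, 10, 11 add up to \<open>1/2\<close>.\<close>
definition independent_bits :: "real \<Rightarrow> real \<Rightarrow> real \<Rightarrow> real \<Rightarrow> real \<Rightarrow> real \<Rightarrow> bool" where
  "independent_bits p q r s \<alpha> \<beta> \<longleftrightarrow> (let D = p + q + (r + s) in D = 1/2 \<and>
     p / D = (p + q) * (p + r) / (D * D) \<and> q / D = (p + q) * (q + s) / (D * D) \<and>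
     r / D = (r + s) * (p + r) / (D * D) \<and> s / D = (r + s) * (q + s) / (D * D) \<and>
     (p + q) / D = \<alpha> \<and> (p + r) / D = \<beta>)"

lemma independent_bits_iff:
  "independent_bits p q r s \<alpha> \<beta> \<longleftrightarrow>
     p = \<alpha> * \<beta> / 2 \<and> q = \<alpha> * (1 - \<beta>) / 2 \<and> r = (1 - \<alpha>) * \<beta> / 2 \<and> s = (1 - \<alpha>) * (1 - \<beta>) / 2"
proof
  assume I: "independent_bits p q r s \<alpha> \<beta>"
  then have D: "p + q + (r + s) = 1/2" by (simp only: independent_bits_def Let_def)
  have I': "p / (1/2) = (p + q) * (p + r) / (1/2 * (1/2)) \<and> q / (1/2) = (p + q) * (q + s) / (1/2 * (1/2)) \<and>
     r / (1/2) = (r + s) * (p + r) / (1/2 * (1/2)) \<and> s / (1/2) = (r + s) * (q + s) / (1/2 * (1/2)) \<and>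
     (p + q) / (1/2) = \<alpha> \<and> (p + r) / (1/2) = \<beta>"
    using I unfolding independent_bits_def Let_def D by (rule conjunct2)
  have *: "p = 2 * ((p + q) * (p + r))" "q = 2 * ((p + q) * (q + s))" "r = 2 * ((r + s) * (p + r))"
    "s = 2 * ((r + s) * (q + s))" "p + q = \<alpha> / 2" "p + r = \<beta> / 2"
  proof -
    have h: "x / (1/2) = y / (1/2 * (1/2)) \<Longrightarrow> x = 2 * y" "x / (1/2) = y \<Longrightarrow> x = y / 2" for x y :: real
      by simp_all
    show "p = 2 * ((p + q) * (p + r))" using I' by (intro h(1)) (elim conjE)
    show "q = 2 * ((p + q) * (q + s))" using I' by (intro h(1)) (elim conjE)
    show "r = 2 * ((r + s) * (p + r))" using I' by (intro h(1)) (elim conjE)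
    show "s = 2 * ((r + s) * (q + s))" using I' by (intro h(1)) (elim conjE)
    show "p + q = \<alpha> / 2" using I' by (intro h(2)) (elim conjE)
    show "p + r = \<beta> / 2" using I' by (intro h(2)) (elim conjE)
  qed
  have **: "r + s = (1 - \<alpha>) / 2" "q + s = (1 - \<beta>) / 2" using D *(5,6) by (simp_all add: field_simps)
  show "p = \<alpha> * \<beta> / 2 \<and> q = \<alpha> * (1 - \<beta>) / 2 \<and> r = (1 - \<alpha>) * \<beta> / 2 \<and> s = (1 - \<alpha>) * (1 - \<beta>) / 2"
    using *(1-4) unfolding *(5,6) ** by simp
next
  assume *: "p = \<alpha> * \<beta> / 2 \<and> q = \<alpha> * (1 - \<beta>) / 2 \<and> r = (1 - \<alpha>) * \<beta> / 2 \<and> s = (1 - \<alpha>) * (1 - \<beta>) / 2"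
  then have 1: "p + q = \<alpha> / 2" "r + s = (1 - \<alpha>) / 2" "p + r = \<beta> / 2" "q + s = (1 - \<beta>) / 2"
    by (simp_all add: field_simps)
  have D: "p + q + (r + s) = 1/2" unfolding 1 by (simp add: field_simps)
  show "independent_bits p q r s \<alpha> \<beta>"
    unfolding independent_bits_def Let_def D unfolding 1 using * by simp
qed

text \<open>The requirements determine the joint law completely. Given \<open>T = 1\<close> the
  probabilities of a zero bit are \<open>1 - a1\<close> and \<open>1 - a2\<close>, hence the
  complemented parameters in the second use of \<open>independent_bits\<close>.\<close>

lemma uniform_aux_law_iff:
  assumes P: "set_pmf P \<subseteq> cube"
  shows "uniform_aux_law a1 a2 P \<longleftrightarrow> (\<forall>z\<in>cube. pmf P z = aux_weight a1 a2 z)"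
proof -
  note M = measure_pmf_cube[OF P]
  define m where "m = (\<lambda>t x y. pmf P (t, x, y))"
  have fst: "map_pmf fst P = pmf_of_set {0, 1} \<longleftrightarrow>
      m 0 0 0 + m 0 0 1 + (m 0 1 0 + m 0 1 1) = 1/2 \<and> m 1 0 0 + m 1 0 1 + (m 1 1 0 + m 1 1 1) = 1/2"
    (is "?L \<longleftrightarrow> ?A = _ \<and> ?B = _")
  proof -
    have p: "pmf (map_pmf fst P) t = (if t = 0 then ?A else if t = 1 then ?B else 0)" for t
      unfolding pmf_map M by (simp add: m_def)
    have q: "pmf (pmf_of_set {0, 1}) t = (if t = 0 then 1/2 else if t = 1 then 1/2 else 0)" for t :: nat
      by (subst pmf_of_set) (auto simp: indicator_def)
    have "?L \<longleftrightarrow> (\<forall>t. (if t = 0 then ?A else if t = 1 then ?B else 0) = (if t = 0 then 1/2 else if t = (1 :: nat) then 1/2 else 0))"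
      unfolding pmf_eq_iff p q ..
    also have "\<dots> \<longleftrightarrow> ?A = 1/2 \<and> ?B = 1/2"
      by (rule iffI, rule conjI, drule spec[of _ 0], simp, drule spec[of _ 1], simp, simp)
    finally show ?thesis .
  qed
  have "uniform_aux_law a1 a2 P \<longleftrightarrow>
      independent_bits (m 0 0 0) (m 0 0 1) (m 0 1 0) (m 0 1 1) a1 a2 \<and>
      independent_bits (m 1 0 0) (m 1 0 1) (m 1 1 0) (m 1 1 1) (1 - a1) (1 - a2)"
    using P unfolding uniform_aux_law_def fst cond_prob_def M independent_bits_def Let_def
    by (simp add: m_def) (rule iffI; elim conjE; intro conjI; linarith)
  also have "\<dots> \<longleftrightarrow> (\<forall>z\<in>cube. pmf P z = aux_weight a1 a2 z)"
    unfolding independent_bits_iff by (simp add: m_def aux_weight_def conj_ac)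
  finally show ?thesis .
qed

text \<open>Existence matters: over an empty set of laws the inner union in the second description
  would be empty.\<close>

lemma ex_uniform_aux_law:
  assumes "a1 \<in> {0..1}" "a2 \<in> {0..1}"
  shows "\<exists>P. uniform_aux_law a1 a2 P"
proof -
  define f where "f = (\<lambda>z. if z \<in> cube then aux_weight a1 a2 z else 0)"
  have nn: "0 \<le> f z" for z
    using assms unfolding f_def aux_weight_def by (simp add: case_prod_unfold)
  have "(\<integral>\<^sup>+ z. ennreal (f z) \<partial>count_space UNIV) = (\<Sum>z\<in>cube. ennreal (f z))"
  proof (rule nn_integral_count_space')
    show "finite cube" by (intro finite_cartesian_product) simp_all
    show "ennreal (f z) = 0" if "z \<notin> cube" for z using that unfolding f_def by (simp only: if_False ennreal_0)
  qed (rule subset_UNIV)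
  also have "\<dots> = ennreal (\<Sum>z\<in>cube. f z)" by (rule sum_ennreal) (rule nn)
  also have "(\<Sum>z\<in>cube. f z) = (\<Sum>z\<in>cube. aux_weight a1 a2 z)"
    by (rule sum.cong[OF refl]) (simp only: f_def if_True)
  also have "\<dots> = (\<Sum>t\<in>{0, 1}. \<Sum>x\<in>{0, 1}. \<Sum>y\<in>{0, 1}. aux_weight a1 a2 (t, x, y))"
    by (simp only: sum.cartesian_product case_prod_unfold prod.collapse)
  also have "\<dots> = 1" by (simp add: aux_weight_def) (simp add: field_simps)
  finally have "(\<integral>\<^sup>+ z. ennreal (f z) \<partial>count_space UNIV) = 1" by simp
  note p = pmf_embed_pmf[OF nn this]
  have "z \<in> cube" if "z \<in> set_pmf (embed_pmf f)" for z
  proof (rule ccontr)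
    assume "z \<notin> cube"
    then have "pmf (embed_pmf f) z = 0" unfolding p unfolding f_def by (rule if_not_P)
    then show False using that by (simp only: set_pmf_iff simp_thms)
  qed
  then have sub: "set_pmf (embed_pmf f) \<subseteq> cube" by (rule subsetI)
  have "\<forall>z\<in>cube. pmf (embed_pmf f) z = aux_weight a1 a2 z"
    unfolding p unfolding f_def by (intro ballI if_P)
  then show ?thesis unfolding uniform_aux_law_iff[OF sub, symmetric] by (rule exI)
qed

section \<open>Library entropies as finite sums\<close>

lemma distributed_measure_pmf:
  "distributed (measure_pmf P) (count_space UNIV) X (pmf (map_pmf X P))"
proof -
  have "distr (measure_pmf P) (count_space UNIV) X = density (count_space UNIV) (\<lambda>x. ennreal (pmf (map_pmf X P) x))"
    unfolding map_pmf_rep_eq[symmetric] by (rule measure_pmf_eq_density)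
  then show ?thesis by (auto simp: distributed_def)
qed

interpretation pmf_information: information_space "measure_pmf P" 2 for P
  by unfold_locales simp

lemma pmf_entropy_eq_sum:
  assumes "finite S" "set_pmf (map_pmf X P) \<subseteq> S"
  shows "pmf_entropy P X = - (\<Sum>x\<in>S. pmf (map_pmf X P) x * log 2 (pmf (map_pmf X P) x))"
proof -
  let ?p = "pmf (map_pmf X P)"
  have "pmf_entropy P X = - (\<integral>x. ?p x * log 2 (?p x) \<partial>count_space UNIV)"
    by (rule pmf_information.entropy_distr[OF distributed_measure_pmf]) simp
  also have "(\<integral>x. ?p x * log 2 (?p x) \<partial>count_space UNIV) = (\<Sum>x | x \<in> UNIV \<and> ?p x * log 2 (?p x) \<noteq> 0. ?p x * log 2 (?p x))"
    by (rule lebesgue_integral_count_space_finite_support)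
       (rule finite_subset[OF _ assms(1)], use assms(2) in \<open>auto simp: set_pmf_eq\<close>)
  also have "\<dots> = (\<Sum>x\<in>S. ?p x * log 2 (?p x))"
    by (rule sum.mono_neutral_left) (use assms in \<open>auto simp: set_pmf_eq\<close>)
  finally show ?thesis .
qed

lemma pmf_cond_entropy_eq_sum:
  assumes "finite S" "set_pmf (map_pmf (\<lambda>z. (X z, T z)) P) \<subseteq> S"
  shows "pmf_cond_entropy P X T = - (\<Sum>(x, t)\<in>S. pmf (map_pmf (\<lambda>z. (X z, T z)) P) (x, t) *
     log 2 (pmf (map_pmf (\<lambda>z. (X z, T z)) P) (x, t) / pmf (map_pmf T P) t))"
proof -
  let ?q = "pmf (map_pmf (\<lambda>z. (X z, T z)) P)" and ?r = "pmf (map_pmf T P)"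
  let ?F = "\<lambda>(x, t). ?q (x, t) * log 2 (?q (x, t) / ?r t)"
  have prod: "count_space UNIV \<Otimes>\<^sub>M count_space UNIV = (count_space UNIV :: (nat \<times> nat) measure)"
    by (subst pair_measure_countable) auto
  have "pmf_cond_entropy P X T = - (\<integral>z. ?F z \<partial>(count_space UNIV \<Otimes>\<^sub>M count_space UNIV))"
    by (rule pmf_information.conditional_entropy_generic_eq[OF _ _ distributed_measure_pmf])
       (auto simp: sigma_finite_measure_count_space prod distributed_measure_pmf)
  also have "(\<integral>z. ?F z \<partial>(count_space UNIV \<Otimes>\<^sub>M count_space UNIV)) = (\<Sum>z | z \<in> UNIV \<and> ?F z \<noteq> 0. ?F z)"
    unfolding prod
    by (rule lebesgue_integral_count_space_finite_support)
       (rule finite_subset[OF _ assms(1)], use assms(2) in \<open>auto simp: set_pmf_eq\<close>)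
  also have "\<dots> = (\<Sum>z\<in>S. ?F z)"
    by (rule sum.mono_neutral_left) (use assms in \<open>auto simp: set_pmf_eq\<close>)
  finally show ?thesis .
qed

text \<open>Given \<open>T\<close>, each input is a bit that agrees with \<open>T\<close> with
  probability \<open>a1\<close> or \<open>a2\<close>, so the inputs differ with probability
  \<open>bconv a1 a2\<close>. The uniform \<open>T\<close> makes the outputs 0 and 2 equally likely,
  and the output is then the ternary variable behind \<open>erasure_entropy\<close>.\<close>

lemma
  assumes "uniform_aux_law a1 a2 P"
  shows pmf_cond_entropy_input1: "pmf_cond_entropy P (\<lambda>(T, X1, X2). X1) (\<lambda>(T, X1, X2). T) = binary_entropy a1"
    and pmf_cond_entropy_input2: "pmf_cond_entropy P (\<lambda>(T, X1, X2). X2) (\<lambda>(T, X1, X2). T) = binary_entropy a2"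
    and pmf_entropy_output: "pmf_entropy P (\<lambda>(T, X1, X2). X1 + X2) = erasure_entropy (bconv a1 a2)"
proof -
  have P: "set_pmf P \<subseteq> cube" using assms unfolding uniform_aux_law_def by (elim conjE)
  have w: "\<forall>z\<in>cube. pmf P z = aux_weight a1 a2 z" using assms uniform_aux_law_iff[OF P] by blast
  note M = measure_pmf_cube[OF P]
  let ?T = "\<lambda>(T, X1, X2). T :: nat" and ?X1 = "\<lambda>(T, X1, X2). X1 :: nat" and ?X2 = "\<lambda>(T, X1, X2). X2 :: nat"
  have T: "pmf (map_pmf ?T P) t = (if t \<in> {0, 1} then 1/2 else 0)" for t
    unfolding pmf_map M by (auto simp: w aux_weight_def) (simp_all add: field_simps)
  have X1T: "pmf (map_pmf (\<lambda>z. (?X1 z, ?T z)) P) (x, t) = (if x = t then a1 else 1 - a1) / 2"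
    if "x \<in> {0, 1}" "t \<in> {0, 1}" for x t
    using that unfolding pmf_map M by (auto simp: w aux_weight_def) (simp_all add: field_simps)
  have X2T: "pmf (map_pmf (\<lambda>z. (?X2 z, ?T z)) P) (x, t) = (if x = t then a2 else 1 - a2) / 2"
    if "x \<in> {0, 1}" "t \<in> {0, 1}" for x t
    using that unfolding pmf_map M by (auto simp: w aux_weight_def) (simp_all add: field_simps)
  have half: "(2 - c * 2) / 2 = 1 - c" for c :: real by simp
  have sum4: "(\<Sum>(x, t)\<in>{0, 1} \<times> {0, 1}. F x t) = F 0 0 + F 0 1 + F 1 0 + F 1 1" for F :: "nat \<Rightarrow> nat \<Rightarrow> real"
    by (simp add: sum.cartesian_product[symmetric])
  have "pmf_cond_entropy P ?X1 ?T = - (\<Sum>(x, t)\<in>{0, 1} \<times> {0, 1}. pmf (map_pmf (\<lambda>z. (?X1 z, ?T z)) P) (x, t) *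
     log 2 (pmf (map_pmf (\<lambda>z. (?X1 z, ?T z)) P) (x, t) / pmf (map_pmf ?T P) t))"
    by (rule pmf_cond_entropy_eq_sum) (use P in auto)
  also have "\<dots> = binary_entropy a1"
    unfolding sum4 T by (simp add: X1T binary_entropy_def half)
  finally show "pmf_cond_entropy P ?X1 ?T = binary_entropy a1" .
  have "pmf_cond_entropy P ?X2 ?T = - (\<Sum>(x, t)\<in>{0, 1} \<times> {0, 1}. pmf (map_pmf (\<lambda>z. (?X2 z, ?T z)) P) (x, t) *
     log 2 (pmf (map_pmf (\<lambda>z. (?X2 z, ?T z)) P) (x, t) / pmf (map_pmf ?T P) t))"
    by (rule pmf_cond_entropy_eq_sum) (use P in auto)
  also have "\<dots> = binary_entropy a2"
    unfolding sum4 T by (simp add: X2T binary_entropy_def half)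
  finally show "pmf_cond_entropy P ?X2 ?T = binary_entropy a2" .
  let ?Y = "\<lambda>(T, X1, X2). X1 + X2 :: nat" and ?s = "bconv a1 a2"
  have Y: "pmf (map_pmf ?Y P) 0 = (1 - ?s) / 2" "pmf (map_pmf ?Y P) 1 = ?s" "pmf (map_pmf ?Y P) 2 = (1 - ?s) / 2"
    unfolding pmf_map M by (simp_all add: w aux_weight_def bconv_def) (simp_all add: field_simps)
  have "?s \<le> 1" using pmf_nonneg[of "map_pmf ?Y P" 0] unfolding Y by simp
  then have l: "(1 - ?s) * log 2 ((1 - ?s) / 2) = (1 - ?s) * (log 2 (1 - ?s) - 1)"
    by (cases "?s = 1") (simp_all add: log_divide)
  have "pmf_entropy P ?Y = - (\<Sum>y\<in>{0, 1, 2}. pmf (map_pmf ?Y P) y * log 2 (pmf (map_pmf ?Y P) y))"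
    by (rule pmf_entropy_eq_sum) (use P in auto)
  also have "\<dots> = - ((1 - ?s) * log 2 ((1 - ?s) / 2) + ?s * log 2 ?s)"
    by (simp add: Y[unfolded One_nat_def])
  also have "\<dots> = erasure_entropy ?s"
    unfolding l by (simp add: erasure_entropy_def binary_entropy_def algebra_simps)
  finally show "pmf_entropy P ?Y = erasure_entropy ?s" .
qed

theorem mainTheorem5:
  shows "binary_erasure.capacity_region =
      (\<Union>u1\<in>{0..1/4}. \<Union>u2\<in>{0..1/4}. {(R1, R2). 0 \<le> R1 \<and> 0 \<le> R2 \<and>
         R1 \<le> binary_entropy (phi (2 * u1)) \<and>
         R2 \<le> binary_entropy (phi (2 * u2)) \<and>
         R1 + R2 \<le> binary_entropy (phi_cross (2 * u1) (2 * u2)) + 1 - phi_cross (2 * u1) (2 * u2)})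
    \<and> binary_erasure.capacity_region =
      (\<Union>u1\<in>{0..1/4}. \<Union>u2\<in>{0..1/4}. \<Union>P\<in>{P. uniform_aux_law (phi (2 * u1)) (phi (2 * u2)) P}.
         {(R1, R2). 0 \<le> R1 \<and> 0 \<le> R2 \<and>
            R1 \<le> pmf_cond_entropy P (\<lambda>(T, X1, X2). X1) (\<lambda>(T, X1, X2). T) \<and>
            R2 \<le> pmf_cond_entropy P (\<lambda>(T, X1, X2). X2) (\<lambda>(T, X1, X2). T) \<and>
            R1 + R2 \<le> pmf_entropy P (\<lambda>(T, X1, X2). X1 + X2)})"
proof -
  have cap: "binary_erasure.capacity_region = rate_region"
    using capacity_region_subset rate_region_subset by (rule equalityI)
  have region: "rate_region = (\<Union>u1\<in>{0..1/4}. \<Union>u2\<in>{0..1/4}. pentagon (phi (2 * u1)) (phi (2 * u2)))"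
    unfolding rate_region_def phi_image[symmetric] image_image by simp
  let ?Q = "\<lambda>P. {(R1, R2). 0 \<le> R1 \<and> 0 \<le> R2 \<and>
            R1 \<le> pmf_cond_entropy P (\<lambda>(T, X1, X2). X1) (\<lambda>(T, X1, X2). T) \<and>
            R2 \<le> pmf_cond_entropy P (\<lambda>(T, X1, X2). X2) (\<lambda>(T, X1, X2). T) \<and>
            R1 + R2 \<le> pmf_entropy P (\<lambda>(T, X1, X2). X1 + X2)}"
  \<comment> \<open>Every admissible law yields the same pentagon, so the union over laws is a union
    of a nonempty constant family.\<close>
  have aux: "(\<Union>P\<in>{P. uniform_aux_law a b P}. ?Q P) = pentagon a b"
    if ab: "a \<in> {0..1/2}" "b \<in> {0..1/2}" for a b
  proof -
    obtain P where P: "uniform_aux_law a b P" using ex_uniform_aux_law[of a b] ab by auto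
    then have ne: "{P. uniform_aux_law a b P} \<noteq> {}" by blast
    have "(\<Union>P\<in>{P. uniform_aux_law a b P}. ?Q P)
        = (\<Union>P\<in>{P. uniform_aux_law a b P}. pentagon a b)"
      by (rule SUP_cong[OF refl])
         (simp only: mem_Collect_eq pentagon_def pmf_cond_entropy_input1 pmf_cond_entropy_input2 pmf_entropy_output)
    also have "\<dots> = pentagon a b" using ne by (simp only: UN_constant if_False)
    finally show ?thesis .
  qed
  have phi: "phi (2 * u) \<in> {0..1/2}" if "u \<in> {0..1/4}" for u
    using phi_image imageI[OF that, of "\<lambda>u. phi (2 * u)"] by (simp only:)
  show ?thesis
    unfolding cap region
  proof (intro conjI SUP_cong refl)
    show "pentagon (phi (2 * u1)) (phi (2 * u2)) = {(R1, R2). 0 \<le> R1 \<and> 0 \<le> R2 \<and>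
         R1 \<le> binary_entropy (phi (2 * u1)) \<and>
         R2 \<le> binary_entropy (phi (2 * u2)) \<and>
         R1 + R2 \<le> binary_entropy (phi_cross (2 * u1) (2 * u2)) + 1 - phi_cross (2 * u1) (2 * u2)}" for u1 u2
      by (simp only: pentagon_def erasure_entropy_def phi_cross_eq)
  qed (rule aux[symmetric]; rule phi; assumption)
qed

end
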